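(* For every admissible initial datum $(t_0,u_0,p_0)\in\mathbb D$ there exist $\tau>0$ and a solution of the impact problem with data $(t_0,u_0,p_0)$ defined on $[t_0,t_0+\tau]$.
   Context: Data. $d\ge1$, $T>0$, $e\in[0,1]$. $K\subset\mathbb R^d$ is closed with non-empty interior, $\partial K$ is an embedded submanifold (hypersurface) of class $C^3$, and $K$ lies on only one side of $\partial K$; $\phi:\mathbb R^d\to\mathbb R$ is of class $C^3$ with $K=\{\phi\ge0\}$, $\partial K=\{\phi=0\}$ and $d\phi\neq0$ on $\partial K$. $M$ is a $C^3$ map from $\mathbb R^d$ to symmetric positive definite $d\times d$ matrices. $f:[0,T]\times\mathbb R^d\times\mathbb R^d\to\mathbb R^d$ is continuous and locally Lipschitz continuous in its last two arguments. For covectors, $\langle\xi,\eta\rangle_u^*=\xi^TM(u)^{-1}\eta$. Admissible data. $\mathbb D=\{(t_0,u_0,p_0)\in[0,T)\times K\times\mathbb R^d:\ \text{if }u_0\in\partial K\text{ then }\langle p_0,d\phi(u_0)\rangle_{u_0}^*\ge0\}$. Impact problem. A solution on $[t_0,t_0+\tau]$ (with $t_0+\tau\le T$) is a continuous $u:[t_0,t_0+\tau]\to K$ with $\dot u$ of bounded variation such that, with $p=M(u)\dot u$, there is an $\mathbb R^d$-valued measure $\mu$ with $M(u)\ddot u=\mu+f(\cdot,u,p)$ in the sense of measures, $\mathrm{supp}(\mu)\subset\{t:\phi(u(t))=0\}$, $\mu=\lambda\,d\phi(u)$ with $\lambda$ a nonnegative scalar measure; such that at every $t\in(t_0,t_0+\tau)$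 with $u(t)\in\partial K$ $$p(t+0)=p(t-0)-(1+e)\frac{\langle d\phi(u(t)),p(t-0)\rangle_{u(t)}^*}{\langle d\phi(u(t)),d\phi(u(t))\rangle_{u(t)}^*}\,d\phi(u(t));$$ and such that $u(t_0)=u_0$, $p(t_0+0)=p_0$. *)

theory Defs
  imports "HOL-Analysis.Analysis"
begin

subsection \<open>Smoothness and hypersurfaces\<close>

text \<open>Class \<open>C\<^sup>k\<close> on an open set of a Euclidean space, by recursion through all directional
  derivatives \<open>x \<mapsto> Df(x)v\<close>.\<close>

primrec Ck_on :: "nat \<Rightarrow> ('a::euclidean_space \<Rightarrow> 'b::real_normed_vector) \<Rightarrow> 'a set \<Rightarrow> bool" where
  "Ck_on 0 f U \<longleftrightarrow> continuous_on U f"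
| "Ck_on (Suc k) f U \<longleftrightarrow>
     (\<forall>x\<in>U. f differentiable (at x)) \<and> (\<forall>v. Ck_on k (\<lambda>x. frechet_derivative f (at x) v) U)"

text \<open>The covector \<open>d\<phi>(x)\<close>, given by its components \<open>\<partial>\<^sub>i\<phi>(x)\<close>.\<close>

definition dcov :: "(real^'n \<Rightarrow> real) \<Rightarrow> real^'n \<Rightarrow> real^'n" where
  "dcov \<phi> x = (\<chi> i. frechet_derivative \<phi> (at x) (axis i 1))"

definition local_defining_function ::
    "(real^'n) set \<Rightarrow> real^'n \<Rightarrow> (real^'n) set \<Rightarrow> (real^'n \<Rightarrow> real) \<Rightarrow> bool" where
  "local_defining_function S x U g \<longleftrightarrow>
     open U \<and> x \<in> U \<and> Ck_on 3 g U \<and> (\<forall>y\<in>U. dcov g y \<noteq> 0) \<and> S \<inter> U = {y\<in>U. g y = 0}"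

definition C3_hypersurface :: "(real^'n) set \<Rightarrow> bool" where
  "C3_hypersurface S \<longleftrightarrow> (\<forall>x\<in>S. \<exists>U g. local_defining_function S x U g)"

text \<open>\<open>K\<close> lies on only one side of its boundary: near each boundary point it is one of the two
  closed sides \<open>{g \<ge> 0}\<close>, \<open>{g \<le> 0}\<close> of a local defining function of the boundary
  (replacing \<open>g\<close> by \<open>-g\<close>, the first one).\<close>

definition on_one_side_of_boundary :: "(real^'n) set \<Rightarrow> bool" where
  "on_one_side_of_boundary K \<longleftrightarrow>
     (\<forall>x\<in>frontier K. \<exists>U g. local_defining_function (frontier K) x U g \<and> K \<inter> U = {y\<in>U. g y \<ge> 0})"

subsection \<open>The mass matrix\<close>

definition sym_pos_def :: "real^'n^'n \<Rightarrow> bool" where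
  "sym_pos_def A \<longleftrightarrow> transpose A = A \<and> (\<forall>x. x \<noteq> 0 \<longrightarrow> x \<bullet> (A *v x) > 0)"

definition dual_inner :: "(real^'n \<Rightarrow> real^'n^'n) \<Rightarrow> real^'n \<Rightarrow> real^'n \<Rightarrow> real^'n \<Rightarrow> real" where
  "dual_inner M x \<xi> \<eta> = \<xi> \<bullet> (matrix_inv (M x) *v \<eta>)"

subsection \<open>Functions of bounded variation and vector-valued measures on an interval\<close>

definition bounded_variation_on :: "real \<Rightarrow> real \<Rightarrow> (real \<Rightarrow> 'a::real_normed_vector) \<Rightarrow> bool" where
  "bounded_variation_on a b v \<longleftrightarrow>
     (\<exists>C. \<forall>(n::nat) s. mono_on {..n} s \<and> s ` {..n} \<subseteq> {a..b} \<longrightarrow>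
        (\<Sum>i<n. norm (v (s (Suc i)) - v (s i))) \<le> C)"

text \<open>Vector-valued measures on \<open>I\<close> are countably additive set functions; only their values on
  Borel subsets of \<open>I\<close> are meaningful.\<close>

definition vector_measure_on :: "real set \<Rightarrow> (real set \<Rightarrow> 'a::real_normed_vector) \<Rightarrow> bool" where
  "vector_measure_on I \<nu> \<longleftrightarrow> \<nu> {} = 0 \<and>
     (\<forall>A::nat \<Rightarrow> real set. disjoint_family A \<and> (\<forall>n. A n \<in> sets borel \<and> A n \<subseteq> I) \<longrightarrow>
        (\<lambda>n. \<nu> (A n)) sums \<nu> (\<Union>n. A n))"

definition vm_support :: "real set \<Rightarrow> (real set \<Rightarrow> 'a::real_normed_vector) \<Rightarrow> real set" where
  "vm_support I \<nu> =
     {t\<in>I. \<forall>U. open U \<and> t \<in> U \<longrightarrow> (\<exists>B\<in>sets borel. B \<subseteq> U \<inter> I \<and> \<nu> B \<noteq> 0)}"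

text \<open>\<open>\<nu> = g \<cdot> m\<close> on \<open>I\<close>, for a nonnegative Borel measure \<open>m\<close>.\<close>

definition has_vm_density ::
    "real set \<Rightarrow> (real set \<Rightarrow> 'a::{banach,second_countable_topology}) \<Rightarrow> real measure \<Rightarrow> (real \<Rightarrow> 'a) \<Rightarrow> bool" where
  "has_vm_density I \<nu> m g \<longleftrightarrow>
     (\<forall>B\<in>sets borel. B \<subseteq> I \<longrightarrow> set_integrable m B g \<and> \<nu> B = (LINT s:B|m. g s))"

text \<open>\<open>\<kappa> = A \<cdot> \<nu>\<close>, the product of a matrix-valued function and a vector-valued measure. Every
  \<open>real^'n\<close>-valued measure can be written \<open>\<nu> = g \<cdot> m\<close> with \<open>m\<close> finite (e.g. its total variation),
  and then \<open>A \<cdot> \<nu> = (A g) \<cdot> m\<close>, which does not depend on the choice of \<open>m\<close> and \<open>g\<close>.\<close>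

definition is_matrix_times_vm ::
    "real set \<Rightarrow> (real set \<Rightarrow> real^'n) \<Rightarrow> (real \<Rightarrow> real^'n^'n) \<Rightarrow> (real set \<Rightarrow> real^'n) \<Rightarrow> bool" where
  "is_matrix_times_vm I \<kappa> A \<nu> \<longleftrightarrow>
     (\<exists>m g. finite_measure m \<and> sets m = sets borel \<and>
        has_vm_density I \<nu> m g \<and> has_vm_density I \<kappa> m (\<lambda>s. A s *v g s))"

text \<open>\<open>\<nu>\<close> is the derivative, as a measure on the open interval \<open>(a,b)\<close>, of the function \<open>v\<close> of
  bounded variation (its Stieltjes measure).\<close>

definition is_derivative_measure ::
    "real \<Rightarrow> real \<Rightarrow> (real set \<Rightarrow> 'a::real_normed_vector) \<Rightarrow> (real \<Rightarrow> 'a) \<Rightarrow> bool" where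
  "is_derivative_measure a b \<nu> v \<longleftrightarrow> vector_measure_on {a<..<b} \<nu> \<and>
     (\<forall>c d. a < c \<and> c \<le> d \<and> d < b \<longrightarrow> \<nu> {c<..d} = Lim (at_right d) v - Lim (at_right c) v)"

subsection \<open>The impact problem\<close>

definition admissible_data ::
    "real \<Rightarrow> (real^'n) set \<Rightarrow> (real^'n \<Rightarrow> real) \<Rightarrow> (real^'n \<Rightarrow> real^'n^'n) \<Rightarrow> (real \<times> (real^'n) \<times> (real^'n)) set" where
  "admissible_data T K \<phi> M =
     {(t0, u0, p0). 0 \<le> t0 \<and> t0 < T \<and> u0 \<in> K \<and>
        (u0 \<in> frontier K \<longrightarrow> dual_inner M u0 p0 (dcov \<phi> u0) \<ge> 0)}"

text \<open>Newton's impact law at time \<open>t\<close>, for the position \<open>x = u(t)\<close>.\<close>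

definition impact_law ::
    "real \<Rightarrow> (real^'n \<Rightarrow> real) \<Rightarrow> (real^'n \<Rightarrow> real^'n^'n) \<Rightarrow> real^'n \<Rightarrow> (real \<Rightarrow> real^'n) \<Rightarrow> real \<Rightarrow> bool" where
  "impact_law e \<phi> M x p t \<longleftrightarrow>
     Lim (at_right t) p = Lim (at_left t) p -
       ((1 + e) * (dual_inner M x (dcov \<phi> x) (Lim (at_left t) p)
                   / dual_inner M x (dcov \<phi> x) (dcov \<phi> x))) *\<^sub>R dcov \<phi> x"

text \<open>Since \<open>u\<close> need not be differentiable at impact times, its velocity is a function \<open>v\<close> of
  bounded variation of which \<open>u\<close> is a primitive; such a \<open>v\<close> is determined up to a countable set, and
  its one-sided limits, hence \<open>p(t \<plusminus> 0)\<close> and the measure \<open>ddu\<close>, are unique.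
  The equation is one between measures on the open interval, so that no jump of the velocity
  at the end points is involved.\<close>

definition impact_solution ::
    "real \<Rightarrow> (real^'n) set \<Rightarrow> (real^'n \<Rightarrow> real) \<Rightarrow> (real^'n \<Rightarrow> real^'n^'n) \<Rightarrow>
     (real \<Rightarrow> real^'n \<Rightarrow> real^'n \<Rightarrow> real^'n) \<Rightarrow>
     real \<Rightarrow> real^'n \<Rightarrow> real^'n \<Rightarrow> real \<Rightarrow> (real \<Rightarrow> real^'n) \<Rightarrow> bool" where
  "impact_solution e K \<phi> M f t0 u0 p0 \<tau> u \<longleftrightarrow>
     continuous_on {t0..t0+\<tau>} u \<and> u ` {t0..t0+\<tau>} \<subseteq> K \<and>
     (\<exists>v p. bounded_variation_on t0 (t0+\<tau>) v \<and>
        (\<forall>t\<in>{t0..t0+\<tau>}. (v has_integral (u t - u t0)) {t0..t}) \<and>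
        p = (\<lambda>t. M (u t) *v v t) \<and>
        (\<exists>ddu Mddu \<mu> F lam.
           is_derivative_measure t0 (t0+\<tau>) ddu v \<and>
           is_matrix_times_vm {t0<..<t0+\<tau>} Mddu (\<lambda>t. M (u t)) ddu \<and>
           vector_measure_on {t0<..<t0+\<tau>} \<mu> \<and>
           has_vm_density {t0<..<t0+\<tau>} F lborel (\<lambda>t. f t (u t) (p t)) \<and>
           (\<forall>B\<in>sets borel. B \<subseteq> {t0<..<t0+\<tau>} \<longrightarrow> Mddu B = \<mu> B + F B) \<and>
           vm_support {t0<..<t0+\<tau>} \<mu> \<subseteq> {t. \<phi> (u t) = 0} \<and>
           finite_measure lam \<and> sets lam = sets borel \<and>
           has_vm_density {t0<..<t0+\<tau>} \<mu> lam (\<lambda>t. dcov \<phi> (u t))) \<and>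
        (\<forall>t\<in>{t0<..<t0+\<tau>}. u t \<in> frontier K \<longrightarrow> impact_law e \<phi> M (u t) p t) \<and>
        u t0 = u0 \<and> (p \<longlongrightarrow> p0) (at_right t0))"

end

theory Submission
  imports Defs "HOL-Complex_Analysis.Great_Picard"
begin

text \<open>
  Write \<open>v\<close> for the velocity, \<open>G = M\<^sup>-\<^sup>1 f\<close>, \<open>n = M\<^sup>-\<^sup>1 d\<phi>\<close> and
  \<open>w = d\<phi>(u) \<bullet> v\<close> for the normal speed. In terms of the velocity the problem reads
  \<open>dv = G(t, u, v) dt + n(u) d\<lambda>\<close> with \<open>\<lambda> \<ge> 0\<close> carried by the contact times, and the impact law is
  \<open>w(t+0) = - e w(t-0)\<close>. Impacts may accumulate, in particular at the initial time when the data are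
  tangential, so a solution cannot be built by following the motion from one impact to the next.
  It is obtained as a limit of Euler polygons whose velocity receives an impulse along \<open>n\<close>,
  reversing the normal speed with the factor \<open>e\<close>, whenever \<open>\<phi> \<le> 0\<close> and the normal speed is negative.

  The argument rests on the function \<open>rebound e w = max w (- e w)\<close>. An impulse does not change it
  (lemma \<open>rebound_impulse\<close>), and it is 1-Lipschitz because \<open>0 \<le> e \<le> 1\<close>. Along the polygons it is
  therefore Lipschitz in time, uniformly in the step size, no matter how many impulses occur.

  This gives the a priori bounds: \<open>w \<le> rebound e w\<close> grows at most linearly, so that the
  impulses spent up to time \<open>t\<close> add up to at most a constant times \<open>t - t0\<close>, and the velocity stays
  close to its initial value (lemma \<open>scheme_in_balls\<close>). It also gives the impact law in the limit:
  the Lipschitz estimate is preserved by pointwise convergence, so that \<open>rebound e\<close> takes the same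
  value at \<open>w(t-0)\<close> and at \<open>w(t+0)\<close>. At a contact time the constraint forces
  \<open>w(t-0) \<le> 0 \<le> w(t+0)\<close>, and there the equality says \<open>w(t+0) = - e w(t-0)\<close>.

  Compactness comes from Helly's selection theorem, the total impulse being the dominating
  monotone function (lemma \<open>helly_selection_dominated\<close>). The equation of motion is carried to the limit
  as an estimate for increments whose error is negligible when it is summed over fine partitions
  (lemmas \<open>velocity_increment\<close> and \<open>constant_if_increments_small\<close>). The limit \<open>\<Lambda>\<close> of the total impulses
  is, up to right-continuity, the distribution function of \<open>\<lambda>\<close>.
\<close>

section \<open>Functions with dominated increments\<close>

text \<open>
  Summing the estimate over a partition of mesh \<open>\<delta>\<close> bounds \<open>E t - E s\<close> by
  \<open>(\<epsilon> + C \<delta>) (Q t - Q s)\<close>; let \<open>\<delta>\<close> and then \<open>\<epsilon>\<close> tend to \<open>0\<close>. The term \<open>C (t - s) (Q t - Q s)\<close> absorbs errors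
  that are small only after summation, such as those caused by jumps of the velocity.
\<close>
lemma constant_if_increments_small:
  fixes E :: "real \<Rightarrow> 'a::real_normed_vector" and Q :: "real \<Rightarrow> real"
  assumes mono: "\<And>s t. a \<le> s \<Longrightarrow> s \<le> t \<Longrightarrow> t \<le> b \<Longrightarrow> Q s \<le> Q t"
    and small: "\<And>\<epsilon>. \<epsilon> > 0 \<Longrightarrow> \<exists>C. \<forall>s t. a \<le> s \<longrightarrow> s \<le> t \<longrightarrow> t \<le> b \<longrightarrow>
            norm (E t - E s) \<le> (\<epsilon> + C * (t - s)) * (Q t - Q s)"
    and st: "a \<le> s" "s \<le> t" "t \<le> b"
  shows "E t = E s"
proof -
  have key: "norm (E t - E s) \<le> \<epsilon> * (Q t - Q s)" if eps: "\<epsilon> > 0" for \<epsilon>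
  proof -
    obtain C where C: "\<And>s t. a \<le> s \<Longrightarrow> s \<le> t \<Longrightarrow> t \<le> b \<Longrightarrow>
            norm (E t - E s) \<le> (\<epsilon> + C * (t - s)) * (Q t - Q s)"
      using small[OF eps] by blast
    \<comment> \<open>the uniform partition into \<open>N + 1\<close> intervals\<close>
    have bound: "norm (E t - E s) \<le> (\<epsilon> + C * ((t - s) / real (Suc N))) * (Q t - Q s)" for N
    proof -
      define d where "d = (t - s) / real (Suc N)"
      define q where "q i = s + real i * d" for i
      have d0: "d \<ge> 0" unfolding d_def using st by simp
      have qN: "q (Suc N) = t" and q0: "q 0 = s"
        unfolding q_def d_def by simp_all
      have qm: "q i \<le> q j" if "i \<le> j" for i j
        unfolding q_def using that d0 by (simp add: mult_right_mono)
      have "norm (E t - E s) = norm (\<Sum>i<Suc N. E (q (Suc i)) - E (q i))"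
        by (simp only: sum_lessThan_telescope[of "\<lambda>i. E (q i)"] qN q0)
      also have "\<dots> \<le> (\<Sum>i<Suc N. norm (E (q (Suc i)) - E (q i)))"
        by (rule norm_sum)
      also have "\<dots> \<le> (\<Sum>i<Suc N. (\<epsilon> + C * d) * (Q (q (Suc i)) - Q (q i)))"
      proof (rule sum_mono)
        fix i assume "i \<in> {..<Suc N}"
        then have i: "Suc i \<le> Suc N" by simp
        have "q (Suc i) - q i = d" unfolding q_def by (simp add: algebra_simps)
        moreover have "a \<le> q i" using qm[of 0 i] q0 st by simp
        moreover have "q (Suc i) \<le> b" using qm[OF i] qN st by simp
        moreover have "q i \<le> q (Suc i)" by (rule qm) simp
        ultimately show "norm (E (q (Suc i)) - E (q i)) \<le> (\<epsilon> + C * d) * (Q (q (Suc i)) - Q (q i))"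
          using C[of "q i" "q (Suc i)"] by simp
      qed
      also have "\<dots> = (\<epsilon> + C * d) * (Q t - Q s)"
        by (simp only: sum_distrib_left[symmetric] sum_lessThan_telescope[of "\<lambda>i. Q (q i)"] qN q0)
      finally show ?thesis unfolding d_def .
    qed
    have "(\<lambda>N. (\<epsilon> + C * ((t - s) * inverse (real (Suc N)))) * (Q t - Q s))
        \<longlonglongrightarrow> (\<epsilon> + C * ((t - s) * 0)) * (Q t - Q s)"
      by (intro tendsto_intros LIMSEQ_inverse_real_of_nat)
    then show ?thesis
      using bound by (intro LIMSEQ_le_const) (auto simp: divide_inverse)
  qed
  have "norm (E t - E s) \<le> 0"
  proof (rule tendsto_lowerbound)
    show "((\<lambda>\<epsilon>. \<epsilon> * (Q t - Q s)) \<longlongrightarrow> 0) (at_right 0)"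
      by (rule tendsto_eq_intros refl | simp)+
    show "\<forall>\<^sub>F \<epsilon> in at_right 0. norm (E t - E s) \<le> \<epsilon> * (Q t - Q s)"
      by (rule eventually_mono[OF eventually_at_right_less]) (rule key)
  qed simp
  then show ?thesis by simp
qed

text \<open>
  Uniform continuity takes care of close points; for distant ones the slope \<open>C\<close> is chosen so
  steep that the bound of \<open>f\<close> suffices. This form of a modulus of continuity remains useful when
  the arguments jump, since the distances can be summed.
\<close>
lemma continuous_on_compact_almost_lipschitz:
  fixes f :: "'a::metric_space \<Rightarrow> 'b::real_normed_vector"
  assumes "continuous_on S f" "compact S" "\<epsilon> > 0"
  obtains C where "C \<ge> 0" "\<And>x y. x \<in> S \<Longrightarrow> y \<in> S \<Longrightarrow> norm (f x - f y) \<le> \<epsilon> + C * dist x y"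
proof -
  obtain d where d: "d > 0" "\<And>x y. x \<in> S \<Longrightarrow> y \<in> S \<Longrightarrow> dist y x < d \<Longrightarrow> dist (f y) (f x) < \<epsilon>"
    using compact_uniformly_continuous[OF assms(1,2)] assms(3)
    unfolding uniformly_continuous_on_def by metis
  have "bounded (f ` S)"
    using assms compact_continuous_image compact_imp_bounded by blast
  then obtain B where B: "B > 0" "\<And>x. x \<in> S \<Longrightarrow> norm (f x) \<le> B"
    by (auto simp: bounded_pos)
  have "norm (f x - f y) \<le> \<epsilon> + (2 * B / d) * dist x y" if "x \<in> S" "y \<in> S" for x y
  proof (cases "dist x y < d")
    case True
    then have "norm (f x - f y) < \<epsilon>"
      using d(2)[of y x] that by (simp add: dist_norm)
    then show ?thesis
      using B(1) d(1) by (smt (verit) divide_nonneg_pos mult_nonneg_nonneg zero_le_dist)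
  next
    case False
    have "norm (f x - f y) \<le> 2 * B"
      using B(2)[of x] B(2)[of y] that norm_triangle_ineq4[of "f x" "f y"] by linarith
    also have "\<dots> \<le> (2 * B / d) * dist x y"
    proof -
      have "2 * B * d \<le> 2 * B * dist x y"
        using False B(1) by (intro mult_left_mono) auto
      then show ?thesis using d(1) by (simp add: field_simps)
    qed
    finally show ?thesis using assms(3) by simp
  qed
  then show ?thesis using B(1) d(1) that[of "2 * B / d"] by simp
qed

text \<open>
  The dominating function is monotone, hence has right limits, and makes \<open>z\<close> satisfy Cauchy's criterion.
\<close>
lemma dominated_right_limit:
  fixes z :: "real \<Rightarrow> 'b::banach" and Q :: "real \<Rightarrow> real"
  assumes inc: "\<And>s t. s \<le> t \<Longrightarrow> norm (z t - z s) \<le> Q t - Q s"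
  shows "\<exists>l. (z \<longlongrightarrow> l) (at_right a)"
proof -
  have mono: "Q s \<le> Q t" if "s \<le> t" for s t
    using order_trans[OF norm_ge_zero inc[OF that]] by simp
  define q where "q k = a + inverse (real (Suc k))" for k
  have qa: "q k > a" for k unfolding q_def by simp
  have qdec: "q l \<le> q k" if "k \<le> l" for k l
    unfolding q_def using that by (simp add: le_imp_inverse_le)
  have Qconv: "convergent (\<lambda>k. Q (q k))"
    unfolding convergent_minus_iff[of "\<lambda>k. Q (q k)"]
  proof (rule Bseq_mono_convergent)
    show "\<forall>m. \<forall>n\<ge>m. - Q (q m) \<le> - Q (q n)" using mono qdec by simp
    have "norm (- Q (q k)) \<le> \<bar>Q a\<bar> + \<bar>Q (q 0)\<bar>" for k
      using mono[of a "q k"] mono[of "q k" "q 0"] qa[of k] qdec[of 0 k] by auto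
    then show "Bseq (\<lambda>k. - Q (q k))" by (rule BseqI')
  qed
  then obtain Ql where Ql: "(\<lambda>k. Q (q k)) \<longlonglongrightarrow> Ql" by (auto simp: convergent_def)
  have Qge: "Ql \<le> Q (q k)" for k
    by (rule decseq_ge[OF _ Ql]) (use mono qdec in \<open>auto simp: decseq_def\<close>)
  have "Cauchy (\<lambda>k. z (q k))"
  proof (rule metric_CauchyI)
    fix e :: real assume "e > 0"
    then obtain k where k: "\<bar>Q (q k) - Ql\<bar> < e / 2"
      using Ql[THEN LIMSEQ_D, of "e/2"] by (auto simp: dist_real_def)
    have "dist (z (q m)) (z (q k)) < e/2" if "m \<ge> k" for m
      using inc[OF qdec[OF that]] k Qge[of m]
      unfolding dist_norm norm_minus_commute[of "z (q m)"] by linarith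
    then show "\<exists>M. \<forall>m\<ge>M. \<forall>n\<ge>M. dist (z (q m)) (z (q n)) < e"
      by (meson dist_triangle_half_l)
  qed
  then obtain l where l: "(\<lambda>k. z (q k)) \<longlonglongrightarrow> l"
    by (auto simp: Cauchy_convergent_iff convergent_def)
  have est: "norm (z s - l) \<le> Q s - Ql" if "s > a" for s
  proof (rule LIMSEQ_le)
    show "(\<lambda>k. norm (z s - z (q k))) \<longlonglongrightarrow> norm (z s - l)" by (intro tendsto_intros l)
    show "(\<lambda>k. Q s - Q (q k)) \<longlonglongrightarrow> Q s - Ql" by (intro tendsto_intros Ql)
    have "eventually (\<lambda>k. inverse (real (Suc k)) < s - a) sequentially"
      using order_tendstoD(2)[OF LIMSEQ_inverse_real_of_nat] that by simp
    then show "\<exists>N. \<forall>k\<ge>N. norm (z s - z (q k)) \<le> Q s - Q (q k)"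
      unfolding eventually_sequentially
      by (metis add.commute inc less_diff_eq less_imp_le q_def)
  qed
  have "(z \<longlongrightarrow> l) (at_right a)"
  proof (rule tendstoI)
    fix e :: real assume "e > 0"
    then obtain k where k: "\<bar>Q (q k) - Ql\<bar> < e"
      using Ql[THEN LIMSEQ_D, of e] by (auto simp: dist_real_def)
    have "dist (z s) l < e" if "s > a" "s < q k" for s
      using est[OF that(1)] mono[of s "q k"] that k by (simp add: dist_norm)
    then show "\<forall>\<^sub>F s in at_right a. dist (z s) l < e"
      using qa[of k] by (auto simp: eventually_at_right_field)
  qed
  then show ?thesis ..
qed

lemma dominated_left_limit:
  fixes z :: "real \<Rightarrow> 'b::banach" and Q :: "real \<Rightarrow> real"
  assumes inc: "\<And>s t. s \<le> t \<Longrightarrow> norm (z t - z s) \<le> Q t - Q s"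
  shows "\<exists>l. (z \<longlongrightarrow> l) (at_left a)"
proof -
  have "\<exists>l. ((\<lambda>s. z (- s)) \<longlongrightarrow> l) (at_right (- a))"
  proof (rule dominated_right_limit[where Q = "\<lambda>s. - Q (- s)"])
    show "norm (z (- t) - z (- s)) \<le> - Q (- t) - - Q (- s)" if "s \<le> t" for s t
      using inc[of "- t" "- s"] that by (simp add: norm_minus_commute)
  qed
  then show ?thesis
    by (simp add: filterlim_at_left_to_right)
qed

lemma convergent_PairD:
  assumes "convergent (\<lambda>k. (f k, g k))"
  shows "convergent f" "convergent g"
proof -
  obtain l where l: "(\<lambda>k. (f k, g k)) \<longlonglongrightarrow> l"
    using assms unfolding convergent_def by blast
  show "convergent f" "convergent g"
    using tendsto_fst[OF l] tendsto_snd[OF l] by (auto intro: convergentI)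
qed

text \<open>
  Helly's selection theorem for functions whose increments are dominated by those of monotone ones.
  A subsequence that converges at the rational points converges wherever the monotone limit \<open>F\<close> of
  the \<open>Q k\<close> is continuous, as there the increments of \<open>z k\<close> between nearby rationals are small. The
  exceptional points are countable, and a second extraction treats them.
\<close>
lemma helly_selection_dominated:
  fixes z :: "nat \<Rightarrow> real \<Rightarrow> 'b::euclidean_space" and Q :: "nat \<Rightarrow> real \<Rightarrow> real"
  assumes inc: "\<And>k s t. s \<le> t \<Longrightarrow> norm (z k t - z k s) \<le> Q k t - Q k s"
    and bz: "\<And>k t. norm (z k t) \<le> B" and bQ: "\<And>k t. \<bar>Q k t\<bar> \<le> B"
  obtains r where "strict_mono (r :: nat \<Rightarrow> nat)" "\<And>t. convergent (\<lambda>k. z (r k) t)"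
    "\<And>t. convergent (\<lambda>k. Q (r k) t)"
proof -
  have sel: "\<exists>r. strict_mono (r :: nat \<Rightarrow> nat) \<and> (\<forall>t\<in>S. convergent (\<lambda>k. (z (r (k::nat)) t, Q (r k) t)))"
    if S: "countable S" and z: "\<And>k t. norm (z k t) \<le> B" and Q: "\<And>k t. \<bar>Q k t\<bar> \<le> B"
    for S and z :: "nat \<Rightarrow> real \<Rightarrow> 'b" and Q :: "nat \<Rightarrow> real \<Rightarrow> real"
  proof -
    have "norm (z k t, Q k t) \<le> B + B" for k t
      using norm_Pair_le[of "z k t" "Q k t"] z[of k t] Q[of k t] by simp
    then show ?thesis
      by (rule function_convergent_subsequence[where f = "\<lambda>k t. (z k t, Q k t)", OF S])
         (auto simp: convergent_def)
  qed
  obtain r1 where r1: "strict_mono r1"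
    "\<And>q. q \<in> \<rat> \<Longrightarrow> convergent (\<lambda>k. (z (r1 k) q, Q (r1 k) q))"
    using sel[OF countable_rat, of z Q] bz bQ by blast
  have Qm: "Q k s \<le> Q k t" if "s \<le> t" for k s t
    using order_trans[OF norm_ge_zero inc[OF that, of k]] by simp
  \<comment> \<open>the monotone extension to the real line of the limit on the rationals\<close>
  define F where "F t = (SUP q\<in>\<rat>\<inter>{..t}. lim (\<lambda>k. Q (r1 k) q))" for t
  have limQ: "(\<lambda>k. Q (r1 k) q) \<longlonglongrightarrow> lim (\<lambda>k. Q (r1 k) q)" if "q \<in> \<rat>" for q
    using convergent_PairD(2)[OF r1(2)[OF that]] by (simp add: convergent_LIMSEQ_iff)
  have limB: "lim (\<lambda>k. Q (r1 k) q) \<le> B" if "q \<in> \<rat>" for q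
    by (rule LIMSEQ_le_const2[OF limQ[OF that]]) (use bQ in \<open>auto simp: abs_le_iff\<close>)
  have limm: "lim (\<lambda>k. Q (r1 k) q) \<le> lim (\<lambda>k. Q (r1 k) q')" if "q \<in> \<rat>" "q' \<in> \<rat>" "q \<le> q'" for q q'
    by (rule LIMSEQ_le[OF limQ limQ]) (use that Qm in auto)
  have bdd: "bdd_above ((\<lambda>q. lim (\<lambda>k. Q (r1 k) q)) ` (\<rat>\<inter>{..t}))" for t
    using limB by (auto simp: bdd_above_def)
  have ne: "\<rat>\<inter>{..t} \<noteq> ({}::real set)" for t :: real
    using Rats_dense_in_real[of "t - 1" t] by force
  have Fm: "mono F"
    unfolding mono_def F_def by (intro allI impI cSUP_subset_mono bdd ne) auto
  have Flow: "lim (\<lambda>k. Q (r1 k) q) \<le> F t" if "q \<in> \<rat>" "q \<le> t" for q t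
    unfolding F_def by (rule cSUP_upper[OF _ bdd]) (use that in auto)
  have Fup: "F t \<le> lim (\<lambda>k. Q (r1 k) q)" if "q \<in> \<rat>" "t \<le> q" for q t
    unfolding F_def by (rule cSUP_least[OF ne]) (use that limm in auto)
  have conv1: "convergent (\<lambda>k. (z (r1 k) t, Q (r1 k) t))" if c: "isCont F t" for t
  proof -
    have "Cauchy (\<lambda>k. (z (r1 k) t, Q (r1 k) t))"
    proof (rule metric_CauchyI)
      fix e :: real assume e: "e > 0"
      define e' where "e' = e / 32"
      have e': "e' > 0" using e unfolding e'_def by simp
      obtain d where d: "d > 0" "\<And>s. \<bar>s - t\<bar> < d \<Longrightarrow> \<bar>F s - F t\<bar> < e'"
        using c e' unfolding continuous_at_eps_delta by (auto simp: dist_real_def)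
      obtain q where q: "q \<in> \<rat>" "t - d/2 < q" "q < t"
        using Rats_dense_in_real[of "t - d/2" t] d by auto
      obtain q' where q': "q' \<in> \<rat>" "t < q'" "q' < t + d/2"
        using Rats_dense_in_real[of t "t + d/2"] d by auto
      have "lim (\<lambda>k. Q (r1 k) q') \<le> F (t + d/2)" using Flow q' by simp
      moreover have "F (t - d/2) \<le> lim (\<lambda>k. Q (r1 k) q)" using Fup q by simp
      ultimately have gap: "lim (\<lambda>k. Q (r1 k) q') - lim (\<lambda>k. Q (r1 k) q) < 2 * e'"
        using d(2)[of "t + d/2"] d(2)[of "t - d/2"] d(1) by simp
      have "Cauchy (\<lambda>k. z (r1 k) q)"
        using convergent_PairD(1)[OF r1(2)[OF q(1)]] by (simp add: Cauchy_convergent_iff)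
      then obtain N1 where N1: "\<And>m n. m \<ge> N1 \<Longrightarrow> n \<ge> N1 \<Longrightarrow> dist (z (r1 m) q) (z (r1 n) q) < e'"
        using e' unfolding Cauchy_def by metis
      have "eventually (\<lambda>k. Q (r1 k) q' < lim (\<lambda>k. Q (r1 k) q') + e') sequentially"
        using order_tendstoD(2)[OF limQ[OF q'(1)]] e' by simp
      moreover have "eventually (\<lambda>k. Q (r1 k) q > lim (\<lambda>k. Q (r1 k) q) - e') sequentially"
        using order_tendstoD(1)[OF limQ[OF q(1)]] e' by simp
      ultimately have "eventually (\<lambda>k. Q (r1 k) q' < lim (\<lambda>k. Q (r1 k) q') + e'
          \<and> Q (r1 k) q > lim (\<lambda>k. Q (r1 k) q) - e') sequentially"
        by (rule eventually_conj)
      then obtain N2 where N2: "\<And>k. k \<ge> N2 \<Longrightarrow> Q (r1 k) q' < lim (\<lambda>k. Q (r1 k) q') + e'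
          \<and> Q (r1 k) q > lim (\<lambda>k. Q (r1 k) q) - e'"
        unfolding eventually_sequentially by blast
      have near: "norm (z (r1 k) t - z (r1 k) q) < 4 * e'" "\<bar>Q (r1 k) t - lim (\<lambda>k. Q (r1 k) q)\<bar> < 4 * e'"
        if "k \<ge> N2" for k
      proof -
        have "Q (r1 k) t \<le> Q (r1 k) q'" "Q (r1 k) q \<le> Q (r1 k) t" using Qm q q' by auto
        then show "norm (z (r1 k) t - z (r1 k) q) < 4 * e'"
             "\<bar>Q (r1 k) t - lim (\<lambda>k. Q (r1 k) q)\<bar> < 4 * e'"
          using inc[of q t "r1 k"] q(3) N2[OF that] gap e' by auto
      qed
      have "dist (z (r1 m) t, Q (r1 m) t) (z (r1 n) t, Q (r1 n) t) < e"
        if mn: "m \<ge> max N1 N2" "n \<ge> max N1 N2" for m n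
      proof -
        have "dist (z (r1 m) t, Q (r1 m) t) (z (r1 n) t, Q (r1 n) t)
           \<le> norm (z (r1 m) t - z (r1 n) t) + \<bar>Q (r1 m) t - Q (r1 n) t\<bar>"
          unfolding dist_norm using norm_Pair_le[of "z (r1 m) t - z (r1 n) t" "Q (r1 m) t - Q (r1 n) t"]
          by simp
        moreover have "norm (z (r1 m) t - z (r1 n) t) \<le> norm (z (r1 m) t - z (r1 m) q)
            + dist (z (r1 m) q) (z (r1 n) q) + norm (z (r1 n) t - z (r1 n) q)"
          by norm
        moreover have "N1 \<le> m" "N1 \<le> n" "N2 \<le> m" "N2 \<le> n" using mn by auto
        ultimately show ?thesis
          using near[of m] near[of n] N1[of m n] e unfolding e'_def by linarith
      qed
      then show "\<exists>M. \<forall>m\<ge>M. \<forall>n\<ge>M. dist (z (r1 m) t, Q (r1 m) t) (z (r1 n) t, Q (r1 n) t) < e"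
        by blast
    qed
    then show ?thesis by (simp add: Cauchy_convergent_iff)
  qed
  obtain r2 where r2: "strict_mono r2"
    "\<And>q. \<not> isCont F q \<Longrightarrow> convergent (\<lambda>k. (z (r1 (r2 k)) q, Q (r1 (r2 k)) q))"
    using sel[OF mono_ctble_discont[OF Fm], of "\<lambda>k. z (r1 k)" "\<lambda>k. Q (r1 k)"] bz bQ by auto
  have conv: "convergent (\<lambda>k. (z (r1 (r2 k)) t, Q (r1 (r2 k)) t))" for t
    using convergent_subseq_convergent[OF conv1 r2(1), of t] r2(2)[of t] by (auto simp: o_def)
  show ?thesis
  proof
    show "strict_mono (r1 \<circ> r2)" using r1 r2 by (simp add: strict_mono_o)
    show "convergent (\<lambda>k. z ((r1 \<circ> r2) k) t)" for t
      using convergent_PairD(1)[OF conv[of t]] by simp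
    show "convergent (\<lambda>k. Q ((r1 \<circ> r2) k) t)" for t
      using convergent_PairD(2)[OF conv[of t]] by simp
  qed
qed

section \<open>Euler polygons with impulses\<close>

text \<open>
  The normal speed with which a particle of normal speed \<open>w\<close> leaves a contact: a departing particle
  keeps its speed, an approaching one is reflected with restitution coefficient \<open>e\<close>.
\<close>
definition rebound :: "real \<Rightarrow> real \<Rightarrow> real" where
  "rebound e w = max w (- e * w)"

lemma rebound_lipschitz:
  assumes "0 \<le> e" "e \<le> 1"
  shows "\<bar>rebound e w - rebound e w'\<bar> \<le> \<bar>w - w'\<bar>"
proof -
  have "\<bar>- e * w - - e * w'\<bar> \<le> \<bar>w - w'\<bar>"
    using assms mult_right_mono[of e 1 "\<bar>w - w'\<bar>"]
    by (simp add: abs_mult right_diff_distrib[symmetric] abs_minus_commute)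
  then show ?thesis unfolding rebound_def by linarith
qed

lemma rebound_nonneg: "0 \<le> e \<Longrightarrow> 0 \<le> w \<Longrightarrow> rebound e w = w"
  unfolding rebound_def using mult_nonneg_nonneg[of e w] by (intro max_absorb1) linarith

lemma rebound_nonpos: "0 \<le> e \<Longrightarrow> w \<le> 0 \<Longrightarrow> rebound e w = - e * w"
  unfolding rebound_def using mult_nonneg_nonpos[of e w] by (intro max_absorb2) simp

lemma increment_le:
  fixes f :: "nat \<Rightarrow> 'a::real_normed_vector"
  assumes "I \<le> J" "\<And>i. I \<le> i \<Longrightarrow> i < J \<Longrightarrow> norm (f (Suc i) - f i) \<le> g (Suc i) - g i"
  shows "norm (f J - f I) \<le> g J - g I"
  using assms
proof (induction J rule: dec_induct)
  case (step m)
  have "norm (f (Suc m) - f I) \<le> norm (f (Suc m) - f m) + norm (f m - f I)"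
    by norm
  moreover have "norm (f (Suc m) - f m) \<le> g (Suc m) - g m" using step by simp
  moreover have "norm (f m - f I) \<le> g m - g I" using step by simp
  ultimately show ?case by linarith
qed simp

text \<open>
  A single constant \<open>K\<close> bounds the data near the initial state, and the duration \<open>\<tau>\<close> is short enough
  to keep the polygons in the balls of radius \<open>r\<close>: the velocity changes by at most \<open>7 K\<^sup>5 \<tau>\<close>.
  The assumption \<open>contact\<close> states that either the boundary is out of reach, or \<open>n\<close> points uniformly
  into the domain and the initial velocity does not point out of it. Impulses can occur only in the
  second case.
\<close>
locale bouncing_scheme =
  fixes G :: "real \<times> 'a \<times> 'a \<Rightarrow> 'a::euclidean_space"
    and \<phi> :: "'a \<Rightarrow> real" and \<psi> n :: "'a \<Rightarrow> 'a"
    and e t0 :: real and x0 v0 :: 'a and \<tau> r K :: real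
  assumes e: "0 \<le> e" "e \<le> 1"
    and r: "r > 0"
    and K1: "K \<ge> 1"
    and \<tau>: "0 < \<tau>" "\<tau> \<le> 1" "7 * K^5 * \<tau> \<le> r"
    and vK: "norm v0 + r \<le> K"
    and G_le: "\<And>t x y. t \<in> {t0..t0+\<tau>} \<Longrightarrow> x \<in> cball x0 r \<Longrightarrow> y \<in> cball v0 r \<Longrightarrow> norm (G (t, x, y)) \<le> K"
    and n_le: "\<And>x. x \<in> cball x0 r \<Longrightarrow> norm (n x) \<le> K"
    and \<psi>_le: "\<And>x. x \<in> cball x0 r \<Longrightarrow> norm (\<psi> x) \<le> K"
    and \<psi>_lip: "\<And>x y. x \<in> cball x0 r \<Longrightarrow> y \<in> cball x0 r \<Longrightarrow> norm (\<psi> x - \<psi> y) \<le> K * norm (x - y)"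
    and \<phi>_deriv: "\<And>x. x \<in> cball x0 r \<Longrightarrow> (\<phi> has_derivative (\<lambda>y. \<psi> x \<bullet> y)) (at x)"
    and \<phi>0: "\<phi> x0 \<ge> 0"
    and contact: "(\<forall>x\<in>cball x0 r. \<phi> x > 0) \<or> (\<forall>x\<in>cball x0 r. \<psi> x \<bullet> n x \<ge> 1 / K) \<and> \<psi> x0 \<bullet> v0 \<ge> 0"
    and contG: "continuous_on UNIV G" and contn: "continuous_on UNIV n"
begin

text \<open>
  The factor of \<open>n x\<close> that reverses the normal speed with the factor \<open>e\<close>, when the particle is
  approaching and has reached the boundary.
\<close>
definition impulse :: "'a \<Rightarrow> 'a \<Rightarrow> real" where
  "impulse x y = (if \<phi> x \<le> 0 \<and> \<psi> x \<bullet> y < 0 then - (1 + e) * (\<psi> x \<bullet> y) / (\<psi> x \<bullet> n x) else 0)"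

text \<open>
  One step moves the particle with its current velocity, accelerates it freely and then applies the
  impulse at the new position; the last component accumulates the impulses.
\<close>
primrec state :: "real \<Rightarrow> nat \<Rightarrow> 'a \<times> 'a \<times> real" where
  "state h 0 = (x0, v0, 0)"
| "state h (Suc j) = (case state h j of (x, y, l) \<Rightarrow>
     let x' = x + h *\<^sub>R y; y' = y + h *\<^sub>R G (t0 + h * real j, x, y); a = impulse x' y'
     in (x', y' + a *\<^sub>R n x', l + a))"

text \<open>
  Position, velocity and total impulse; the velocity just before the impulse; the normal speed; and
  the monotone quantity (elapsed time plus total impulse) that dominates all increments.
\<close>
definition xs :: "real \<Rightarrow> nat \<Rightarrow> 'a" where "xs h j = fst (state h j)"
definition ys :: "real \<Rightarrow> nat \<Rightarrow> 'a" where "ys h j = fst (snd (state h j))"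
definition ls :: "real \<Rightarrow> nat \<Rightarrow> real" where "ls h j = snd (snd (state h j))"
definition free :: "real \<Rightarrow> nat \<Rightarrow> 'a" where
  "free h j = ys h j + h *\<^sub>R G (t0 + h * real j, xs h j, ys h j)"
definition ws :: "real \<Rightarrow> nat \<Rightarrow> real" where "ws h j = \<psi> (xs h j) \<bullet> ys h j"
definition qs :: "real \<Rightarrow> nat \<Rightarrow> real" where "qs h j = h * real j + ls h j"

lemma scheme_0: "xs h 0 = x0" "ys h 0 = v0" "ls h 0 = 0"
  by (simp_all add: xs_def ys_def ls_def)

lemma scheme_Suc:
  "xs h (Suc j) = xs h j + h *\<^sub>R ys h j"
  "ys h (Suc j) = free h j + impulse (xs h (Suc j)) (free h j) *\<^sub>R n (xs h (Suc j))"
  "ls h (Suc j) = ls h j + impulse (xs h (Suc j)) (free h j)"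
  by (simp_all add: xs_def ys_def ls_def free_def Let_def split: prod.split)

lemma K_power_mono: "i \<le> j \<Longrightarrow> K ^ i \<le> K ^ j"
  using K1 by (rule power_increasing[rotated])

lemma ball_v_le: "y \<in> cball v0 r \<Longrightarrow> norm y \<le> K"
  using vK norm_triangle_ineq2[of y v0] by (simp add: dist_norm norm_minus_commute)

lemma impulse_nonneg:
  assumes "x \<in> cball x0 r" shows "impulse x y \<ge> 0"
proof (cases "\<phi> x \<le> 0 \<and> \<psi> x \<bullet> y < 0")
  case True
  then have "\<psi> x \<bullet> n x \<ge> 1 / K" using contact assms by force
  then have "\<psi> x \<bullet> n x > 0" using K1 by (smt (verit) divide_pos_pos)
  moreover have "- (1 + e) * (\<psi> x \<bullet> y) \<ge> 0" using True e by (intro mult_nonpos_nonpos) auto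
  ultimately show ?thesis using True unfolding impulse_def by (simp only: if_True) simp
qed (auto simp: impulse_def)

lemma normal_velocity_after_impulse:
  assumes "x \<in> cball x0 r"
  shows "\<psi> x \<bullet> (y + impulse x y *\<^sub>R n x) =
      (if \<phi> x \<le> 0 \<and> \<psi> x \<bullet> y < 0 then - e * (\<psi> x \<bullet> y) else \<psi> x \<bullet> y)"
proof (cases "\<phi> x \<le> 0 \<and> \<psi> x \<bullet> y < 0")
  case True
  then have "\<psi> x \<bullet> n x \<ge> 1 / K" using contact assms by force
  then have "\<psi> x \<bullet> n x > 0" using K1 by (smt (verit) divide_pos_pos)
  then show ?thesis using True
    by (simp add: impulse_def inner_right_distrib field_simps)
qed (auto simp: impulse_def)

text \<open>
  The invariance on which the a priori bounds and the impact law rest: an approaching normal speed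
  \<open>w < 0\<close> becomes \<open>- e w \<ge> 0\<close>, and \<open>rebound e\<close> equals \<open>- e w\<close> at both.
\<close>
lemma rebound_impulse:
  assumes "x \<in> cball x0 r"
  shows "rebound e (\<psi> x \<bullet> (y + impulse x y *\<^sub>R n x)) = rebound e (\<psi> x \<bullet> y)"
  using e unfolding normal_velocity_after_impulse[OF assms]
  by (auto simp: rebound_nonneg rebound_nonpos mult_nonneg_nonpos)

text \<open>
  An impulse is at most \<open>K\<close> times the gain in normal speed, because \<open>\<psi> x \<bullet> n x \<ge> 1 / K\<close> wherever
  an impulse can occur. Bounds on the normal speed thus become bounds on the total impulse.
\<close>
lemma impulse_le:
  assumes "x \<in> cball x0 r"
  shows "impulse x y \<le> K * (\<psi> x \<bullet> (y + impulse x y *\<^sub>R n x) - \<psi> x \<bullet> y)"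
proof (cases "\<phi> x \<le> 0 \<and> \<psi> x \<bullet> y < 0")
  case True
  then have "\<psi> x \<bullet> n x \<ge> 1 / K" using contact assms by force
  then have "1 \<le> K * (\<psi> x \<bullet> n x)" using K1 by (simp add: field_simps)
  then have "impulse x y * 1 \<le> impulse x y * (K * (\<psi> x \<bullet> n x))"
    using impulse_nonneg[OF assms] by (rule mult_left_mono)
  then show ?thesis by (simp add: inner_right_distrib algebra_simps)
qed (auto simp: impulse_def)

context
  fixes h :: real and j :: nat
  assumes h: "0 < h" "h * real (Suc j) \<le> \<tau>"
    and xj: "xs h j \<in> cball x0 r" and yj: "ys h j \<in> cball v0 r"
    and xj': "xs h (Suc j) \<in> cball x0 r"
begin

lemma G_step: "norm (G (t0 + h * real j, xs h j, ys h j)) \<le> K"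
  by (rule G_le) (use h xj yj in \<open>auto simp: algebra_simps\<close>)

lemma free_step: "\<bar>\<psi> (xs h (Suc j)) \<bullet> free h j - ws h j\<bar> \<le> 3 * K^3 * h"
proof -
  let ?g = "G (t0 + h * real j, xs h j, ys h j)"
  have y: "norm (ys h j) \<le> K" using yj by (rule ball_v_le)
  have eq: "\<psi> (xs h (Suc j)) \<bullet> free h j - ws h j
     = (\<psi> (xs h (Suc j)) - \<psi> (xs h j)) \<bullet> ys h j + h * (\<psi> (xs h (Suc j)) \<bullet> ?g)"
    by (simp add: free_def ws_def inner_simps)
  have "\<bar>\<psi> (xs h (Suc j)) \<bullet> free h j - ws h j\<bar>
     \<le> \<bar>(\<psi> (xs h (Suc j)) - \<psi> (xs h j)) \<bullet> ys h j\<bar> + \<bar>h * (\<psi> (xs h (Suc j)) \<bullet> ?g)\<bar>"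
    unfolding eq by (rule abs_triangle_ineq)
  also have "\<dots> \<le> K * (h * K) * K + h * (K * K)"
  proof (rule add_mono)
    have "norm (\<psi> (xs h (Suc j)) - \<psi> (xs h j)) \<le> K * norm (xs h (Suc j) - xs h j)"
      by (rule \<psi>_lip[OF xj' xj])
    also have "\<dots> \<le> K * (h * K)"
      unfolding scheme_Suc(1) using h(1) K1 y by simp
    finally show "\<bar>(\<psi> (xs h (Suc j)) - \<psi> (xs h j)) \<bullet> ys h j\<bar> \<le> K * (h * K) * K"
      using h(1) K1 y by (intro order_trans[OF Cauchy_Schwarz_ineq2] mult_mono) auto
    have "\<bar>\<psi> (xs h (Suc j)) \<bullet> ?g\<bar> \<le> K * K"
      using K1 \<psi>_le[OF xj'] G_step by (intro order_trans[OF Cauchy_Schwarz_ineq2] mult_mono) auto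
    then show "\<bar>h * (\<psi> (xs h (Suc j)) \<bullet> ?g)\<bar> \<le> h * (K * K)"
      using h(1) by (simp add: abs_mult)
  qed
  also have "\<dots> = (K^3 + K^2) * h" by (simp add: power3_eq_cube power2_eq_square algebra_simps)
  also have "\<dots> \<le> (3 * K^3) * h"
    using h(1) K_power_mono[of 2 3] K_power_mono[of 0 3] by (intro mult_right_mono) auto
  finally show ?thesis .
qed

lemma ws_Suc: "ws h (Suc j) = \<psi> (xs h (Suc j)) \<bullet>
    (free h j + impulse (xs h (Suc j)) (free h j) *\<^sub>R n (xs h (Suc j)))"
  by (simp add: ws_def scheme_Suc(2))

lemma rebound_step: "\<bar>rebound e (ws h (Suc j)) - rebound e (ws h j)\<bar> \<le> 3 * K^3 * h"
  unfolding ws_Suc rebound_impulse[OF xj']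
  using rebound_lipschitz[OF e] free_step by (rule order_trans)

lemma ls_step: "ls h (Suc j) - ls h j \<le> K * (ws h (Suc j) - ws h j) + 3 * K^4 * h"
proof -
  have "ls h (Suc j) - ls h j \<le> K * (ws h (Suc j) - \<psi> (xs h (Suc j)) \<bullet> free h j)"
    unfolding ws_Suc using impulse_le[OF xj'] by (simp add: scheme_Suc(3))
  also have "\<dots> \<le> K * ((ws h (Suc j) - ws h j) + 3 * K^3 * h)"
    using K1 free_step by (intro mult_left_mono) auto
  finally show ?thesis by (simp add: algebra_simps power4_eq_xxxx power3_eq_cube)
qed

lemma ls_step_nonneg: "ls h j \<le> ls h (Suc j)"
  using impulse_nonneg[OF xj'] by (simp add: scheme_Suc(3))

lemma ys_step: "norm (ys h (Suc j) - ys h j) \<le> K * (qs h (Suc j) - qs h j)"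
proof -
  let ?a = "impulse (xs h (Suc j)) (free h j)"
  let ?g = "h *\<^sub>R G (t0 + h * real j, xs h j, ys h j)"
  have eq: "ys h (Suc j) - ys h j = ?g + ?a *\<^sub>R n (xs h (Suc j))"
    unfolding scheme_Suc(2) by (simp add: free_def)
  have "norm ?g \<le> h * K"
    using h(1) G_step by simp
  moreover have "norm (?a *\<^sub>R n (xs h (Suc j))) \<le> ?a * K"
    using n_le[OF xj'] impulse_nonneg[OF xj', of "free h j"] by (simp add: mult_left_mono)
  ultimately have "norm (ys h (Suc j) - ys h j) \<le> h * K + ?a * K"
    unfolding eq by (rule norm_triangle_mono)
  also have "\<dots> = K * (qs h (Suc j) - qs h j)"
    by (simp add: qs_def scheme_Suc(3) algebra_simps)
  finally show ?thesis .
qed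

lemma impulse_only_at_contact: "\<phi> (xs h (Suc j)) > 0 \<Longrightarrow> ls h (Suc j) = ls h j"
  by (simp add: scheme_Suc(3) impulse_def)

lemma nonneg_normal_velocity_Suc: "\<phi> (xs h (Suc j)) \<le> 0 \<Longrightarrow> ws h (Suc j) \<ge> 0"
  unfolding ws_Suc normal_velocity_after_impulse[OF xj'] using e by (auto simp: mult_nonneg_nonpos)

text \<open>
  Taylor's formula to first order; the gradient is Lipschitz with constant \<open>K\<close> and the step has
  length at most \<open>h K\<close>.
\<close>
lemma \<phi>_step: "\<phi> (xs h (Suc j)) - \<phi> (xs h j) \<ge> h * ws h j - K^3 * h^2"
proof -
  let ?x = "xs h j" and ?x' = "xs h (Suc j)"
  have seg: "z \<in> cball x0 r" if "z \<in> closed_segment ?x ?x'" for z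
    using that xj xj' convex_cball closed_segment_subset by blast
  have "norm (\<phi> ?x' - \<phi> ?x - \<psi> ?x \<bullet> (?x' - ?x)) \<le> norm (?x' - ?x) * (K * norm (?x' - ?x))"
  proof (rule differentiable_bound_linearization[where S = "closed_segment ?x ?x'"
      and f' = "\<lambda>z y. \<psi> z \<bullet> y"])
    show "?x + t *\<^sub>R (?x' - ?x) \<in> closed_segment ?x ?x'" if "t \<in> {0..1}" for t
      using that by (auto simp: in_segment algebra_simps)
    show "(\<phi> has_derivative (\<lambda>y. \<psi> z \<bullet> y)) (at z within closed_segment ?x ?x')"
      if "z \<in> closed_segment ?x ?x'" for z
      using \<phi>_deriv[OF seg[OF that]] by (rule has_derivative_at_withinI)
    show "onorm ((\<lambda>y. \<psi> z \<bullet> y) - (\<lambda>y. \<psi> ?x \<bullet> y)) \<le> K * norm (?x' - ?x)"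
      if "z \<in> closed_segment ?x ?x'" for z
      unfolding fun_diff_def
    proof (rule onorm_le)
      fix y
      have "norm (\<psi> z \<bullet> y - \<psi> ?x \<bullet> y) \<le> norm (\<psi> z - \<psi> ?x) * norm y"
        unfolding inner_diff_left[symmetric] real_norm_def by (rule Cauchy_Schwarz_ineq2)
      also have "\<dots> \<le> (K * norm (z - ?x)) * norm y"
        by (intro mult_right_mono \<psi>_lip[OF seg[OF that] xj]) simp
      also have "\<dots> \<le> (K * norm (?x' - ?x)) * norm y"
        using segment_bound1[OF that] K1 by (intro mult_right_mono mult_left_mono) auto
      finally show "norm (\<psi> z \<bullet> y - \<psi> ?x \<bullet> y) \<le> K * norm (?x' - ?x) * norm y" .
    qed
  qed simp
  also have "\<dots> \<le> (h * K) * (K * (h * K))"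
    using h(1) K1 ball_v_le[OF yj] by (auto simp: scheme_Suc intro!: mult_mono)
  finally have "\<bar>\<phi> ?x' - \<phi> ?x - h * ws h j\<bar> \<le> K^3 * h^2"
    by (simp add: scheme_Suc(1) ws_def power3_eq_cube power2_eq_square algebra_simps)
  then show ?thesis by linarith
qed

end

text \<open>
  Induction on time, all bounds of a single step being available as long as the states lie in the
  balls. When impulses occur, summing \<open>ls_step\<close> bounds their total by the increase of the normal speed,
  and \<open>w \<le> rebound e w\<close> together with \<open>w\<^sub>0 = rebound e w\<^sub>0\<close> bounds that increase linearly in time.
  Linear growth of the total impulse in turn keeps the velocity near \<open>v0\<close>.
\<close>
lemma scheme_in_balls:
  assumes h: "0 < h" "h * real J \<le> \<tau>" and j: "j \<le> J"
  shows "xs h j \<in> cball x0 r \<and> ys h j \<in> cball v0 r \<and> ls h j \<le> 6 * K^4 * (h * real j)"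
  using h(2) j
proof (induction J arbitrary: j)
  case 0
  then show ?case using r by (simp add: scheme_0)
next
  case (Suc J)
  have "h * real J \<le> h * real (Suc J)" using h(1) by simp
  then have hJ: "h * real J \<le> \<tau>" using Suc.prems(1) by simp
  note IH = Suc.IH[OF hJ]
  have KK: "K \<le> K^5" using K_power_mono[of 1 5] by simp
  have Kt: "K^5 * \<tau> \<ge> 0" using K1 \<tau> by simp
  have hi: "h * real (Suc i) \<le> \<tau>" if "i \<le> J" for i
  proof -
    have "h * real (Suc i) \<le> h * real (Suc J)" using that h(1) by (intro mult_left_mono) auto
    then show ?thesis using Suc.prems(1) by simp
  qed
  have "norm (xs h (Suc J) - xs h 0) \<le> K * (h * real (Suc J)) - K * (h * real 0)"
  proof (rule increment_le)
    fix i assume "i < Suc J"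
    then have "norm (ys h i) \<le> K" using IH[of i] ball_v_le by simp
    then show "norm (xs h (Suc i) - xs h i) \<le> K * (h * real (Suc i)) - K * (h * real i)"
      using h(1) by (simp add: scheme_Suc algebra_simps)
  qed simp
  also have "\<dots> \<le> K * \<tau>" using K1 Suc.prems(1) by simp
  also have "\<dots> \<le> 7 * K^5 * \<tau>" using mult_right_mono[OF KK, of \<tau>] \<tau>(1) Kt by linarith
  also have "\<dots> \<le> r" by (rule \<tau>)
  finally have x': "xs h (Suc J) \<in> cball x0 r"
    by (simp add: scheme_0 dist_norm norm_minus_commute)
  have xi: "xs h (Suc i) \<in> cball x0 r" if "i \<le> J" for i
    using that x' IH[of "Suc i"] by (cases "i = J") auto
  have ls0: "ls h (Suc J) \<le> 6 * K^4 * (h * real (Suc J))"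
  proof (cases "\<forall>x\<in>cball x0 r. \<phi> x > 0")
    case True
    then have "\<phi> (xs h (Suc J)) > 0" using x' by blast
    then have "ls h (Suc J) = ls h J"
      by (simp add: scheme_Suc(3) impulse_def)
    also have "\<dots> \<le> 6 * K^4 * (h * real J)" using IH[of J] by simp
    also have "\<dots> \<le> 6 * K^4 * (h * real (Suc J))"
      using K1 h(1) by (intro mult_left_mono) auto
    finally show ?thesis .
  next
    case False
    then have w0: "ws h 0 \<ge> 0" using contact unfolding ws_def scheme_0 by blast
    have "norm (rebound e (ws h (Suc J)) - rebound e (ws h 0))
        \<le> 3 * K^3 * h * real (Suc J) - 3 * K^3 * h * real 0"
    proof (rule increment_le)
      fix i assume "i < Suc J"
      then show "norm (rebound e (ws h (Suc i)) - rebound e (ws h i))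
          \<le> 3 * K^3 * h * real (Suc i) - 3 * K^3 * h * real i"
        using rebound_step[OF h(1) hi, of i] IH[of i] xi[of i] by (simp add: algebra_simps)
    qed simp
    moreover have "ws h (Suc J) \<le> rebound e (ws h (Suc J))" by (simp add: rebound_def)
    moreover have "rebound e (ws h 0) = ws h 0" using e w0 by (simp add: rebound_nonneg)
    ultimately have w: "ws h (Suc J) - ws h 0 \<le> 3 * K^3 * h * real (Suc J)" by simp
    have *: "ls h j \<le> K * (ws h j - ws h 0) + 3 * K^4 * h * real j" if "j \<le> Suc J" for j
      using that
    proof (induction j)
      case (Suc j)
      then show ?case
        using ls_step[OF h(1) hi, of j] IH[of j] xi[of j] by (simp add: algebra_simps)
    qed (simp add: scheme_0)
    have "ls h (Suc J) \<le> K * (ws h (Suc J) - ws h 0) + 3 * K^4 * h * real (Suc J)"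
      by (rule *) simp
    also have "\<dots> \<le> K * (3 * K^3 * h * real (Suc J)) + 3 * K^4 * h * real (Suc J)"
      using w K1 by (intro add_right_mono mult_left_mono) auto
    also have "\<dots> = 6 * K^4 * (h * real (Suc J))"
      by (simp add: power4_eq_xxxx power3_eq_cube algebra_simps)
    finally show ?thesis .
  qed
  have "norm (ys h (Suc J) - ys h 0) \<le> K * qs h (Suc J) - K * qs h 0"
  proof (rule increment_le)
    fix i assume "i < Suc J"
    then show "norm (ys h (Suc i) - ys h i) \<le> K * qs h (Suc i) - K * qs h i"
      using ys_step[OF h(1) hi, of i] IH[of i] xi[of i] by (simp add: algebra_simps)
  qed simp
  also have "\<dots> = K * (h * real (Suc J) + ls h (Suc J))" by (simp add: qs_def scheme_0)
  also have "\<dots> \<le> K * (h * real (Suc J) + 6 * K^4 * (h * real (Suc J)))"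
    using ls0 K1 by (intro mult_left_mono add_left_mono) auto
  also have "\<dots> = (K + 6 * K^5) * (h * real (Suc J))"
    using power_Suc[of K 4] by (simp add: algebra_simps)
  also have "\<dots> \<le> (7 * K^5) * \<tau>"
    using KK K1 Suc.prems(1) h(1) \<tau> by (intro mult_mono) auto
  also have "\<dots> \<le> r" by (rule \<tau>)
  finally have "ys h (Suc J) \<in> cball v0 r"
    by (simp add: scheme_0 dist_norm norm_minus_commute)
  with x' ls0 show ?case using IH[of j] Suc.prems(2) by (cases "j = Suc J") simp_all
qed

lemma theta_in:
  assumes "0 < h" "h * real J \<le> \<tau>" "i \<le> J"
  shows "t0 + h * real i \<in> {t0..t0+\<tau>}"
proof -
  have "h * real i \<le> h * real J" using assms(1,3) by (intro mult_left_mono) auto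
  moreover have "0 \<le> h * real i" using assms(1) by simp
  ultimately show ?thesis using assms(2) by simp
qed

lemma step_ok:
  assumes h: "0 < h" "h * real N \<le> \<tau>" and i: "i < N"
  shows "h * real (Suc i) \<le> \<tau>" "xs h i \<in> cball x0 r" "ys h i \<in> cball v0 r" "xs h (Suc i) \<in> cball x0 r"
proof -
  have "h * real (Suc i) \<le> h * real N" using i h(1) by (intro mult_left_mono) auto
  then show "h * real (Suc i) \<le> \<tau>" using h(2) by simp
  show "xs h i \<in> cball x0 r" "ys h i \<in> cball v0 r" "xs h (Suc i) \<in> cball x0 r"
    using scheme_in_balls[OF h, of i] scheme_in_balls[OF h, of "Suc i"] i by auto
qed

context
  fixes h :: real and N :: nat
  assumes h: "0 < h" "h * real N \<le> \<tau>"
begin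

lemma ls_mono: "I \<le> J \<Longrightarrow> J \<le> N \<Longrightarrow> ls h I \<le> ls h J"
proof (induction J rule: dec_induct)
  case (step m)
  have m: "m < N" using step.prems by simp
  have "ls h I \<le> ls h m" using step.IH m by simp
  also have "\<dots> \<le> ls h (Suc m)" by (rule ls_step_nonneg[OF h(1) step_ok[OF h m]])
  finally show ?case .
qed simp

lemma qs_diff_ge: "I \<le> J \<Longrightarrow> J \<le> N \<Longrightarrow> h * (real J - real I) \<le> qs h J - qs h I"
  using ls_mono[of I J] by (simp add: qs_def algebra_simps)

lemma qs_mono: "I \<le> J \<Longrightarrow> J \<le> N \<Longrightarrow> qs h I \<le> qs h J"
  using ls_mono[of I J] h(1) by (simp add: qs_def add_mono)

lemma ys_increment: "I \<le> J \<Longrightarrow> J \<le> N \<Longrightarrow> norm (ys h J - ys h I) \<le> K * (qs h J - qs h I)"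
  unfolding right_diff_distrib
  by (rule increment_le) (use ys_step[OF h(1) step_ok[OF h]] in \<open>auto simp: right_diff_distrib\<close>)

lemma xs_increment: "I \<le> J \<Longrightarrow> J \<le> N \<Longrightarrow> norm (xs h J - xs h I) \<le> K * (h * (real J - real I))"
  unfolding right_diff_distrib
proof (rule increment_le)
  fix i assume "i < J" "J \<le> N"
  then have "norm (ys h i) \<le> K" using step_ok(3)[OF h] ball_v_le by simp
  then show "norm (xs h (Suc i) - xs h i) \<le> K * (h * real (Suc i)) - K * (h * real i)"
    using h(1) by (simp add: scheme_Suc algebra_simps)
qed

lemma xs_linear_increment:
  assumes "I \<le> J" "J \<le> N"
  shows "norm (xs h J - xs h I - (h * (real J - real I)) *\<^sub>R ys h I)
    \<le> (h * (real J - real I)) * (K * (qs h J - qs h I))"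
proof -
  let ?c = "K * (qs h J - qs h I)"
  have "norm ((xs h J - (h * real J) *\<^sub>R ys h I) - (xs h I - (h * real I) *\<^sub>R ys h I))
      \<le> h * real J * ?c - h * real I * ?c"
  proof (rule increment_le[OF assms(1)])
    fix i assume i: "I \<le> i" "i < J"
    have "norm (ys h i - ys h I) \<le> K * (qs h i - qs h I)"
      by (rule ys_increment) (use i assms in auto)
    also have "\<dots> \<le> ?c"
      using qs_mono[of i J] i assms K1 by (intro mult_left_mono) auto
    finally have "norm (h *\<^sub>R (ys h i - ys h I)) \<le> h * ?c" using h(1) by simp
    moreover have "(xs h (Suc i) - (h * real (Suc i)) *\<^sub>R ys h I) - (xs h i - (h * real i) *\<^sub>R ys h I)
       = h *\<^sub>R (ys h i - ys h I)"
      by (simp add: scheme_Suc algebra_simps)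
    ultimately show "norm ((xs h (Suc i) - (h * real (Suc i)) *\<^sub>R ys h I) - (xs h i - (h * real i) *\<^sub>R ys h I))
       \<le> h * real (Suc i) * ?c - h * real i * ?c"
      by (simp add: algebra_simps)
  qed
  then show ?thesis by (simp add: algebra_simps)
qed

lemma rebound_increment:
  assumes "I \<le> J" "J \<le> N"
  shows "\<bar>rebound e (ws h J) - rebound e (ws h I)\<bar> \<le> 3 * K^3 * (h * (real J - real I))"
proof -
  have "norm (rebound e (ws h J) - rebound e (ws h I)) \<le> 3 * K^3 * h * real J - 3 * K^3 * h * real I"
    by (rule increment_le[OF assms(1)])
       (use rebound_step[OF h(1) step_ok[OF h]] assms(2) in \<open>auto simp: algebra_simps\<close>)
  then show ?thesis by (simp add: algebra_simps)
qed

text \<open>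
  A polygon can enter the region \<open>\<phi> < 0\<close> only from \<open>\<phi> > 0\<close>, by a single step of length \<open>O(h)\<close>. Once
  \<open>\<phi> \<le> 0\<close>, the normal speed is nonnegative, so that each later step contributes only the
  second-order error of \<open>\<phi>_step\<close>.
\<close>
lemma penetration_le:
  assumes "j \<le> N"
  shows "\<phi> (xs h j) \<ge> - (K^2 * h) - K^3 * h * (h * real j)"
  using assms
proof (induction j)
  case 0
  have "0 \<le> K^2 * h" using h(1) by simp
  then show ?case using \<phi>0 by (simp add: scheme_0)
next
  case (Suc j)
  then have j: "j < N" by simp
  note ok = step_ok[OF h j]
  have step: "\<phi> (xs h (Suc j)) \<ge> \<phi> (xs h j) + h * ws h j - K^3 * h^2"
    using \<phi>_step[OF h(1) ok] by simp
  have IH: "\<phi> (xs h j) \<ge> - (K^2 * h) - K^3 * h * (h * real j)" using Suc by simp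
  show ?case
  proof (cases "\<phi> (xs h j) \<le> 0")
    case True
    have "ws h j \<ge> 0"
    proof (cases j)
      case 0
      then have "\<not> (\<forall>x\<in>cball x0 r. \<phi> x > 0)" using True r by (auto simp: scheme_0 intro!: bexI[of _ x0])
      then show ?thesis using contact 0 unfolding ws_def by (auto simp: scheme_0)
    next
      case (Suc i)
      then show ?thesis
        using nonneg_normal_velocity_Suc[OF h(1) step_ok[OF h], of i] True j by simp
    qed
    then have "h * ws h j \<ge> 0" using h(1) by simp
    then show ?thesis using step IH by (simp add: algebra_simps power2_eq_square)
  next
    case False
    have "\<bar>ws h j\<bar> \<le> K * K"
      unfolding ws_def using \<psi>_le[OF ok(2)] ball_v_le[OF ok(3)] K1
      by (intro order_trans[OF Cauchy_Schwarz_ineq2] mult_mono) auto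
    then have "h * (- (K * K)) \<le> h * ws h j"
      using h(1) by (intro mult_left_mono) auto
    moreover have "0 \<le> K^3 * h^2 * real j" using K1 by simp
    ultimately show ?thesis using step False by (simp add: algebra_simps power2_eq_square)
  qed
qed

lemma ls_constant_off_contact:
  assumes "I \<le> J" "J \<le> N" "\<And>j. I \<le> j \<Longrightarrow> j \<le> J \<Longrightarrow> \<phi> (xs h j) > 0"
  shows "ls h J = ls h I"
  using assms
proof (induction J rule: dec_induct)
  case (step m)
  then show ?case
    using impulse_only_at_contact[OF h(1) step_ok[OF h], of m] by simp
qed simp

end

text \<open>
  The equation of motion in integrated form, with \<open>G\<close> and \<open>n\<close> frozen at the initial point of the
  interval. The constant does not depend on the step size \<open>h\<close>, hence the estimate survives
  the limit; its error is of the kind that \<open>constant_if_increments_small\<close> neglects.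
\<close>
lemma velocity_increment:
  assumes "\<epsilon> > 0"
  obtains C where "\<And>h N I J. 0 < h \<Longrightarrow> h * real N \<le> \<tau> \<Longrightarrow> I \<le> J \<Longrightarrow> J \<le> N \<Longrightarrow>
     norm (ys h J - ys h I - (h * (real J - real I)) *\<^sub>R G (t0 + h * real I, xs h I, ys h I)
        - (ls h J - ls h I) *\<^sub>R n (xs h I))
     \<le> (\<epsilon> + C * (h * (real J - real I))) * (qs h J - qs h I)"
proof -
  define S where "S = {t0..t0+\<tau>} \<times> cball x0 r \<times> cball v0 r"
  have "compact S" unfolding S_def by (intro compact_Times compact_Icc compact_cball)
  then obtain CG where CG: "CG \<ge> 0" "\<And>p q. p \<in> S \<Longrightarrow> q \<in> S \<Longrightarrow> norm (G p - G q) \<le> \<epsilon> + CG * dist p q"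
    using continuous_on_compact_almost_lipschitz[OF continuous_on_subset[OF contG] _ assms] by blast
  obtain Cn where Cn: "Cn \<ge> 0" "\<And>p q. p \<in> cball x0 r \<Longrightarrow> q \<in> cball x0 r \<Longrightarrow> norm (n p - n q) \<le> \<epsilon> + Cn * dist p q"
    using continuous_on_compact_almost_lipschitz[OF continuous_on_subset[OF contn] compact_cball assms] by blast
  define C where "C = K * (Cn + 3 * CG)"
  have "norm (ys h J - ys h I - (h * (real J - real I)) *\<^sub>R G (t0 + h * real I, xs h I, ys h I)
        - (ls h J - ls h I) *\<^sub>R n (xs h I))
     \<le> (\<epsilon> + C * (h * (real J - real I))) * (qs h J - qs h I)"
    if h: "0 < h" "h * real N \<le> \<tau>" and IJ: "I \<le> J" "J \<le> N" for h N I J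
  proof -
    let ?gI = "G (t0 + h * real I, xs h I, ys h I)" and ?nI = "n (xs h I)"
    let ?d = "h * (real J - real I)" and ?dq = "qs h J - qs h I"
    have d0: "0 \<le> ?d" using h(1) IJ by simp
    have ddq: "?d \<le> ?dq" by (rule qs_diff_ge[OF h IJ])
    have "norm ((ys h J - (h * real J) *\<^sub>R ?gI - ls h J *\<^sub>R ?nI) - (ys h I - (h * real I) *\<^sub>R ?gI - ls h I *\<^sub>R ?nI))
       \<le> ((\<epsilon> + CG * (3 * K * ?dq)) * (h * real J) + (\<epsilon> + Cn * (K * ?d)) * ls h J)
        - ((\<epsilon> + CG * (3 * K * ?dq)) * (h * real I) + (\<epsilon> + Cn * (K * ?d)) * ls h I)"
    proof (rule increment_le[OF IJ(1)])
      fix i assume i: "I \<le> i" "i < J"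
      then have iN: "i < N" using IJ by simp
      note ok = step_ok[OF h iN]
      have okI: "xs h I \<in> cball x0 r" "ys h I \<in> cball v0 r"
        using scheme_in_balls[OF h, of I] IJ by auto
      let ?gi = "G (t0 + h * real i, xs h i, ys h i)" and ?ni = "n (xs h (Suc i))"
      let ?a = "ls h (Suc i) - ls h i"
      have a0: "0 \<le> ?a" using ls_step_nonneg[OF h(1) ok] by simp
      have hi: "h * (real i - real I) \<le> ?d" "h * (real (Suc i) - real I) \<le> ?d" "0 \<le> h * (real i - real I)"
        using i h(1) by (auto intro!: mult_left_mono)
      have qi: "qs h i \<le> qs h J" by (rule qs_mono[OF h]) (use i IJ in auto)
      have "dist (t0 + h * real i, xs h i, ys h i) (t0 + h * real I, xs h I, ys h I)
         \<le> \<bar>h * (real i - real I)\<bar> + (norm (xs h i - xs h I) + norm (ys h i - ys h I))"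
        unfolding dist_norm using norm_Pair_le[of "xs h i - xs h I" "ys h i - ys h I"]
          norm_Pair_le[of "h * real i - h * real I" "(xs h i - xs h I, ys h i - ys h I)"]
        by (simp add: algebra_simps)
      also have "\<dots> \<le> K * ?dq + (K * ?dq + K * ?dq)"
      proof (intro add_mono)
        have "\<bar>h * (real i - real I)\<bar> \<le> 1 * ?dq"
          unfolding abs_of_nonneg[OF hi(3)] mult_1 using hi(1) ddq by (rule order_trans)
        also have "\<dots> \<le> K * ?dq" using K1 d0 ddq by (intro mult_right_mono) auto
        finally show "\<bar>h * (real i - real I)\<bar> \<le> K * ?dq" .
        have "norm (xs h i - xs h I) \<le> K * (h * (real i - real I))"
          by (rule xs_increment[OF h]) (use i IJ in auto)
        also have "\<dots> \<le> K * ?dq" using hi ddq K1 by (intro mult_left_mono) auto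
        finally show "norm (xs h i - xs h I) \<le> K * ?dq" .
        have "norm (ys h i - ys h I) \<le> K * (qs h i - qs h I)"
          by (rule ys_increment[OF h]) (use i IJ in auto)
        also have "\<dots> \<le> K * ?dq" using qi K1 by (intro mult_left_mono) auto
        finally show "norm (ys h i - ys h I) \<le> K * ?dq" .
      qed
      finally have dist: "dist (t0 + h * real i, xs h i, ys h i) (t0 + h * real I, xs h I, ys h I) \<le> 3 * K * ?dq"
        by simp
      have inS: "(t0 + h * real i, xs h i, ys h i) \<in> S" "(t0 + h * real I, xs h I, ys h I) \<in> S"
        unfolding S_def mem_Times_iff fst_conv snd_conv using ok okI theta_in[OF h, of i] theta_in[OF h, of I] iN i by simp_all
      have Gd: "norm (?gi - ?gI) \<le> \<epsilon> + CG * (3 * K * ?dq)"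
        using CG(2)[OF inS] mult_left_mono[OF dist CG(1)] by linarith
      have "norm (xs h (Suc i) - xs h I) \<le> K * (h * (real (Suc i) - real I))"
        by (rule xs_increment[OF h]) (use i IJ in auto)
      also have "\<dots> \<le> K * ?d" by (rule mult_left_mono[OF hi(2)]) (use K1 in simp)
      finally have "dist (xs h (Suc i)) (xs h I) \<le> K * ?d" by (simp add: dist_norm)
      then have nd: "norm (?ni - ?nI) \<le> \<epsilon> + Cn * (K * ?d)"
        using Cn(2)[OF ok(4) okI(1)] mult_left_mono[OF _ Cn(1)] by fastforce
      have eq: "(ys h (Suc i) - (h * real (Suc i)) *\<^sub>R ?gI - ls h (Suc i) *\<^sub>R ?nI) - (ys h i - (h * real i) *\<^sub>R ?gI - ls h i *\<^sub>R ?nI)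
         = h *\<^sub>R (?gi - ?gI) + ?a *\<^sub>R (?ni - ?nI)"
        unfolding scheme_Suc(2,3) by (simp add: free_def algebra_simps)
      have "norm (h *\<^sub>R (?gi - ?gI)) \<le> h * (\<epsilon> + CG * (3 * K * ?dq))"
        using h(1) Gd by (simp add: mult_left_mono)
      moreover have "norm (?a *\<^sub>R (?ni - ?nI)) \<le> ?a * (\<epsilon> + Cn * (K * ?d))"
        using a0 nd by (simp add: mult_left_mono)
      ultimately have "norm (h *\<^sub>R (?gi - ?gI) + ?a *\<^sub>R (?ni - ?nI))
         \<le> h * (\<epsilon> + CG * (3 * K * ?dq)) + ?a * (\<epsilon> + Cn * (K * ?d))"
        by (rule norm_triangle_mono)
      then show "norm ((ys h (Suc i) - (h * real (Suc i)) *\<^sub>R ?gI - ls h (Suc i) *\<^sub>R ?nI) - (ys h i - (h * real i) *\<^sub>R ?gI - ls h i *\<^sub>R ?nI))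
         \<le> ((\<epsilon> + CG * (3 * K * ?dq)) * (h * real (Suc i)) + (\<epsilon> + Cn * (K * ?d)) * ls h (Suc i))
        - ((\<epsilon> + CG * (3 * K * ?dq)) * (h * real i) + (\<epsilon> + Cn * (K * ?d)) * ls h i)"
        unfolding eq by (simp add: algebra_simps)
    qed
    also have "\<dots> = (\<epsilon> + CG * (3 * K * ?dq)) * ?d + (\<epsilon> + Cn * (K * ?d)) * (?dq - ?d)"
      by (simp add: qs_def algebra_simps)
    also have "\<dots> \<le> (\<epsilon> + C * ?d) * ?dq"
    proof -
      have "0 \<le> Cn * (K * ?d) * ?d"
        by (intro mult_nonneg_nonneg[of _ ?d] mult_nonneg_nonneg[of Cn] mult_nonneg_nonneg[of K] d0 Cn(1))
           (use K1 in simp)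
      moreover have "(\<epsilon> + CG * (3 * K * ?dq)) * ?d + (\<epsilon> + Cn * (K * ?d)) * (?dq - ?d) + Cn * (K * ?d) * ?d
        = (\<epsilon> + C * ?d) * ?dq"
        unfolding C_def by (simp only: ring_distribs mult_ac)
      ultimately show ?thesis by linarith
    qed
    finally show ?thesis by (simp add: algebra_simps)
  qed
  then show ?thesis using that by blast
qed

end

section \<open>Pointwise limits of the polygons\<close>

context bouncing_scheme
begin

text \<open>
  Step size, index of the grid point reached at time \<open>t\<close>, and time elapsed since \<open>t0\<close>. The last two are
  truncated to the interval \<open>[t0, t0 + \<tau>]\<close>, which makes all functions below defined, with the same
  estimates, on the whole line.
\<close>
definition hk :: "nat \<Rightarrow> real" where "hk k = \<tau> / real (Suc k)"
definition jk :: "nat \<Rightarrow> real \<Rightarrow> nat" where "jk k t = min (Suc k) (nat \<lfloor>(t - t0) / hk k\<rfloor>)"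
definition \<sigma> :: "real \<Rightarrow> real" where "\<sigma> t = min \<tau> (max 0 (t - t0))"

lemma hk_pos: "hk k > 0" and hk_total: "hk k * real (Suc k) = \<tau>"
  using \<tau> by (simp_all add: hk_def)

lemma hk_tendsto: "hk \<longlonglongrightarrow> 0"
proof -
  have "(\<lambda>k. \<tau> * inverse (real (Suc k))) \<longlonglongrightarrow> \<tau> * 0"
    by (intro tendsto_intros LIMSEQ_inverse_real_of_nat)
  then show ?thesis unfolding hk_def[abs_def] by (simp add: divide_inverse)
qed

lemma jk_le: "jk k t \<le> Suc k" unfolding jk_def by simp

lemma jk_mono: "s \<le> t \<Longrightarrow> jk k s \<le> jk k t"
  unfolding jk_def using hk_pos[of k]
  by (intro min.mono nat_mono floor_mono divide_right_mono) auto

lemma jk_before: "t \<le> t0 \<Longrightarrow> jk k t = 0"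
  unfolding jk_def using hk_pos[of k] by (simp add: divide_nonpos_pos)

lemma jk_after: "t \<ge> t0 + \<tau> \<Longrightarrow> jk k t = Suc k"
proof -
  assume t: "t \<ge> t0 + \<tau>"
  have "real (Suc k) \<le> (t - t0) / hk k"
    using hk_pos[of k] hk_total[of k] t by (simp add: pos_le_divide_eq mult.commute)
  then have "int (Suc k) \<le> \<lfloor>(t - t0) / hk k\<rfloor>" by (simp only: le_floor_iff of_int_of_nat_eq)
  then show "jk k t = Suc k" unfolding jk_def by (simp add: le_nat_iff)
qed

lemma jk_near: "\<bar>hk k * real (jk k t) - \<sigma> t\<bar> \<le> hk k"
proof -
  consider "t \<le> t0" | "t \<ge> t0 + \<tau>" | "t0 < t" "t < t0 + \<tau>" by linarith
  then show ?thesis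
  proof cases
    case 1
    then show ?thesis using jk_before[of t k] \<tau> hk_pos[of k] by (simp add: \<sigma>_def)
  next
    case 2
    then have "hk k * real (jk k t) = \<tau>" using jk_after[of t k] hk_total[of k] by simp
    then show ?thesis using 2 \<tau> hk_pos[of k] by (simp add: \<sigma>_def)
  next
    case 3
    define q where "q = (t - t0) / hk k"
    have q0: "q > 0" and hq: "hk k * q = t - t0" unfolding q_def using 3 hk_pos[of k] by simp_all
    have "hk k * q < hk k * real (Suc k)" unfolding hq hk_total using 3 by simp
    then have "q < real (Suc k)" using hk_pos[of k] by simp
    then have "nat \<lfloor>q\<rfloor> \<le> Suc k" using q0 by (simp add: nat_le_iff floor_le_iff)
    then have j: "real (jk k t) = of_int \<lfloor>q\<rfloor>"
      unfolding jk_def q_def[symmetric] using q0 by simp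
    have "\<bar>of_int \<lfloor>q\<rfloor> - q\<bar> \<le> 1" by linarith
    then have "hk k * \<bar>of_int \<lfloor>q\<rfloor> - q\<bar> \<le> hk k * 1" using hk_pos[of k] by (intro mult_left_mono) auto
    moreover have "hk k * \<bar>of_int \<lfloor>q\<rfloor> - q\<bar> = \<bar>hk k * of_int \<lfloor>q\<rfloor> - (t - t0)\<bar>"
      unfolding hq[symmetric] right_diff_distrib[symmetric] abs_mult using hk_pos[of k] by simp
    moreover have "\<sigma> t = t - t0" unfolding \<sigma>_def using 3 by simp
    ultimately show ?thesis unfolding j by simp
  qed
qed

lemma jk_tendsto: "(\<lambda>k. hk k * real (jk k t)) \<longlonglongrightarrow> \<sigma> t"
proof (rule LIM_zero_cancel, rule Lim_null_comparison[OF _ hk_tendsto])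
  show "\<forall>\<^sub>F k in sequentially. norm (hk k * real (jk k t) - \<sigma> t) \<le> hk k"
    using jk_near by simp
qed

lemma \<sigma>_mono: "s \<le> t \<Longrightarrow> \<sigma> s \<le> \<sigma> t" unfolding \<sigma>_def by auto

lemma \<sigma>_lip: "s \<le> t \<Longrightarrow> \<sigma> t - \<sigma> s \<le> t - s" unfolding \<sigma>_def by auto

lemma \<sigma>_in: "t0 \<le> t \<Longrightarrow> t \<le> t0 + \<tau> \<Longrightarrow> \<sigma> t = t - t0" unfolding \<sigma>_def by auto

lemma \<psi>_continuous: "continuous_on (cball x0 r) \<psi>"
proof (rule continuous_onI)
  fix x \<epsilon> assume x: "x \<in> cball x0 r" and \<epsilon>: "(0::real) < \<epsilon>"
  have "dist (\<psi> y) (\<psi> x) \<le> \<epsilon>" if "y \<in> cball x0 r" "dist y x < \<epsilon> / K" for y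
  proof -
    have "dist (\<psi> y) (\<psi> x) \<le> K * dist y x" using \<psi>_lip[OF that(1) x] by (simp add: dist_norm)
    also have "\<dots> \<le> K * (\<epsilon> / K)" using that(2) K1 by (intro mult_left_mono) auto
    finally show ?thesis using K1 by simp
  qed
  then show "\<exists>d>0. \<forall>y\<in>cball x0 r. dist y x < d \<longrightarrow> dist (\<psi> y) (\<psi> x) \<le> \<epsilon>"
    using \<epsilon> K1 by (intro exI[of _ "\<epsilon> / K"]) auto
qed

text \<open>
  Each estimate for the polygons is a weak inequality between continuous expressions in finitely many
  of their values and the step size, so it passes to pointwise limits. Off contact, a ball around \<open>X t\<close> on which \<open>\<phi> > 0\<close>
  contains the polygons for a time that does not depend on the step size, and in that time no impulse
  occurs.
\<close>
lemma limit_motion: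
  obtains X V :: "real \<Rightarrow> 'a" and \<Lambda> :: "real \<Rightarrow> real" where
    "\<And>s t. s \<le> t \<Longrightarrow> \<Lambda> s \<le> \<Lambda> t"
    "\<And>t. t \<le> t0 \<Longrightarrow> X t = x0 \<and> V t = v0 \<and> \<Lambda> t = 0"
    "\<And>t. t \<ge> t0 + \<tau> \<Longrightarrow> \<Lambda> t = \<Lambda> (t0 + \<tau>)"
    "\<And>t. \<Lambda> t \<le> 6 * K^4 * \<sigma> t"
    "\<And>s t. s \<le> t \<Longrightarrow> norm (V t - V s) \<le> K * ((\<sigma> t - \<sigma> s) + (\<Lambda> t - \<Lambda> s))"
    "\<And>s t. s \<le> t \<Longrightarrow> norm (X t - X s) \<le> K * (\<sigma> t - \<sigma> s)"
    "\<And>s t. s \<le> t \<Longrightarrow> norm (X t - X s - (\<sigma> t - \<sigma> s) *\<^sub>R V s)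
        \<le> (\<sigma> t - \<sigma> s) * (K * ((\<sigma> t - \<sigma> s) + (\<Lambda> t - \<Lambda> s)))"
    "\<And>\<epsilon>. \<epsilon> > 0 \<Longrightarrow> \<exists>C. \<forall>s t. s \<le> t \<longrightarrow>
        norm (V t - V s - (\<sigma> t - \<sigma> s) *\<^sub>R G (t0 + \<sigma> s, X s, V s) - (\<Lambda> t - \<Lambda> s) *\<^sub>R n (X s))
        \<le> (\<epsilon> + C * (\<sigma> t - \<sigma> s)) * ((\<sigma> t - \<sigma> s) + (\<Lambda> t - \<Lambda> s))"
    "\<And>s t. s \<le> t \<Longrightarrow> \<bar>rebound e (\<psi> (X t) \<bullet> V t) - rebound e (\<psi> (X s) \<bullet> V s)\<bar> \<le> 3 * K^3 * (\<sigma> t - \<sigma> s)"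
    "\<And>t. \<phi> (X t) \<ge> 0"
    "\<And>t. X t \<in> cball x0 r"
    "\<And>t. \<phi> (X t) > 0 \<Longrightarrow> \<exists>\<delta>>0. \<Lambda> (t + \<delta>) = \<Lambda> (t - \<delta>)"
proof -
  have hN: "hk k * real (Suc k) \<le> \<tau>" for k using hk_total[of k] by simp
  note h = hk_pos hN
  define z where "z k t = (xs (hk k) (jk k t), ys (hk k) (jk k t))" for k t
  \<comment> \<open>positions and velocities each have increments dominated by \<open>K * qs\<close>, hence the factor \<open>2\<close>\<close>
  define Q where "Q k t = 2 * K * qs (hk k) (jk k t)" for k t
  note balls = scheme_in_balls[OF h jk_le]
  have inc: "norm (z k t - z k s) \<le> Q k t - Q k s" if "s \<le> t" for k s t
  proof -
    note J = jk_mono[OF that, of k] jk_le[of k t]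
    have "norm (z k t - z k s) \<le> norm (xs (hk k) (jk k t) - xs (hk k) (jk k s)) + norm (ys (hk k) (jk k t) - ys (hk k) (jk k s))"
      unfolding z_def using norm_Pair_le by simp
    also have "\<dots> \<le> K * (qs (hk k) (jk k t) - qs (hk k) (jk k s)) + K * (qs (hk k) (jk k t) - qs (hk k) (jk k s))"
    proof (rule add_mono)
      show "norm (xs (hk k) (jk k t) - xs (hk k) (jk k s)) \<le> K * (qs (hk k) (jk k t) - qs (hk k) (jk k s))"
        using xs_increment[OF h J] mult_left_mono[OF qs_diff_ge[OF h J], of K] K1 by linarith
      show "norm (ys (hk k) (jk k t) - ys (hk k) (jk k s)) \<le> K * (qs (hk k) (jk k t) - qs (hk k) (jk k s))"
        by (rule ys_increment[OF h J])
    qed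
    finally show ?thesis by (simp add: Q_def algebra_simps)
  qed
  define B where "B = (norm x0 + r + K) + 2 * K * (\<tau> + 6 * K^4 * \<tau>)"
  have hj: "0 \<le> hk k * real (jk k t)" "hk k * real (jk k t) \<le> \<tau>" for k t
    using theta_in[OF h jk_le, of k t] by simp_all
  have qB: "0 \<le> qs (hk k) (jk k t)" "qs (hk k) (jk k t) \<le> \<tau> + 6 * K^4 * \<tau>" for k t
  proof -
    have "0 \<le> ls (hk k) (jk k t)" using ls_mono[OF h, of 0 "jk k t"] jk_le[of k t] by (simp add: scheme_0)
    then show "0 \<le> qs (hk k) (jk k t)" using hj by (simp add: qs_def)
    have "6 * K^4 * (hk k * real (jk k t)) \<le> 6 * K^4 * \<tau>" using hj[of k t] K1 by (intro mult_left_mono) auto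
    then show "qs (hk k) (jk k t) \<le> \<tau> + 6 * K^4 * \<tau>" using balls[of k t] hj[of k t] by (simp add: qs_def)
  qed
  have c0: "0 \<le> 2 * K * (\<tau> + 6 * K^4 * \<tau>)" using K1 \<tau> by simp
  have bz: "norm (z k t) \<le> B" for k t
  proof -
    have "norm (xs (hk k) (jk k t)) \<le> norm x0 + r"
      using balls[of k t] norm_triangle_ineq2[of "xs (hk k) (jk k t)" x0] by (simp add: dist_norm norm_minus_commute)
    moreover have "norm (ys (hk k) (jk k t)) \<le> K" using balls[of k t] ball_v_le by simp
    ultimately have "norm (z k t) \<le> (norm x0 + r) + K" unfolding z_def by (intro order_trans[OF norm_Pair_le] add_mono)
    then show ?thesis using c0 unfolding B_def by linarith
  qed
  have bQ: "\<bar>Q k t\<bar> \<le> B" for k t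
  proof -
    have "0 \<le> Q k t" unfolding Q_def using qB[of k t] K1 by simp
    moreover have "Q k t \<le> 2 * K * (\<tau> + 6 * K^4 * \<tau>)"
      unfolding Q_def using qB[of k t] K1 by (intro mult_left_mono) auto
    ultimately show ?thesis unfolding B_def using r K1 norm_ge_zero[of x0] by linarith
  qed
  obtain \<rho> where \<rho>: "strict_mono (\<rho> :: nat \<Rightarrow> nat)" and zc: "\<And>t. convergent (\<lambda>k. z (\<rho> k) t)"
    and Qc: "\<And>t. convergent (\<lambda>k. Q (\<rho> k) t)"
    using helly_selection_dominated[of z Q B, OF inc bz bQ] by blast
  define H where "H k = hk (\<rho> k)" for k
  define J where "J k t = jk (\<rho> k) t" for k t
  note h' = hk_pos[of "\<rho> k" for k, folded H_def] hN[of "\<rho> k" for k, folded H_def]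
  have Jle: "J k t \<le> Suc (\<rho> k)" for k t unfolding J_def by (rule jk_le)
  have Jm: "s \<le> t \<Longrightarrow> J k s \<le> J k t" for k s t unfolding J_def by (rule jk_mono)
  have Ht: "H \<longlonglongrightarrow> 0"
    using LIMSEQ_subseq_LIMSEQ[OF hk_tendsto \<rho>] by (simp add: H_def[abs_def] o_def)
  have HJ: "(\<lambda>k. H k * real (J k t)) \<longlonglongrightarrow> \<sigma> t" for t
    using LIMSEQ_subseq_LIMSEQ[OF jk_tendsto \<rho>] by (simp add: H_def J_def o_def)
  define X where "X t = lim (\<lambda>k. xs (H k) (J k t))" for t
  define V where "V t = lim (\<lambda>k. ys (H k) (J k t))" for t
  define \<Lambda> where "\<Lambda> t = lim (\<lambda>k. ls (H k) (J k t))" for t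
  have Xt: "(\<lambda>k. xs (H k) (J k t)) \<longlonglongrightarrow> X t" for t
    using convergent_PairD(1)[OF zc[of t, unfolded z_def]] unfolding X_def H_def J_def convergent_LIMSEQ_iff .
  have Vt: "(\<lambda>k. ys (H k) (J k t)) \<longlonglongrightarrow> V t" for t
    using convergent_PairD(2)[OF zc[of t, unfolded z_def]] unfolding V_def H_def J_def convergent_LIMSEQ_iff .
  have \<Lambda>t: "(\<lambda>k. ls (H k) (J k t)) \<longlonglongrightarrow> \<Lambda> t" for t
  proof -
    have "(\<lambda>k. Q (\<rho> k) t / (2 * K) - H k * real (J k t)) \<longlonglongrightarrow> lim (\<lambda>k. Q (\<rho> k) t) / (2 * K) - \<sigma> t"
      using K1 by (intro tendsto_intros HJ Qc[of t, unfolded convergent_LIMSEQ_iff]) simp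
    moreover have "Q (\<rho> k) t / (2 * K) - H k * real (J k t) = ls (H k) (J k t)" for k
      unfolding Q_def qs_def H_def J_def using K1 by simp
    ultimately have "convergent (\<lambda>k. ls (H k) (J k t))" by (auto intro: convergentI)
    then show ?thesis unfolding \<Lambda>_def convergent_LIMSEQ_iff .
  qed
  have Qt: "(\<lambda>k. qs (H k) (J k t) - qs (H k) (J k s)) \<longlonglongrightarrow> (\<sigma> t - \<sigma> s) + (\<Lambda> t - \<Lambda> s)" for s t
  proof -
    have "(\<lambda>k. (H k * real (J k t) - H k * real (J k s)) + (ls (H k) (J k t) - ls (H k) (J k s)))
       \<longlonglongrightarrow> (\<sigma> t - \<sigma> s) + (\<Lambda> t - \<Lambda> s)"
      by (intro tendsto_intros HJ \<Lambda>t)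
    then show ?thesis by (simp add: qs_def algebra_simps)
  qed
  have Dt: "(\<lambda>k. H k * (real (J k t) - real (J k s))) \<longlonglongrightarrow> \<sigma> t - \<sigma> s" for s t
    unfolding right_diff_distrib by (intro tendsto_intros HJ)
  have balls': "xs (H k) (J k t) \<in> cball x0 r" for k t
    using balls unfolding H_def J_def by blast
  have Xin: "X t \<in> cball x0 r" for t
    by (rule Lim_in_closed_set[OF closed_cball _ _ Xt]) (use balls' in auto)
  have G_lim: "(\<lambda>k. G (t0 + H k * real (J k s), xs (H k) (J k s), ys (H k) (J k s))) \<longlonglongrightarrow> G (t0 + \<sigma> s, X s, V s)" for s
    by (rule continuous_on_tendsto_compose[OF contG]) (auto intro!: tendsto_intros HJ Xt Vt)
  have n_lim: "(\<lambda>k. n (xs (H k) (J k s))) \<longlonglongrightarrow> n (X s)" for s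
    by (rule continuous_on_tendsto_compose[OF contn]) (auto intro!: Xt)
  have \<psi>_lim: "(\<lambda>k. \<psi> (xs (H k) (J k s))) \<longlonglongrightarrow> \<psi> (X s)" for s
    by (rule continuous_on_tendsto_compose[OF \<psi>_continuous Xt Xin]) (use balls' in auto)
  have \<phi>_lim: "(\<lambda>k. \<phi> (xs (H k) (J k s))) \<longlonglongrightarrow> \<phi> (X s)" for s
    by (rule isCont_tendsto_compose[OF has_derivative_continuous[OF \<phi>_deriv[OF Xin]] Xt])
  show ?thesis
  proof
    fix s t :: real assume st: "s \<le> t"
    note IJ = Jm[OF st] Jle
    show "\<Lambda> s \<le> \<Lambda> t"
      by (rule LIMSEQ_le[OF \<Lambda>t \<Lambda>t]) (use ls_mono[OF h' IJ] in auto)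
    show "norm (V t - V s) \<le> K * ((\<sigma> t - \<sigma> s) + (\<Lambda> t - \<Lambda> s))"
      by (rule LIMSEQ_le[OF tendsto_norm[OF tendsto_diff[OF Vt Vt]] tendsto_mult[OF tendsto_const Qt]])
         (use ys_increment[OF h' IJ] in auto)
    show "norm (X t - X s) \<le> K * (\<sigma> t - \<sigma> s)"
      by (rule LIMSEQ_le[OF tendsto_norm[OF tendsto_diff[OF Xt Xt]] tendsto_mult[OF tendsto_const Dt]])
         (use xs_increment[OF h' IJ] in auto)
    show "norm (X t - X s - (\<sigma> t - \<sigma> s) *\<^sub>R V s)
        \<le> (\<sigma> t - \<sigma> s) * (K * ((\<sigma> t - \<sigma> s) + (\<Lambda> t - \<Lambda> s)))"
      by (rule LIMSEQ_le[OF tendsto_norm[OF tendsto_diff[OF tendsto_diff[OF Xt Xt] tendsto_scaleR[OF Dt Vt]]]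
           tendsto_mult[OF Dt tendsto_mult[OF tendsto_const Qt]]])
         (use xs_linear_increment[OF h' IJ] in auto)
    show "\<bar>rebound e (\<psi> (X t) \<bullet> V t) - rebound e (\<psi> (X s) \<bullet> V s)\<bar> \<le> 3 * K^3 * (\<sigma> t - \<sigma> s)"
    proof (rule LIMSEQ_le)
      show "(\<lambda>k. 3 * K^3 * (H k * (real (J k t) - real (J k s)))) \<longlonglongrightarrow> 3 * K^3 * (\<sigma> t - \<sigma> s)"
        by (rule tendsto_mult[OF tendsto_const Dt])
      show "(\<lambda>k. \<bar>rebound e (ws (H k) (J k t)) - rebound e (ws (H k) (J k s))\<bar>) \<longlonglongrightarrow>
          \<bar>rebound e (\<psi> (X t) \<bullet> V t) - rebound e (\<psi> (X s) \<bullet> V s)\<bar>"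
        unfolding rebound_def ws_def by (intro tendsto_intros \<psi>_lim Vt)
      show "\<exists>N. \<forall>k\<ge>N. \<bar>rebound e (ws (H k) (J k t)) - rebound e (ws (H k) (J k s))\<bar>
          \<le> 3 * K^3 * (H k * (real (J k t) - real (J k s)))"
        using rebound_increment[OF h' IJ] by auto
    qed
  next
    fix t :: real assume t: "t \<le> t0"
    have "J k t = 0" for k unfolding J_def by (rule jk_before[OF t])
    then show "X t = x0 \<and> V t = v0 \<and> \<Lambda> t = 0"
      unfolding X_def V_def \<Lambda>_def by (simp add: scheme_0)
  next
    fix t :: real assume t: "t \<ge> t0 + \<tau>"
    then have "J k t = J k (t0 + \<tau>)" for k unfolding J_def by (simp add: jk_after)
    then show "\<Lambda> t = \<Lambda> (t0 + \<tau>)" unfolding \<Lambda>_def by simp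
  next
    fix t
    show "\<Lambda> t \<le> 6 * K^4 * \<sigma> t"
      by (rule LIMSEQ_le[OF \<Lambda>t tendsto_mult[OF tendsto_const HJ]])
         (use balls in \<open>auto simp: H_def J_def\<close>)
    show "X t \<in> cball x0 r" by (rule Xin)
    have "(\<lambda>k. - (K^2 * H k) - K^3 * H k * (H k * real (J k t))) \<longlonglongrightarrow> - (K^2 * 0) - K^3 * 0 * \<sigma> t"
      by (intro tendsto_intros Ht HJ)
    then have "- (K^2 * 0) - K^3 * 0 * \<sigma> t \<le> \<phi> (X t)"
      by (rule LIMSEQ_le[OF _ \<phi>_lim]) (use penetration_le[OF h' Jle] in auto)
    then show "\<phi> (X t) \<ge> 0" by simp
  next
    fix \<epsilon> :: real assume "\<epsilon> > 0"
    then obtain C where C: "\<And>h N I J. 0 < h \<Longrightarrow> h * real N \<le> \<tau> \<Longrightarrow> I \<le> J \<Longrightarrow> J \<le> N \<Longrightarrow>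
     norm (ys h J - ys h I - (h * (real J - real I)) *\<^sub>R G (t0 + h * real I, xs h I, ys h I)
        - (ls h J - ls h I) *\<^sub>R n (xs h I))
     \<le> (\<epsilon> + C * (h * (real J - real I))) * (qs h J - qs h I)"
      by (rule velocity_increment) (rule that)
    have "norm (V t - V s - (\<sigma> t - \<sigma> s) *\<^sub>R G (t0 + \<sigma> s, X s, V s) - (\<Lambda> t - \<Lambda> s) *\<^sub>R n (X s))
        \<le> (\<epsilon> + C * (\<sigma> t - \<sigma> s)) * ((\<sigma> t - \<sigma> s) + (\<Lambda> t - \<Lambda> s))" if st: "s \<le> t" for s t
    proof (rule LIMSEQ_le)
      show "(\<lambda>k. (\<epsilon> + C * (H k * (real (J k t) - real (J k s)))) * (qs (H k) (J k t) - qs (H k) (J k s)))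
        \<longlonglongrightarrow> (\<epsilon> + C * (\<sigma> t - \<sigma> s)) * ((\<sigma> t - \<sigma> s) + (\<Lambda> t - \<Lambda> s))"
        by (intro tendsto_mult[OF tendsto_add] tendsto_mult tendsto_const Dt Qt)
      show "(\<lambda>k. norm (ys (H k) (J k t) - ys (H k) (J k s)
         - (H k * (real (J k t) - real (J k s))) *\<^sub>R G (t0 + H k * real (J k s), xs (H k) (J k s), ys (H k) (J k s))
         - (ls (H k) (J k t) - ls (H k) (J k s)) *\<^sub>R n (xs (H k) (J k s))))
        \<longlonglongrightarrow> norm (V t - V s - (\<sigma> t - \<sigma> s) *\<^sub>R G (t0 + \<sigma> s, X s, V s) - (\<Lambda> t - \<Lambda> s) *\<^sub>R n (X s))"
        by (intro tendsto_norm tendsto_diff tendsto_scaleR Vt \<Lambda>t Dt G_lim n_lim)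
    qed (use C[OF h' Jm[OF st] Jle] in blast)
    then show "\<exists>C. \<forall>s t. s \<le> t \<longrightarrow>
        norm (V t - V s - (\<sigma> t - \<sigma> s) *\<^sub>R G (t0 + \<sigma> s, X s, V s) - (\<Lambda> t - \<Lambda> s) *\<^sub>R n (X s))
        \<le> (\<epsilon> + C * (\<sigma> t - \<sigma> s)) * ((\<sigma> t - \<sigma> s) + (\<Lambda> t - \<Lambda> s))"
      by blast
  next
    fix t assume pos: "\<phi> (X t) > 0"
    have "eventually (\<lambda>y. \<phi> y > 0) (nhds (X t))"
      using order_tendstoD(1)[OF has_derivative_continuous[OF \<phi>_deriv[OF Xin], unfolded isCont_def] pos] pos
      by (auto simp: eventually_at_filter elim: eventually_mono)
    then obtain \<rho>' where \<rho>': "\<rho>' > 0" "\<And>y. dist y (X t) < \<rho>' \<Longrightarrow> \<phi> y > 0"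
      unfolding eventually_nhds_metric by blast
    define \<delta> where "\<delta> = \<rho>' / (8 * K)"
    have \<delta>: "\<delta> > 0" "K * (3 * \<delta>) < \<rho>' / 2" unfolding \<delta>_def using \<rho>' K1 by simp_all
    have "\<sigma> (t + \<delta>) - \<sigma> (t - \<delta>) < 3 * \<delta>" using \<sigma>_lip[of "t - \<delta>" "t + \<delta>"] \<delta> by simp
    from order_tendstoD(2)[OF Dt this] order_tendstoD(2)[OF tendsto_dist[OF Xt tendsto_const[of "X t"]], of t "\<rho>' / 2"]
    have ev: "eventually (\<lambda>k. H k * (real (J k (t + \<delta>)) - real (J k (t - \<delta>))) < 3 * \<delta> \<and>
        dist (xs (H k) (J k t)) (X t) < \<rho>' / 2) sequentially"
      using \<rho>' by (simp add: eventually_conj)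
    have "eventually (\<lambda>k. ls (H k) (J k (t + \<delta>)) = ls (H k) (J k (t - \<delta>))) sequentially"
      using ev
    proof eventually_elim
      case (elim k)
      let ?b = "J k (t + \<delta>)" and ?a = "J k (t - \<delta>)" and ?m = "J k t"
      have ab: "?a \<le> ?m" "?m \<le> ?b" using Jm \<delta> by simp_all
      show ?case
      proof (rule ls_constant_off_contact[OF h' _ Jle])
        fix j assume j: "?a \<le> j" "j \<le> ?b"
        have "norm (xs (H k) j - xs (H k) ?m) \<le> K * (H k * (real ?b - real ?a))"
        proof (cases "?m \<le> j")
          case True
          have "norm (xs (H k) j - xs (H k) ?m) \<le> K * (H k * (real j - real ?m))"
            by (rule xs_increment[OF h' True]) (use j Jle in \<open>auto intro: order_trans\<close>)
          also have "\<dots> \<le> K * (H k * (real ?b - real ?a))"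
            using K1 h'(1)[of k] ab j by simp
          finally show ?thesis .
        next
          case False
          then have "norm (xs (H k) ?m - xs (H k) j) \<le> K * (H k * (real ?m - real j))"
            by (intro xs_increment[OF h']) (use Jle in auto)
          also have "\<dots> \<le> K * (H k * (real ?b - real ?a))"
            using K1 h'(1)[of k] ab j by simp
          finally show ?thesis by (simp add: norm_minus_commute)
        qed
        also have "\<dots> \<le> K * (3 * \<delta>)" using K1 elim by (intro mult_left_mono) auto
        finally have "dist (xs (H k) j) (X t) < \<rho>'"
          using elim \<delta>(2) dist_triangle[of "xs (H k) j" "X t" "xs (H k) ?m"] by (simp add: dist_norm)
        then show "\<phi> (xs (H k) j) > 0" by (rule \<rho>')
      qed (use ab in simp)
    qed
    then have "(\<lambda>k. ls (H k) (J k (t - \<delta>))) \<longlonglongrightarrow> \<Lambda> (t + \<delta>)"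
      using tendsto_cong \<Lambda>t by fastforce
    then have "\<Lambda> (t + \<delta>) = \<Lambda> (t - \<delta>)" using LIMSEQ_unique \<Lambda>t by blast
    then show "\<exists>\<delta>>0. \<Lambda> (t + \<delta>) = \<Lambda> (t - \<delta>)" using \<delta>(1) by blast
  qed
qed

text \<open>
  Replacing \<open>V\<close> and \<open>\<Lambda>\<close> by their right limits makes them right-continuous. The estimates persist
  since they hold for the translated pairs \<open>s + \<rho>\<close>, \<open>t + \<rho>\<close> with \<open>\<rho> > 0\<close>. The initial velocity
  is still attained, because the total impulse grows at most linearly.
\<close>
lemma motion_exists:
  obtains x v :: "real \<Rightarrow> 'a" and \<Lambda> :: "real \<Rightarrow> real" where
    "\<And>s t. s \<le> t \<Longrightarrow> \<Lambda> s \<le> \<Lambda> t"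
    "\<And>t. continuous (at_right t) \<Lambda>"
    "\<And>t. t \<le> t0 \<Longrightarrow> \<Lambda> t = 0"
    "\<And>t. t \<ge> t0 + \<tau> \<Longrightarrow> \<Lambda> t = \<Lambda> (t0 + \<tau>)"
    "\<And>t. (v \<longlongrightarrow> v t) (at_right t)"
    "\<And>s t. s \<le> t \<Longrightarrow> norm (v t - v s) \<le> K * ((t - s) + (\<Lambda> t - \<Lambda> s))"
    "x t0 = x0" "v t0 = v0"
    "continuous_on UNIV x"
    "\<And>s t. s \<le> t \<Longrightarrow> norm (x t - x s) \<le> K * (t - s)"
    "\<And>s t. t0 \<le> s \<Longrightarrow> s \<le> t \<Longrightarrow> t \<le> t0 + \<tau> \<Longrightarrow>
       norm (x t - x s - (t - s) *\<^sub>R v s) \<le> (t - s) * (K * ((t - s) + (\<Lambda> t - \<Lambda> s)))"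
    "\<And>\<epsilon>. \<epsilon> > 0 \<Longrightarrow> \<exists>C. \<forall>s t. t0 \<le> s \<longrightarrow> s \<le> t \<longrightarrow> t \<le> t0 + \<tau> \<longrightarrow>
        norm (v t - v s - (t - s) *\<^sub>R G (s, x s, v s) - (\<Lambda> t - \<Lambda> s) *\<^sub>R n (x s))
        \<le> (\<epsilon> + C * (t - s)) * ((t - s) + (\<Lambda> t - \<Lambda> s))"
    "\<And>s t. t0 \<le> s \<Longrightarrow> s \<le> t \<Longrightarrow> t \<le> t0 + \<tau> \<Longrightarrow>
       \<bar>rebound e (\<psi> (x t) \<bullet> v t) - rebound e (\<psi> (x s) \<bullet> v s)\<bar> \<le> 3 * K^3 * (t - s)"
    "\<And>t. \<phi> (x t) \<ge> 0" "\<And>t. x t \<in> cball x0 r"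
    "\<And>t. \<phi> (x t) > 0 \<Longrightarrow> \<exists>\<delta>>0. \<Lambda> (t + \<delta>) = \<Lambda> (t - \<delta>)"
proof -
  obtain X V :: "real \<Rightarrow> 'a" and L :: "real \<Rightarrow> real" where
    Lm: "\<And>s t. s \<le> t \<Longrightarrow> L s \<le> L t" and
    before: "\<And>t. t \<le> t0 \<Longrightarrow> X t = x0 \<and> V t = v0 \<and> L t = 0" and
    after: "\<And>t. t \<ge> t0 + \<tau> \<Longrightarrow> L t = L (t0 + \<tau>)" and
    Lb: "\<And>t. L t \<le> 6 * K^4 * \<sigma> t" and
    Vi: "\<And>s t. s \<le> t \<Longrightarrow> norm (V t - V s) \<le> K * ((\<sigma> t - \<sigma> s) + (L t - L s))" and
    Xi: "\<And>s t. s \<le> t \<Longrightarrow> norm (X t - X s) \<le> K * (\<sigma> t - \<sigma> s)" and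
    Xl: "\<And>s t. s \<le> t \<Longrightarrow> norm (X t - X s - (\<sigma> t - \<sigma> s) *\<^sub>R V s)
        \<le> (\<sigma> t - \<sigma> s) * (K * ((\<sigma> t - \<sigma> s) + (L t - L s)))" and
    VG: "\<And>\<epsilon>. \<epsilon> > 0 \<Longrightarrow> \<exists>C. \<forall>s t. s \<le> t \<longrightarrow>
        norm (V t - V s - (\<sigma> t - \<sigma> s) *\<^sub>R G (t0 + \<sigma> s, X s, V s) - (L t - L s) *\<^sub>R n (X s))
        \<le> (\<epsilon> + C * (\<sigma> t - \<sigma> s)) * ((\<sigma> t - \<sigma> s) + (L t - L s))" and
    reb: "\<And>s t. s \<le> t \<Longrightarrow> \<bar>rebound e (\<psi> (X t) \<bullet> V t) - rebound e (\<psi> (X s) \<bullet> V s)\<bar> \<le> 3 * K^3 * (\<sigma> t - \<sigma> s)" and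
    pos: "\<And>t. \<phi> (X t) \<ge> 0" and
    inb: "\<And>t. X t \<in> cball x0 r" and
    off: "\<And>t. \<phi> (X t) > 0 \<Longrightarrow> \<exists>\<delta>>0. L (t + \<delta>) = L (t - \<delta>)"
    by (rule limit_motion) (rule that)
  have Xi': "norm (X t - X s) \<le> K * (t - s)" if "s \<le> t" for s t
  proof -
    have "K * (\<sigma> t - \<sigma> s) \<le> K * (t - s)" using \<sigma>_lip[OF that] K1 by (intro mult_left_mono) auto
    then show ?thesis using Xi[OF that] by simp
  qed
  have Xc: "continuous_on UNIV X"
  proof (rule continuous_onI)
    fix t \<epsilon> :: real assume \<epsilon>: "\<epsilon> > 0"
    have lip: "dist (X s) (X t) \<le> K * \<bar>s - t\<bar>" for s
      using Xi'[of s t] Xi'[of t s] by (cases "s \<le> t") (simp_all add: dist_norm norm_minus_commute)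
    have "dist (X s) (X t) \<le> \<epsilon>" if "dist s t < \<epsilon> / K" for s
    proof -
      have "K * \<bar>s - t\<bar> \<le> K * (\<epsilon> / K)" using that K1 by (intro mult_left_mono) (auto simp: dist_real_def)
      then show ?thesis using lip[of s] K1 by simp
    qed
    then show "\<exists>d>0. \<forall>s\<in>UNIV. dist s t < d \<longrightarrow> dist (X s) (X t) \<le> \<epsilon>"
      using \<epsilon> K1 by (intro exI[of _ "\<epsilon> / K"]) auto
  qed
  have VL_inc: "norm ((V t, L t) - (V s, L s)) \<le> (K + 1) * (\<sigma> t + L t) - (K + 1) * (\<sigma> s + L s)" if "s \<le> t" for s t
  proof -
    have "norm ((V t, L t) - (V s, L s)) \<le> norm (V t - V s) + norm (L t - L s)"
      using norm_Pair_le[of "V t - V s" "L t - L s"] by simp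
    also have "\<dots> \<le> K * ((\<sigma> t - \<sigma> s) + (L t - L s)) + ((\<sigma> t - \<sigma> s) + (L t - L s))"
      using Vi[OF that] \<sigma>_mono[OF that] Lm[OF that] by simp
    finally show ?thesis by (simp add: algebra_simps)
  qed
  have VL_lim: "\<exists>l. ((\<lambda>t. (V t, L t)) \<longlongrightarrow> l) (at_right a)" for a
    by (rule dominated_right_limit[OF VL_inc])
  have ex: "\<forall>a. \<exists>p. (V \<longlongrightarrow> fst p) (at_right a) \<and> (L \<longlongrightarrow> snd p) (at_right a)"
  proof
    fix a
    obtain l where l: "((\<lambda>t. (V t, L t)) \<longlongrightarrow> l) (at_right a)" using VL_lim by blast
    show "\<exists>p. (V \<longlongrightarrow> fst p) (at_right a) \<and> (L \<longlongrightarrow> snd p) (at_right a)"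
      using tendsto_fst[OF l] tendsto_snd[OF l] by auto
  qed
  then obtain p where p: "\<And>a. (V \<longlongrightarrow> fst (p a)) (at_right a)" "\<And>a. (L \<longlongrightarrow> snd (p a)) (at_right a)"
    using choice[OF ex] by blast
  define v where "v a = fst (p a)" for a
  define \<Lambda> where "\<Lambda> a = snd (p a)" for a
  have vt: "((\<lambda>\<rho>. V (\<rho> + a)) \<longlongrightarrow> v a) (at_right 0)" for a
    using p(1)[of a] unfolding v_def by (simp add: filterlim_at_right_to_0[of V _ a])
  have \<Lambda>t: "((\<lambda>\<rho>. L (\<rho> + a)) \<longlongrightarrow> \<Lambda> a) (at_right 0)" for a
    using p(2)[of a] unfolding \<Lambda>_def by (simp add: filterlim_at_right_to_0[of L _ a])
  have sh: "((\<lambda>\<rho>. \<rho> + a) \<longlongrightarrow> a) (at_right 0)" for a :: real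
    by (rule tendsto_eq_intros refl | simp)+
  have \<sigma>t: "((\<lambda>\<rho>. \<sigma> (\<rho> + a)) \<longlongrightarrow> \<sigma> a) (at_right 0)" for a
    unfolding \<sigma>_def by (intro tendsto_intros sh)
  have Xt: "((\<lambda>\<rho>. X (\<rho> + a)) \<longlongrightarrow> X a) (at_right 0)" for a
    by (rule continuous_on_tendsto_compose[OF Xc sh]) auto
  have \<Lambda>m: "\<Lambda> s \<le> \<Lambda> t" if "s \<le> t" for s t
    by (rule tendsto_le[OF _ \<Lambda>t \<Lambda>t]) (use Lm that in auto)
  have Lle: "L t \<le> \<Lambda> t" for t
    by (rule tendsto_lowerbound[OF \<Lambda>t]) (auto simp: eventually_at_right_field intro!: Lm exI[of _ 1])
  have \<Lambda>le: "\<Lambda> s \<le> L t" if "s < t" for s t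
    by (rule tendsto_upperbound[OF \<Lambda>t])
       (use that in \<open>auto simp: eventually_at_right_field intro!: Lm exI[of _ "t - s"]\<close>)
  have v_inc: "norm (v t - v s) \<le> K * ((\<sigma> t - \<sigma> s) + (\<Lambda> t - \<Lambda> s))" if "s \<le> t" for s t
    by (rule tendsto_le[OF _ tendsto_mult[OF tendsto_const tendsto_add[OF tendsto_diff[OF \<sigma>t \<sigma>t] tendsto_diff[OF \<Lambda>t \<Lambda>t]]]
        tendsto_norm[OF tendsto_diff[OF vt vt]]])
       (use Vi that in auto)
  have v_inc': "norm (v t - v s) \<le> K * ((t - s) + (\<Lambda> t - \<Lambda> s))" if "s \<le> t" for s t
  proof -
    have "K * ((\<sigma> t - \<sigma> s) + (\<Lambda> t - \<Lambda> s)) \<le> K * ((t - s) + (\<Lambda> t - \<Lambda> s))"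
      using \<sigma>_lip[OF that] K1 by (intro mult_left_mono) auto
    then show ?thesis using v_inc[OF that] by linarith
  qed
  have \<Lambda>_right: "(\<Lambda> \<longlongrightarrow> \<Lambda> a) (at_right a)" for a
  proof (rule tendsto_sandwich)
    show "\<forall>\<^sub>F t in at_right a. \<Lambda> a \<le> \<Lambda> t"
      using \<Lambda>m by (auto simp: eventually_at_right_field intro!: exI[of _ "a + 1"])
    \<comment> \<open>\<open>\<Lambda> t\<close> is a right limit at \<open>t\<close>, so it is dominated by \<open>L\<close> only strictly to the right of \<open>t\<close>\<close>
    show "\<forall>\<^sub>F t in at_right a. \<Lambda> t \<le> L (a + 2 * (t - a))"
      using \<Lambda>le by (auto simp: eventually_at_right_field intro!: exI[of _ "a + 1"])
    have "filterlim (\<lambda>t. a + 2 * (t - a)) (at_right a) (at_right a)"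
      unfolding filterlim_at
      by (intro conjI tendsto_eq_intros eventually_at_rightI[of a "a+1"]) auto
    then show "((\<lambda>t. L (a + 2 * (t - a))) \<longlongrightarrow> \<Lambda> a) (at_right a)"
      using filterlim_compose[OF p(2)[of a, folded \<Lambda>_def]] by blast
  qed simp
  have v_right: "(v \<longlongrightarrow> v a) (at_right a)" for a
  proof (rule LIM_zero_cancel, rule Lim_null_comparison)
    show "\<forall>\<^sub>F t in at_right a. norm (v t - v a) \<le> K * ((t - a) + (\<Lambda> t - \<Lambda> a))"
      using v_inc' by (auto simp: eventually_at_right_field intro!: exI[of _ "a + 1"])
    have "((\<lambda>t. K * ((t - a) + (\<Lambda> t - \<Lambda> a))) \<longlongrightarrow> K * ((a - a) + (\<Lambda> a - \<Lambda> a))) (at_right a)"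
      by (intro tendsto_intros \<Lambda>_right)
    then show "((\<lambda>t. K * ((t - a) + (\<Lambda> t - \<Lambda> a))) \<longlongrightarrow> 0) (at_right a)" by simp
  qed
  have \<Lambda>_ub: "\<Lambda> t \<le> 6 * K^4 * \<sigma> t" for t
    by (rule tendsto_le[OF _ tendsto_mult[OF tendsto_const \<sigma>t] \<Lambda>t]) (use Lb in auto)
  have \<Lambda>0: "\<Lambda> t = 0" if "t \<le> t0" for t
    using \<Lambda>_ub[of t] Lle[of t] before[of t] that \<tau> by (simp add: \<sigma>_def)
  show ?thesis
  proof
    fix t
    show "continuous (at_right t) \<Lambda>" unfolding continuous_within by (rule \<Lambda>_right)
    show "(v \<longlongrightarrow> v t) (at_right t)" by (rule v_right)
    show "\<phi> (X t) \<ge> 0" by (rule pos)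
    show "X t \<in> cball x0 r" by (rule inb)
  next
    fix t assume "t \<ge> t0 + \<tau>"
    moreover have "\<Lambda> u = L (t0 + \<tau>)" if "u \<ge> t0 + \<tau>" for u
    proof (rule antisym)
      have "\<Lambda> u \<le> L (u + 1)" by (rule \<Lambda>le) simp
      then show "\<Lambda> u \<le> L (t0 + \<tau>)" using after[of "u + 1"] that by simp
      show "L (t0 + \<tau>) \<le> \<Lambda> u" using Lle[of u] after[OF that] by simp
    qed
    ultimately show "\<Lambda> t = \<Lambda> (t0 + \<tau>)" by simp
  next
    show "X t0 = x0" using before by simp
    have "((\<lambda>\<rho>. V (\<rho> + t0)) \<longlongrightarrow> v0) (at_right 0)"
    proof (rule LIM_zero_cancel, rule Lim_null_comparison)
      show "\<forall>\<^sub>F \<rho> in at_right 0. norm (V (\<rho> + t0) - v0) \<le> K * (\<sigma> (\<rho> + t0) + 6 * K^4 * \<sigma> (\<rho> + t0))"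
      proof (rule eventually_at_rightI[of 0 1])
        fix \<rho> :: real assume "\<rho> \<in> {0<..<1}"
        then have "norm (V (\<rho> + t0) - V t0) \<le> K * ((\<sigma> (\<rho> + t0) - \<sigma> t0) + (L (\<rho> + t0) - L t0))"
          by (intro Vi) simp
        also have "\<dots> \<le> K * (\<sigma> (\<rho> + t0) + 6 * K^4 * \<sigma> (\<rho> + t0))"
          using Lb[of "\<rho> + t0"] before[of t0] K1 \<tau> by (intro mult_left_mono) (auto simp: \<sigma>_def)
        finally show "norm (V (\<rho> + t0) - v0) \<le> K * (\<sigma> (\<rho> + t0) + 6 * K^4 * \<sigma> (\<rho> + t0))"
          using before[of t0] by simp
      qed simp
      have "((\<lambda>\<rho>. K * (\<sigma> (\<rho> + t0) + 6 * K^4 * \<sigma> (\<rho> + t0))) \<longlongrightarrow> K * (\<sigma> t0 + 6 * K^4 * \<sigma> t0)) (at_right 0)"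
        by (intro tendsto_intros \<sigma>t)
      then show "((\<lambda>\<rho>. K * (\<sigma> (\<rho> + t0) + 6 * K^4 * \<sigma> (\<rho> + t0))) \<longlongrightarrow> 0) (at_right 0)"
        using \<tau> by (simp add: \<sigma>_def)
    qed
    then show "v t0 = v0" using tendsto_unique[OF _ vt] by auto
  next
    fix t assume "\<phi> (X t) > 0"
    then obtain \<delta> where \<delta>: "\<delta> > 0" "L (t + \<delta>) = L (t - \<delta>)" using off by blast
    have "\<Lambda> (t + \<delta>/2) = \<Lambda> (t - \<delta>/2)"
      using \<Lambda>le[of "t + \<delta>/2" "t + \<delta>"] Lle[of "t - \<delta>/2"] Lm[of "t - \<delta>" "t - \<delta>/2"]
        \<Lambda>m[of "t - \<delta>/2" "t + \<delta>/2"] \<delta> by simp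
    then show "\<exists>\<delta>>0. \<Lambda> (t + \<delta>) = \<Lambda> (t - \<delta>)" using \<delta>(1) by (intro exI[of _ "\<delta>/2"]) simp
  next
    fix \<epsilon> :: real assume "\<epsilon> > 0"
    then obtain C where C: "\<And>s t. s \<le> t \<Longrightarrow>
        norm (V t - V s - (\<sigma> t - \<sigma> s) *\<^sub>R G (t0 + \<sigma> s, X s, V s) - (L t - L s) *\<^sub>R n (X s))
        \<le> (\<epsilon> + C * (\<sigma> t - \<sigma> s)) * ((\<sigma> t - \<sigma> s) + (L t - L s))"
      using VG by blast
    have Gt: "((\<lambda>\<rho>. G (t0 + \<sigma> (\<rho> + s), X (\<rho> + s), V (\<rho> + s))) \<longlongrightarrow> G (t0 + \<sigma> s, X s, v s)) (at_right 0)" for s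
      by (rule continuous_on_tendsto_compose[OF contG]) (auto intro!: tendsto_intros \<sigma>t Xt vt)
    have nt: "((\<lambda>\<rho>. n (X (\<rho> + s))) \<longlongrightarrow> n (X s)) (at_right 0)" for s
      by (rule continuous_on_tendsto_compose[OF contn Xt]) auto
    have "norm (v t - v s - (\<sigma> t - \<sigma> s) *\<^sub>R G (t0 + \<sigma> s, X s, v s) - (\<Lambda> t - \<Lambda> s) *\<^sub>R n (X s))
        \<le> (\<epsilon> + C * (\<sigma> t - \<sigma> s)) * ((\<sigma> t - \<sigma> s) + (\<Lambda> t - \<Lambda> s))" if st: "s \<le> t" for s t
    proof (rule tendsto_le)
      show "((\<lambda>\<rho>. norm (V (\<rho> + t) - V (\<rho> + s) - (\<sigma> (\<rho> + t) - \<sigma> (\<rho> + s)) *\<^sub>R G (t0 + \<sigma> (\<rho> + s), X (\<rho> + s), V (\<rho> + s))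
            - (L (\<rho> + t) - L (\<rho> + s)) *\<^sub>R n (X (\<rho> + s)))) \<longlongrightarrow>
          norm (v t - v s - (\<sigma> t - \<sigma> s) *\<^sub>R G (t0 + \<sigma> s, X s, v s) - (\<Lambda> t - \<Lambda> s) *\<^sub>R n (X s))) (at_right 0)"
        by (intro tendsto_norm tendsto_diff tendsto_scaleR vt \<Lambda>t \<sigma>t Gt nt)
      show "((\<lambda>\<rho>. (\<epsilon> + C * (\<sigma> (\<rho> + t) - \<sigma> (\<rho> + s))) * ((\<sigma> (\<rho> + t) - \<sigma> (\<rho> + s)) + (L (\<rho> + t) - L (\<rho> + s)))) \<longlongrightarrow>
          (\<epsilon> + C * (\<sigma> t - \<sigma> s)) * ((\<sigma> t - \<sigma> s) + (\<Lambda> t - \<Lambda> s))) (at_right 0)"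
        by (intro tendsto_mult tendsto_add tendsto_diff tendsto_const \<Lambda>t \<sigma>t)
    qed (use C st in auto)
    note gen = this
    have "norm (v t - v s - (t - s) *\<^sub>R G (s, X s, v s) - (\<Lambda> t - \<Lambda> s) *\<^sub>R n (X s))
        \<le> (\<epsilon> + C * (t - s)) * ((t - s) + (\<Lambda> t - \<Lambda> s))" if "t0 \<le> s" "s \<le> t" "t \<le> t0 + \<tau>" for s t
      using gen[OF that(2)] \<sigma>_in[of s] \<sigma>_in[of t] that by simp
    then show "\<exists>C. \<forall>s t. t0 \<le> s \<longrightarrow> s \<le> t \<longrightarrow> t \<le> t0 + \<tau> \<longrightarrow>
        norm (v t - v s - (t - s) *\<^sub>R G (s, X s, v s) - (\<Lambda> t - \<Lambda> s) *\<^sub>R n (X s))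
        \<le> (\<epsilon> + C * (t - s)) * ((t - s) + (\<Lambda> t - \<Lambda> s))"
      by blast
  next
    fix s t assume st: "t0 \<le> s" "s \<le> t" "t \<le> t0 + \<tau>"
    have \<sigma>st: "\<sigma> t - \<sigma> s = t - s" using \<sigma>_in[of s] \<sigma>_in[of t] st by simp
    have "norm (X t - X s - (\<sigma> t - \<sigma> s) *\<^sub>R v s) \<le> (\<sigma> t - \<sigma> s) * (K * ((\<sigma> t - \<sigma> s) + (\<Lambda> t - \<Lambda> s)))"
      by (rule tendsto_le[OF _ tendsto_mult[OF tendsto_diff[OF \<sigma>t \<sigma>t]
            tendsto_mult[OF tendsto_const tendsto_add[OF tendsto_diff[OF \<sigma>t \<sigma>t] tendsto_diff[OF \<Lambda>t \<Lambda>t]]]]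
          tendsto_norm[OF tendsto_diff[OF tendsto_diff[OF Xt Xt] tendsto_scaleR[OF tendsto_diff[OF \<sigma>t \<sigma>t] vt]]]])
         (use Xl st in auto)
    then show "norm (X t - X s - (t - s) *\<^sub>R v s) \<le> (t - s) * (K * ((t - s) + (\<Lambda> t - \<Lambda> s)))"
      unfolding \<sigma>st .
    have \<psi>t: "((\<lambda>\<rho>. \<psi> (X (\<rho> + u))) \<longlongrightarrow> \<psi> (X u)) (at_right 0)" for u
      by (rule continuous_on_tendsto_compose[OF \<psi>_continuous Xt]) (use inb in auto)
    have "\<bar>rebound e (\<psi> (X t) \<bullet> v t) - rebound e (\<psi> (X s) \<bullet> v s)\<bar> \<le> 3 * K^3 * (\<sigma> t - \<sigma> s)"
    proof (rule tendsto_le)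
      show "((\<lambda>\<rho>. \<bar>rebound e (\<psi> (X (\<rho> + t)) \<bullet> V (\<rho> + t)) - rebound e (\<psi> (X (\<rho> + s)) \<bullet> V (\<rho> + s))\<bar>) \<longlongrightarrow>
          \<bar>rebound e (\<psi> (X t) \<bullet> v t) - rebound e (\<psi> (X s) \<bullet> v s)\<bar>) (at_right 0)"
        unfolding rebound_def by (intro tendsto_intros \<psi>t vt)
      show "((\<lambda>\<rho>. 3 * K^3 * (\<sigma> (\<rho> + t) - \<sigma> (\<rho> + s))) \<longlongrightarrow> 3 * K^3 * (\<sigma> t - \<sigma> s)) (at_right 0)"
        by (intro tendsto_mult tendsto_diff tendsto_const \<sigma>t)
    qed (use reb st in auto)
    then show "\<bar>rebound e (\<psi> (X t) \<bullet> v t) - rebound e (\<psi> (X s) \<bullet> v s)\<bar> \<le> 3 * K^3 * (t - s)"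
      unfolding \<sigma>st .
  qed (use \<Lambda>m \<Lambda>0 v_inc' Xc Xi' in auto)
qed

end

section \<open>The limit motion in terms of measures\<close>

text \<open>
  This compares the integrals of \<open>G\<close> and \<open>n\<close> over short intervals with their frozen values.
\<close>
lemma set_integral_near_const:
  fixes g :: "'a \<Rightarrow> 'b::{banach, second_countable_topology}"
  assumes B: "B \<in> sets M" "emeasure M B < \<infinity>" and g: "set_integrable M B g"
    and near: "\<And>s. s \<in> B \<Longrightarrow> norm (g s - y) \<le> \<kappa>"
  shows "norm ((LINT s:B|M. g s) - measure M B *\<^sub>R y) \<le> measure M B * \<kappa>"
proof -
  have c: "set_integrable M B (\<lambda>s. y)" and k: "set_integrable M B (\<lambda>s. \<kappa>)"
    unfolding set_integrable_def using B by auto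
  have "(LINT s:B|M. g s) - measure M B *\<^sub>R y = (LINT s:B|M. g s - y)"
    using set_integral_diff(2)[OF g c] B by (simp add: set_lebesgue_integral_def)
  also have "norm \<dots> \<le> (LINT s:B|M. norm (g s - y))"
    by (rule set_integral_norm_bound[OF set_integral_diff(1)[OF g c]])
  also have "\<dots> \<le> (LINT s:B|M. \<kappa>)"
    by (rule set_integral_mono[OF set_integrable_norm[OF set_integral_diff(1)[OF g c]] k near])
  also have "\<dots> = measure M B * \<kappa>"
    using B by (simp add: set_lebesgue_integral_def)
  finally show ?thesis .
qed

lemma set_integrable_bounded:
  fixes g :: "'a \<Rightarrow> 'b::{banach, second_countable_topology}"
  assumes "B \<in> sets M" "emeasure M B < \<infinity>" "g \<in> borel_measurable M"
    and "\<And>s. s \<in> B \<Longrightarrow> norm (g s) \<le> c"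
  shows "set_integrable M B g"
  unfolding set_integrable_def using assms by (intro integrableI_bounded_set_indicator) auto

lemma borel_measurable_dominated_increments:
  fixes v :: "real \<Rightarrow> 'a::euclidean_space"
  assumes "\<And>s t. s \<le> t \<Longrightarrow> norm (v t - v s) \<le> Q t - Q s"
  shows "v \<in> borel_measurable borel"
proof -
  have Qm: "mono Q"
    by (rule monoI) (use order_trans[OF norm_ge_zero assms] in simp)
  have "(\<lambda>t. v t \<bullet> b) \<in> borel_measurable borel" if b: "b \<in> Basis" for b
  proof -
    have "mono (\<lambda>t. v t \<bullet> b + Q t)"
    proof (rule monoI)
      fix s t :: real assume st: "s \<le> t"
      have "\<bar>(v t - v s) \<bullet> b\<bar> \<le> norm (v t - v s)" using b by (rule Basis_le_norm)
      then show "v s \<bullet> b + Q s \<le> v t \<bullet> b + Q t" using assms[OF st] by (simp add: inner_diff_left)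
    qed
    then have "(\<lambda>t. v t \<bullet> b + Q t) \<in> borel_measurable borel" by (rule borel_measurable_mono)
    then have "(\<lambda>t. (v t \<bullet> b + Q t) - Q t) \<in> borel_measurable borel"
      by (rule borel_measurable_diff) (rule borel_measurable_mono[OF Qm])
    then show ?thesis by simp
  qed
  then show ?thesis by (subst borel_measurable_euclidean_space) auto
qed

text \<open>
  At a contact time the function \<open>a = \<phi> \<circ> x \<ge> 0\<close> has a minimum, which gives the signs of the normal
  speeds before and after the contact.
\<close>
lemma derivative_at_right_minimum_nonneg:
  fixes a :: "real \<Rightarrow> real"
  assumes "(a has_field_derivative D) (at_right t)" "a t = 0" "\<And>s. a s \<ge> 0"
  shows "D \<ge> 0"
proof (rule tendsto_lowerbound)
  show "((\<lambda>s. (a s - a t) / (s - t)) \<longlongrightarrow> D) (at_right t)"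
    using assms(1) by (simp add: has_field_derivative_iff)
  show "\<forall>\<^sub>F s in at_right t. 0 \<le> (a s - a t) / (s - t)"
    by (rule eventually_mono[OF eventually_at_right_less]) (use assms in auto)
qed simp

lemma derivative_at_left_minimum_nonpos:
  fixes a :: "real \<Rightarrow> real"
  assumes "(a has_field_derivative D) (at_left t)" "a t = 0" "\<And>s. a s \<ge> 0"
  shows "D \<le> 0"
proof (rule tendsto_upperbound)
  show "((\<lambda>s. (a s - a t) / (s - t)) \<longlongrightarrow> D) (at_left t)"
    using assms(1) by (simp add: has_field_derivative_iff)
  have "eventually (\<lambda>s. s < t) (at_left t)" by (simp add: eventually_at_filter)
  then show "\<forall>\<^sub>F s in at_left t. (a s - a t) / (s - t) \<le> 0"
    by eventually_elim (use assms in \<open>auto intro: divide_nonneg_neg\<close>)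
qed simp

lemma normal_speed_at_boundary:
  fixes x :: "real \<Rightarrow> 'a::euclidean_space" and \<phi> :: "'a \<Rightarrow> real"
  assumes d: "(\<phi> has_derivative (\<lambda>y. \<psi> \<bullet> y)) (at (x t))"
    and F: "(x has_vector_derivative w) (at t within S)"
  shows "((\<lambda>s. \<phi> (x s)) has_field_derivative \<psi> \<bullet> w) (at t within S)"
proof -
  have "((\<lambda>s. \<phi> (x s)) has_derivative (\<lambda>h. \<psi> \<bullet> (h *\<^sub>R w))) (at t within S)"
    using has_derivative_compose[OF F[unfolded has_vector_derivative_def] d] .
  moreover have "(\<lambda>h. \<psi> \<bullet> (h *\<^sub>R w)) = (*) (\<psi> \<bullet> w)" by (auto simp: mult.commute)
  ultimately show ?thesis by (simp only: has_field_derivative_def)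
qed

lemma finite_interval_measure:
  assumes m: "\<And>s t. s \<le> t \<Longrightarrow> F s \<le> F t" and rc: "\<And>t. continuous (at_right t) F"
    and b: "\<And>t. \<bar>F t\<bar> \<le> B"
  shows "finite_measure (interval_measure F)"
proof (rule finite_measureI)
  let ?A = "\<lambda>k::nat. {- real k<..real k}"
  have "(\<Union>k. ?A k) = UNIV"
  proof -
    have "\<exists>k. t \<in> ?A k" for t :: real
    proof -
      obtain k :: nat where "\<bar>t\<bar> < real k" using reals_Archimedean2 by blast
      then show ?thesis by (intro exI[of _ k]) auto
    qed
    then show ?thesis by auto
  qed
  moreover have "(SUP k. emeasure (interval_measure F) (?A k)) = emeasure (interval_measure F) (\<Union>k. ?A k)"
    by (rule SUP_emeasure_incseq) (auto simp: incseq_def)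
  ultimately have "emeasure (interval_measure F) UNIV = (SUP k. emeasure (interval_measure F) (?A k))" by simp
  also have "\<dots> \<le> ennreal (2 * B)"
  proof (rule SUP_least)
    fix k
    have "F (real k) - F (- real k) \<le> 2 * B" using b[of "real k"] b[of "- real k"] by linarith
    then show "emeasure (interval_measure F) (?A k) \<le> ennreal (2 * B)"
      by (subst emeasure_interval_measure_Ioc[OF _ m rc]) (auto intro: ennreal_leI)
  qed
  finally show "emeasure (interval_measure F) (space (interval_measure F)) \<noteq> \<infinity>"
    by (auto simp: top_unique)
qed

lemma set_integral_Ioc_split:
  fixes g :: "real \<Rightarrow> 'b::{banach, second_countable_topology}"
  assumes "a \<le> s" "s \<le> t" "sets M = sets borel" "set_integrable M {a<..t} g"
  shows "(LINT r:{a<..t}|M. g r) - (LINT r:{a<..s}|M. g r) = (LINT r:{s<..t}|M. g r)"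
proof -
  have "{a<..t} = {a<..s} \<union> {s<..t}" using assms by auto
  moreover have "(LINT r:{a<..s} \<union> {s<..t}|M. g r) = (LINT r:{a<..s}|M. g r) + (LINT r:{s<..t}|M. g r)"
  proof (rule set_integral_Un)
    show "set_integrable M {a<..s} g" "set_integrable M {s<..t} g"
      using assms(1-3) by (auto intro: set_integrable_subset[OF assms(4)])
  qed auto
  ultimately show ?thesis by simp
qed

context bouncing_scheme
begin

text \<open>
  The measure \<open>lam\<close> has distribution function \<open>\<Lambda>\<close>. That \<open>x\<close> is a primitive of \<open>v\<close>, and that the
  increments of \<open>v\<close> are integrals of \<open>G\<close> and \<open>n\<close>, follows by comparing both sides on short intervals with
  the frozen increments. At a contact time, \<open>v\<close> jumps by a multiple of \<open>n\<close>; this multiple is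
  determined by the signs of the normal speeds and the continuity of \<open>rebound e\<close> along the motion.
\<close>
theorem bouncing_motion_exists:
  obtains x v :: "real \<Rightarrow> 'a" and lam :: "real measure" where
    "x t0 = x0" "v t0 = v0" "continuous_on UNIV x" "\<And>t. \<phi> (x t) \<ge> 0" "\<And>t. x t \<in> cball x0 r"
    "\<And>t. (v \<longlongrightarrow> v t) (at_right t)" "v \<in> borel_measurable borel"
    "bounded (v ` {t0..t0+\<tau>})"
    "bounded_variation_on t0 (t0 + \<tau>) v"
    "\<And>t. t \<in> {t0..t0+\<tau>} \<Longrightarrow> (v has_integral (x t - x t0)) {t0..t}"
    "finite_measure lam" "sets lam = sets borel"
    "\<And>c d. t0 \<le> c \<Longrightarrow> c \<le> d \<Longrightarrow> d \<le> t0 + \<tau> \<Longrightarrow>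
       v d - v c = (LINT s:{c<..d}|lborel. G (s, x s, v s)) + (LINT s:{c<..d}|lam. n (x s))"
    "\<And>t. \<phi> (x t) > 0 \<Longrightarrow> \<exists>\<delta>>0. emeasure lam {t-\<delta><..t+\<delta>} = 0"
    "\<And>t. t0 < t \<Longrightarrow> t < t0 + \<tau> \<Longrightarrow> \<phi> (x t) = 0 \<Longrightarrow> \<exists>vl. (v \<longlongrightarrow> vl) (at_left t) \<and>
       v t = vl - ((1 + e) * ((\<psi> (x t) \<bullet> vl) / (\<psi> (x t) \<bullet> n (x t)))) *\<^sub>R n (x t)"
proof -
  obtain x v :: "real \<Rightarrow> 'a" and \<Lambda> :: "real \<Rightarrow> real" where
    \<Lambda>m: "\<And>s t. s \<le> t \<Longrightarrow> \<Lambda> s \<le> \<Lambda> t" and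
    \<Lambda>rc: "\<And>t. continuous (at_right t) \<Lambda>" and
    before: "\<And>t. t \<le> t0 \<Longrightarrow> \<Lambda> t = 0" and
    after: "\<And>t. t \<ge> t0 + \<tau> \<Longrightarrow> \<Lambda> t = \<Lambda> (t0 + \<tau>)" and
    vrc: "\<And>t. (v \<longlongrightarrow> v t) (at_right t)" and
    vi: "\<And>s t. s \<le> t \<Longrightarrow> norm (v t - v s) \<le> K * ((t - s) + (\<Lambda> t - \<Lambda> s))" and
    ini: "x t0 = x0" "v t0 = v0" and
    xc: "continuous_on UNIV x" and
    xi: "\<And>s t. s \<le> t \<Longrightarrow> norm (x t - x s) \<le> K * (t - s)" and
    xl: "\<And>s t. t0 \<le> s \<Longrightarrow> s \<le> t \<Longrightarrow> t \<le> t0 + \<tau> \<Longrightarrow>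
       norm (x t - x s - (t - s) *\<^sub>R v s) \<le> (t - s) * (K * ((t - s) + (\<Lambda> t - \<Lambda> s)))" and
    vG: "\<And>\<epsilon>. \<epsilon> > 0 \<Longrightarrow> \<exists>C. \<forall>s t. t0 \<le> s \<longrightarrow> s \<le> t \<longrightarrow> t \<le> t0 + \<tau> \<longrightarrow>
        norm (v t - v s - (t - s) *\<^sub>R G (s, x s, v s) - (\<Lambda> t - \<Lambda> s) *\<^sub>R n (x s))
        \<le> (\<epsilon> + C * (t - s)) * ((t - s) + (\<Lambda> t - \<Lambda> s))" and
    reb: "\<And>s t. t0 \<le> s \<Longrightarrow> s \<le> t \<Longrightarrow> t \<le> t0 + \<tau> \<Longrightarrow>
       \<bar>rebound e (\<psi> (x t) \<bullet> v t) - rebound e (\<psi> (x s) \<bullet> v s)\<bar> \<le> 3 * K^3 * (t - s)" and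
    pos: "\<And>t. \<phi> (x t) \<ge> 0" and inb: "\<And>t. x t \<in> cball x0 r" and
    off: "\<And>t. \<phi> (x t) > 0 \<Longrightarrow> \<exists>\<delta>>0. \<Lambda> (t + \<delta>) = \<Lambda> (t - \<delta>)"
    by (rule motion_exists) (rule that)
  define q where "q t = t + \<Lambda> t" for t
  have qd: "(t - s) + (\<Lambda> t - \<Lambda> s) = q t - q s" for s t by (simp add: q_def)
  have q_mono: "q s \<le> q t" if "s \<le> t" for s t unfolding q_def using \<Lambda>m[OF that] that by simp
  have q_ge: "t - s \<le> q t - q s" if "s \<le> t" for s t unfolding q_def using \<Lambda>m[OF that] by simp
  have vq: "norm (v t - v s) \<le> K * (q t - q s)" if "s \<le> t" for s t
    using vi[OF that] unfolding qd .
  have vq': "norm (v t - v s) \<le> K * q t - K * q s" if "s \<le> t" for s t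
    using vq[OF that] by (simp add: algebra_simps)
  have vmeas: "v \<in> borel_measurable borel"
    by (rule borel_measurable_dominated_increments) (rule vq')
  have xmeas: "x \<in> borel_measurable borel" using xc by (rule borel_measurable_continuous_onI)
  have Gmeas: "(\<lambda>s. G (s, x s, v s)) \<in> borel_measurable borel"
    using vmeas xmeas by (intro borel_measurable_continuous_on[OF contG]) measurable
  have nxc: "continuous_on UNIV (\<lambda>s. n (x s))"
    using continuous_on_compose2[OF contn xc] by simp
  have nmeas: "(\<lambda>s. n (x s)) \<in> borel_measurable borel" using nxc by (rule borel_measurable_continuous_onI)
  define R where "R = norm v0 + K * (q (t0 + \<tau>) - q t0)"
  have vR: "norm (v t) \<le> R" if "t0 \<le> t" "t \<le> t0 + \<tau>" for t
  proof -
    have "norm (v t - v t0) \<le> K * (q t - q t0)" by (rule vq[OF that(1)])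
    also have "\<dots> \<le> K * (q (t0 + \<tau>) - q t0)" using q_mono[OF that(2)] K1 by (intro mult_left_mono) auto
    finally show ?thesis using norm_triangle_ineq2[of "v t" "v t0"] unfolding R_def ini by linarith
  qed
  define S where "S = {t0..t0+\<tau>} \<times> cball x0 r \<times> cball (0::'a) R"
  have cS: "compact S" unfolding S_def by (intro compact_Times compact_Icc compact_cball)
  have inS: "(t, x t, v t) \<in> S" if "t0 \<le> t" "t \<le> t0 + \<tau>" for t
    unfolding S_def using that vR[OF that] inb[of t] by simp
  obtain BG where BG: "\<And>p. p \<in> S \<Longrightarrow> norm (G p) \<le> BG"
    using compact_imp_bounded[OF compact_continuous_image[OF continuous_on_subset[OF contG] cS]]
    unfolding bounded_iff by auto
  define lam where "lam = interval_measure \<Lambda>"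
  have lam_sets: "sets lam = sets borel" by (simp add: lam_def)
  have \<Lambda>b: "\<bar>\<Lambda> t\<bar> \<le> \<Lambda> (t0 + \<tau>)" for t
  proof -
    have "0 \<le> \<Lambda> t"
      using before[of t] before[of t0] \<Lambda>m[of t0 t] by (cases "t \<le> t0") auto
    moreover have "\<Lambda> t \<le> \<Lambda> (t0 + \<tau>)"
      using after[of t] \<Lambda>m[of t "t0 + \<tau>"] by (cases "t \<le> t0 + \<tau>") linarith+
    ultimately show ?thesis by simp
  qed
  have lam_fin: "finite_measure lam"
    unfolding lam_def by (rule finite_interval_measure[OF \<Lambda>m \<Lambda>rc \<Lambda>b])
  have lam_Ioc: "measure lam {c<..d} = \<Lambda> d - \<Lambda> c" "emeasure lam {c<..d} = ennreal (\<Lambda> d - \<Lambda> c)" if "c \<le> d" for c d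
    unfolding lam_def using measure_interval_measure_Ioc[OF that \<Lambda>m \<Lambda>rc]
      emeasure_interval_measure_Ioc[OF that \<Lambda>m \<Lambda>rc] by auto
  have bv: "bounded_variation_on t0 (t0 + \<tau>) v"
    unfolding bounded_variation_on_def
  proof (intro exI allI impI)
    fix N :: nat and s assume s: "mono_on {..N} s \<and> s ` {..N} \<subseteq> {t0..t0+\<tau>}"
    have "(\<Sum>i<N. norm (v (s (Suc i)) - v (s i))) \<le> (\<Sum>i<N. K * q (s (Suc i)) - K * q (s i))"
      by (rule sum_mono) (use s in \<open>auto intro!: vq' simp: mono_on_def\<close>)
    also have "\<dots> = K * q (s N) - K * q (s 0)" by (rule sum_lessThan_telescope)
    also have "\<dots> \<le> K * q (t0 + \<tau>) - K * q t0"
      using s K1 by (intro diff_mono mult_left_mono q_mono) (auto simp: image_subset_iff)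
    finally show "(\<Sum>i<N. norm (v (s (Suc i)) - v (s i))) \<le> K * q (t0 + \<tau>) - K * q t0" .
  qed
  have v_int: "v integrable_on {a..b}" if "t0 \<le> a" "b \<le> t0 + \<tau>" for a b
  proof -
    have "set_integrable lborel {a..b} v"
      by (rule set_integrable_bounded[where c = R]) (use that vR vmeas emeasure_bounded_finite[of "{a..b}"] in auto)
    then show ?thesis by (rule set_borel_integral_eq_integral)
  qed
  have hi: "(v has_integral (x t - x t0)) {t0..t}" if t: "t \<in> {t0..t0+\<tau>}" for t
  proof -
    have "x t - integral {t0..t} v = x t0 - integral {t0..t0} v"
    proof (rule constant_if_increments_small[where a = t0 and b = "t0 + \<tau>" and Q = q and
          E = "\<lambda>t. x t - integral {t0..t} v"])
      fix \<epsilon> :: real assume \<epsilon>: "\<epsilon> > 0"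
      have "norm ((x t - integral {t0..t} v) - (x s - integral {t0..s} v)) \<le> (\<epsilon> + (2 * K) * (t - s)) * (q t - q s)"
        if st: "t0 \<le> s" "s \<le> t" "t \<le> t0 + \<tau>" for s t
      proof -
        have c: "integral {t0..s} v + integral {s..t} v = integral {t0..t} v"
          by (rule Henstock_Kurzweil_Integration.integral_combine) (use st v_int in auto)
        have "((\<lambda>r. v r - v s) has_integral (integral {s..t} v - (t - s) *\<^sub>R v s)) (cbox s t)"
          using has_integral_diff[OF integrable_integral[OF v_int[OF st(1,3)]] has_integral_const_real[of "v s" s t]] st by simp
        then have "norm (integral {s..t} v - (t - s) *\<^sub>R v s) \<le> (K * (q t - q s)) * measure lborel (cbox s t)"
        proof (rule has_integral_bound[rotated])
          show "0 \<le> K * (q t - q s)" using K1 q_mono[OF st(2)] by simp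
          fix r assume "r \<in> cbox s t"
          then have r: "s \<le> r" "r \<le> t" by auto
          have "K * (q r - q s) \<le> K * (q t - q s)" using q_mono[OF r(2)] K1 by (intro mult_left_mono) auto
          then show "norm (v r - v s) \<le> K * (q t - q s)" using vq[OF r(1)] by linarith
        qed
        then have 1: "norm (integral {s..t} v - (t - s) *\<^sub>R v s) \<le> (t - s) * (K * (q t - q s))"
          using st by (simp add: mult_ac)
        have 2: "norm (x t - x s - (t - s) *\<^sub>R v s) \<le> (t - s) * (K * (q t - q s))"
          using xl[OF st] unfolding qd .
        have eq: "(x t - integral {t0..t} v) - (x s - integral {t0..s} v)
            = (x t - x s - (t - s) *\<^sub>R v s) - (integral {s..t} v - (t - s) *\<^sub>R v s)"
          using c by (simp add: algebra_simps)
        have "norm ((x t - integral {t0..t} v) - (x s - integral {t0..s} v)) \<le> 2 * ((t - s) * (K * (q t - q s)))"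
          unfolding eq using norm_triangle_ineq4[of "x t - x s - (t - s) *\<^sub>R v s" "integral {s..t} v - (t - s) *\<^sub>R v s"] 1 2
          by linarith
        also have "\<dots> = (2 * K * (t - s)) * (q t - q s)" by simp
        also have "\<dots> \<le> (\<epsilon> + (2 * K) * (t - s)) * (q t - q s)"
          using \<epsilon> q_mono[OF st(2)] by (intro mult_right_mono) auto
        finally show ?thesis .
      qed
      then show "\<exists>C. \<forall>s t. t0 \<le> s \<longrightarrow> s \<le> t \<longrightarrow> t \<le> t0 + \<tau> \<longrightarrow>
          norm ((x t - integral {t0..t} v) - (x s - integral {t0..s} v)) \<le> (\<epsilon> + C * (t - s)) * (q t - q s)"
        by blast
    qed (use t q_mono in auto)
    then have "integral {t0..t} v = x t - x t0" by (simp add: algebra_simps)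
    then show ?thesis using integrable_integral[OF v_int[of t0 t]] t by simp
  qed
  have Gint: "set_integrable lborel {c<..d} (\<lambda>s. G (s, x s, v s))" if "t0 \<le> c" "d \<le> t0 + \<tau>" for c d
    by (rule set_integrable_bounded[where c = BG]) (use that BG[OF inS] Gmeas emeasure_bounded_finite[of "{c<..d}"] in auto)
  interpret lam: finite_measure lam by (rule lam_fin)
  have lam_less: "emeasure lam A < top" for A by (simp add: less_top[symmetric])
  have nint: "set_integrable lam {c<..d} (\<lambda>s. n (x s))" for c d
    by (rule set_integrable_bounded[where c = K])
       (use n_le[OF inb] nmeas lam_less in \<open>auto simp: lam_sets measurable_cong_sets[OF lam_sets refl]\<close>)
  have dv: "v d - v c = (LINT s:{c<..d}|lborel. G (s, x s, v s)) + (LINT s:{c<..d}|lam. n (x s))"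
    if cd: "t0 \<le> c" "c \<le> d" "d \<le> t0 + \<tau>" for c d
  proof -
    define E where "E t = v t - (LINT s:{t0<..t}|lborel. G (s, x s, v s)) - (LINT s:{t0<..t}|lam. n (x s))" for t
    have Ed: "E t - E s = v t - v s - (LINT s:{s<..t}|lborel. G (s, x s, v s)) - (LINT s:{s<..t}|lam. n (x s))"
      if st: "t0 \<le> s" "s \<le> t" "t \<le> t0 + \<tau>" for s t
      using set_integral_Ioc_split[OF st(1,2) _ Gint[OF order_refl st(3)]]
        set_integral_Ioc_split[OF st(1,2) lam_sets nint]
      unfolding E_def by (simp add: algebra_simps)
    have "E d = E c"
    proof (rule constant_if_increments_small[where a = t0 and b = "t0 + \<tau>" and Q = q])
      fix \<epsilon> :: real assume "\<epsilon> > 0"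
      then have \<epsilon>: "\<epsilon> / 3 > 0" by simp
      obtain C where C: "\<And>s t. t0 \<le> s \<Longrightarrow> s \<le> t \<Longrightarrow> t \<le> t0 + \<tau> \<Longrightarrow>
        norm (v t - v s - (t - s) *\<^sub>R G (s, x s, v s) - (\<Lambda> t - \<Lambda> s) *\<^sub>R n (x s))
        \<le> (\<epsilon> / 3 + C * (t - s)) * (q t - q s)"
        using vG[OF \<epsilon>] unfolding qd by blast
      obtain CG where CG: "CG \<ge> 0" "\<And>p p'. p \<in> S \<Longrightarrow> p' \<in> S \<Longrightarrow> norm (G p - G p') \<le> \<epsilon> / 3 + CG * dist p p'"
        using continuous_on_compact_almost_lipschitz[OF continuous_on_subset[OF contG] cS \<epsilon>] by blast
      obtain Cn where Cn: "Cn \<ge> 0" "\<And>p p'. p \<in> cball x0 r \<Longrightarrow> p' \<in> cball x0 r \<Longrightarrow> norm (n p - n p') \<le> \<epsilon> / 3 + Cn * dist p p'"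
        using continuous_on_compact_almost_lipschitz[OF continuous_on_subset[OF contn] compact_cball \<epsilon>] by blast
      have "norm (E t - E s) \<le> (\<epsilon> + (C + 3 * K * CG + Cn * K) * (t - s)) * (q t - q s)"
        if st: "t0 \<le> s" "s \<le> t" "t \<le> t0 + \<tau>" for s t
      proof -
        let ?IG = "LINT s:{s<..t}|lborel. G (s, x s, v s)" and ?In = "LINT s:{s<..t}|lam. n (x s)"
        let ?Gs = "G (s, x s, v s)" and ?ns = "n (x s)"
        have qst: "0 \<le> q t - q s" "t - s \<le> q t - q s" "0 \<le> t - s" using q_mono[OF st(2)] q_ge[OF st(2)] st(2) by auto
        have "norm (?IG - measure lborel {s<..t} *\<^sub>R ?Gs) \<le> measure lborel {s<..t} * (\<epsilon> / 3 + CG * (3 * K * (q t - q s)))"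
        proof (rule set_integral_near_const[OF _ _ Gint[OF st(1,3)]])
          fix \<rho> assume "\<rho> \<in> {s<..t}"
          then have \<rho>: "s \<le> \<rho>" "\<rho> \<le> t" by auto
          have "dist (\<rho>, x \<rho>, v \<rho>) (s, x s, v s) \<le> norm (\<rho> - s) + (norm (x \<rho> - x s) + norm (v \<rho> - v s))"
            unfolding dist_norm using norm_Pair_le[of "x \<rho> - x s" "v \<rho> - v s"]
              norm_Pair_le[of "\<rho> - s" "(x \<rho> - x s, v \<rho> - v s)"] by simp
          also have "\<dots> \<le> K * (q t - q s) + (K * (q t - q s) + K * (q t - q s))"
          proof (intro add_mono)
            have d: "\<rho> - s \<le> q t - q s" using \<rho> qst by simp
            have "1 * (\<rho> - s) \<le> K * (q t - q s)" using d \<rho> K1 by (intro mult_mono) auto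
            then show "norm (\<rho> - s) \<le> K * (q t - q s)" using \<rho> by simp
            show "norm (x \<rho> - x s) \<le> K * (q t - q s)"
              using xi[OF \<rho>(1)] mult_left_mono[OF d, of K] K1 by linarith
            have "K * (q \<rho> - q s) \<le> K * (q t - q s)" using q_mono[OF \<rho>(2)] K1 by (intro mult_left_mono) auto
            then show "norm (v \<rho> - v s) \<le> K * (q t - q s)" using vq[OF \<rho>(1)] by linarith
          qed
          finally have "dist (\<rho>, x \<rho>, v \<rho>) (s, x s, v s) \<le> 3 * K * (q t - q s)" by simp
          then have "CG * dist (\<rho>, x \<rho>, v \<rho>) (s, x s, v s) \<le> CG * (3 * K * (q t - q s))"
            using CG(1) by (rule mult_left_mono)
          moreover have "norm (G (\<rho>, x \<rho>, v \<rho>) - ?Gs) \<le> \<epsilon> / 3 + CG * dist (\<rho>, x \<rho>, v \<rho>) (s, x s, v s)"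
            by (rule CG(2)) (use inS \<rho> st in auto)
          ultimately show "norm (G (\<rho>, x \<rho>, v \<rho>) - ?Gs) \<le> \<epsilon> / 3 + CG * (3 * K * (q t - q s))" by linarith
        qed (use emeasure_bounded_finite[of "{s<..t}"] in auto)
        then have 1: "norm (?IG - (t - s) *\<^sub>R ?Gs) \<le> (t - s) * (\<epsilon> / 3 + CG * (3 * K * (q t - q s)))"
          using st by simp
        have "norm (?In - measure lam {s<..t} *\<^sub>R ?ns) \<le> measure lam {s<..t} * (\<epsilon> / 3 + Cn * (K * (t - s)))"
        proof (rule set_integral_near_const[OF _ _ nint])
          fix \<rho> assume "\<rho> \<in> {s<..t}"
          then have \<rho>: "s \<le> \<rho>" "\<rho> \<le> t" by auto
          have "dist (x \<rho>) (x s) \<le> K * (\<rho> - s)" using xi[OF \<rho>(1)] by (simp add: dist_norm)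
          also have "\<dots> \<le> K * (t - s)" using \<rho> K1 by (intro mult_left_mono) auto
          finally have "Cn * dist (x \<rho>) (x s) \<le> Cn * (K * (t - s))" using Cn(1) by (rule mult_left_mono)
          then show "norm (n (x \<rho>) - ?ns) \<le> \<epsilon> / 3 + Cn * (K * (t - s))"
            using Cn(2)[OF inb inb, of \<rho> s] by linarith
        qed (use lam_less in \<open>auto simp: lam_sets\<close>)
        then have 2: "norm (?In - (\<Lambda> t - \<Lambda> s) *\<^sub>R ?ns) \<le> (\<Lambda> t - \<Lambda> s) * (\<epsilon> / 3 + Cn * (K * (t - s)))"
          using lam_Ioc(1)[OF st(2)] by simp
        have eq: "E t - E s = (v t - v s - (t - s) *\<^sub>R ?Gs - (\<Lambda> t - \<Lambda> s) *\<^sub>R ?ns)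
            - (?IG - (t - s) *\<^sub>R ?Gs) - (?In - (\<Lambda> t - \<Lambda> s) *\<^sub>R ?ns)"
          unfolding Ed[OF st] by simp
        have tri: "norm (a - b - c) \<le> norm a + norm b + norm c" for a b c :: 'a by norm
        have "norm (E t - E s) \<le> norm (v t - v s - (t - s) *\<^sub>R ?Gs - (\<Lambda> t - \<Lambda> s) *\<^sub>R ?ns)
            + norm (?IG - (t - s) *\<^sub>R ?Gs) + norm (?In - (\<Lambda> t - \<Lambda> s) *\<^sub>R ?ns)"
          unfolding eq by (rule tri)
        also have "\<dots> \<le> (\<epsilon> / 3 + C * (t - s)) * (q t - q s)
            + (t - s) * (\<epsilon> / 3 + CG * (3 * K * (q t - q s))) + (\<Lambda> t - \<Lambda> s) * (\<epsilon> / 3 + Cn * (K * (t - s)))"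
          using C[OF st] 1 2 by (intro add_mono)
        also have "\<dots> \<le> (\<epsilon> / 3 + C * (t - s)) * (q t - q s)
            + ((\<epsilon> / 3) * (q t - q s) + 3 * K * CG * (t - s) * (q t - q s))
            + (q t - q s) * (\<epsilon> / 3 + Cn * (K * (t - s)))"
        proof (intro add_mono order_refl)
          have "(t - s) * (\<epsilon> / 3) \<le> (q t - q s) * (\<epsilon> / 3)" using qst \<epsilon> by (intro mult_right_mono) auto
          then show "(t - s) * (\<epsilon> / 3 + CG * (3 * K * (q t - q s)))
              \<le> (\<epsilon> / 3) * (q t - q s) + 3 * K * CG * (t - s) * (q t - q s)"
            by (simp add: algebra_simps)
          have "\<Lambda> t - \<Lambda> s \<le> q t - q s" using st(2) by (simp add: q_def)
          then show "(\<Lambda> t - \<Lambda> s) * (\<epsilon> / 3 + Cn * (K * (t - s))) \<le> (q t - q s) * (\<epsilon> / 3 + Cn * (K * (t - s)))"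
            using \<epsilon> Cn(1) K1 qst by (intro mult_right_mono) auto
        qed
        also have "\<dots> = (\<epsilon> + (C + 3 * K * CG + Cn * K) * (t - s)) * (q t - q s)"
          by (simp add: field_simps)
        finally show ?thesis .
      qed
      then show "\<exists>C. \<forall>s t. t0 \<le> s \<longrightarrow> s \<le> t \<longrightarrow> t \<le> t0 + \<tau> \<longrightarrow>
          norm (E t - E s) \<le> (\<epsilon> + C * (t - s)) * (q t - q s)"
        by blast
    qed (use cd q_mono in auto)
    then show ?thesis using Ed[OF cd] by (simp add: algebra_simps)
  qed
  have impact: "\<exists>vl. (v \<longlongrightarrow> vl) (at_left t) \<and>
       v t = vl - ((1 + e) * ((\<psi> (x t) \<bullet> vl) / (\<psi> (x t) \<bullet> n (x t)))) *\<^sub>R n (x t)"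
    if t: "t0 < t" "t < t0 + \<tau>" and contact_t: "\<phi> (x t) = 0" for t
  proof -
    let ?\<psi> = "\<psi> (x t)" and ?n = "n (x t)"
    obtain vl where vl: "(v \<longlongrightarrow> vl) (at_left t)" using dominated_left_limit[of v "\<lambda>t. K * q t" t] vq' by blast
    have "norm (\<Lambda> t - \<Lambda> s) \<le> \<Lambda> t - \<Lambda> s" if "s \<le> t" for s t using \<Lambda>m[OF that] by simp
    then obtain \<Lambda>l where \<Lambda>l: "(\<Lambda> \<longlongrightarrow> \<Lambda>l) (at_left t)" using dominated_left_limit[of \<Lambda> \<Lambda> t] by blast
    have inside: "\<forall>\<^sub>F s in at_left t. t0 \<le> s \<and> s \<le> t"
      using t by (intro eventually_at_leftI[of t0]) auto
    have below: "\<forall>\<^sub>F s' in at_left t. s \<le> s' \<and> s' \<le> t" if "s < t" for s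
      using that by (intro eventually_at_leftI[of s]) auto
    have id_t: "((\<lambda>s. s) \<longlongrightarrow> t) (at_left t)" by (rule tendsto_ident_at)
    have xt: "(x \<longlongrightarrow> x t) (at_left t)"
      using xc by (simp add: continuous_on_eq_continuous_at continuous_at_imp_continuous_at_within continuous_within[symmetric])
    have \<psi>c: "?\<psi> \<bullet> ?n > 0"
    proof -
      have "\<not> (\<forall>x\<in>cball x0 r. \<phi> x > 0)" using contact_t inb[of t] by force
      then have "?\<psi> \<bullet> ?n \<ge> 1 / K" using contact inb[of t] by blast
      then show ?thesis using K1 by (smt (verit) divide_pos_pos)
    qed
    have ev_t: "((\<lambda>s. (t - s) + (\<Lambda> t - \<Lambda> s)) \<longlongrightarrow> (t - t) + (\<Lambda> t - \<Lambda>l)) (at_left t)"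
      by (intro tendsto_intros id_t \<Lambda>l)
    \<comment> \<open>let \<open>s\<close> tend to \<open>t\<close> from the left in the estimate for increments, then \<open>\<epsilon>\<close> to \<open>0\<close>\<close>
    have jump: "v t - vl = (\<Lambda> t - \<Lambda>l) *\<^sub>R ?n"
    proof -
      have "norm (v t - vl - (\<Lambda> t - \<Lambda>l) *\<^sub>R ?n) \<le> \<epsilon> * (\<Lambda> t - \<Lambda>l)" if \<epsilon>: "\<epsilon> > 0" for \<epsilon>
      proof -
        obtain C where C: "\<And>s t. t0 \<le> s \<Longrightarrow> s \<le> t \<Longrightarrow> t \<le> t0 + \<tau> \<Longrightarrow>
          norm (v t - v s - (t - s) *\<^sub>R G (s, x s, v s) - (\<Lambda> t - \<Lambda> s) *\<^sub>R n (x s))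
          \<le> (\<epsilon> + C * (t - s)) * ((t - s) + (\<Lambda> t - \<Lambda> s))"
          using vG[OF \<epsilon>] by blast
        have Gl: "((\<lambda>s. G (s, x s, v s)) \<longlongrightarrow> G (t, x t, vl)) (at_left t)"
          by (rule continuous_on_tendsto_compose[OF contG]) (auto intro!: tendsto_intros id_t xt vl)
        have nl: "((\<lambda>s. n (x s)) \<longlongrightarrow> ?n) (at_left t)"
          by (rule continuous_on_tendsto_compose[OF contn xt]) auto
        have "norm (v t - vl - (t - t) *\<^sub>R G (t, x t, vl) - (\<Lambda> t - \<Lambda>l) *\<^sub>R ?n)
            \<le> (\<epsilon> + C * (t - t)) * ((t - t) + (\<Lambda> t - \<Lambda>l))"
        proof (rule tendsto_le)
          show "((\<lambda>s. norm (v t - v s - (t - s) *\<^sub>R G (s, x s, v s) - (\<Lambda> t - \<Lambda> s) *\<^sub>R n (x s))) \<longlongrightarrow>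
              norm (v t - vl - (t - t) *\<^sub>R G (t, x t, vl) - (\<Lambda> t - \<Lambda>l) *\<^sub>R ?n)) (at_left t)"
            by (intro tendsto_norm tendsto_diff tendsto_scaleR tendsto_const id_t vl Gl nl \<Lambda>l)
          show "((\<lambda>s. (\<epsilon> + C * (t - s)) * ((t - s) + (\<Lambda> t - \<Lambda> s))) \<longlongrightarrow>
              (\<epsilon> + C * (t - t)) * ((t - t) + (\<Lambda> t - \<Lambda>l))) (at_left t)"
            by (intro tendsto_mult tendsto_add tendsto_diff tendsto_const id_t \<Lambda>l)
          show "\<forall>\<^sub>F s in at_left t. norm (v t - v s - (t - s) *\<^sub>R G (s, x s, v s) - (\<Lambda> t - \<Lambda> s) *\<^sub>R n (x s))
              \<le> (\<epsilon> + C * (t - s)) * ((t - s) + (\<Lambda> t - \<Lambda> s))"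
            using inside by eventually_elim (use C t in auto)
        qed simp
        then show ?thesis by simp
      qed
      then have "norm (v t - vl - (\<Lambda> t - \<Lambda>l) *\<^sub>R ?n) \<le> 0"
      proof -
        assume *: "\<And>\<epsilon>. 0 < \<epsilon> \<Longrightarrow> norm (v t - vl - (\<Lambda> t - \<Lambda>l) *\<^sub>R ?n) \<le> \<epsilon> * (\<Lambda> t - \<Lambda>l)"
        show ?thesis
        proof (rule tendsto_lowerbound)
          show "((\<lambda>\<epsilon>. \<epsilon> * (\<Lambda> t - \<Lambda>l)) \<longlongrightarrow> 0) (at_right 0)"
            by (rule tendsto_eq_intros refl | simp)+
          show "\<forall>\<^sub>F \<epsilon> in at_right 0. norm (v t - vl - (\<Lambda> t - \<Lambda>l) *\<^sub>R ?n) \<le> \<epsilon> * (\<Lambda> t - \<Lambda>l)"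
            by (rule eventually_mono[OF eventually_at_right_less]) (rule *)
        qed simp
      qed
      then show ?thesis by simp
    qed
    have wl: "?\<psi> \<bullet> vl \<le> 0"
    proof (rule derivative_at_left_minimum_nonpos)
      show "((\<lambda>s. \<phi> (x s)) has_field_derivative ?\<psi> \<bullet> vl) (at_left t)"
      proof (rule normal_speed_at_boundary[OF \<phi>_deriv[OF inb]])
        show "(x has_vector_derivative vl) (at_left t)"
          unfolding has_vector_derivative_def
        proof (rule has_derivativeI_sandwich)
          show "0 < t - t0" using t by simp
          show "bounded_linear (\<lambda>h. h *\<^sub>R vl)" by (rule bounded_linear_scaleR_left)
          show "((\<lambda>s. 2 * K * ((t - s) + (\<Lambda>l - \<Lambda> s))) \<longlongrightarrow> 0) (at_left t)"
          proof -
            have "((\<lambda>s. 2 * K * ((t - s) + (\<Lambda>l - \<Lambda> s))) \<longlongrightarrow> 2 * K * ((t - t) + (\<Lambda>l - \<Lambda>l))) (at_left t)"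
              by (intro tendsto_mult tendsto_add tendsto_diff tendsto_const id_t \<Lambda>l)
            then show ?thesis by simp
          qed
          fix s assume s: "s \<in> {..<t}" "s \<noteq> t" "dist s t < t - t0"
          then have st: "s < t" "t0 \<le> s" by (auto simp: dist_real_def)
          \<comment> \<open>The estimate up to \<open>t\<close> itself would involve the jump of \<open>\<Lambda>\<close> at \<open>t\<close>; approaching \<open>t\<close> from the
             left replaces \<open>\<Lambda> t\<close> by the left limit \<open>\<Lambda>l\<close>.\<close>
          have "norm (x t - x s - (t - s) *\<^sub>R v s) \<le> (t - s) * (K * ((t - s) + (\<Lambda>l - \<Lambda> s)))"
          proof (rule tendsto_le)
            show "((\<lambda>s'. norm (x s' - x s - (s' - s) *\<^sub>R v s)) \<longlongrightarrow> norm (x t - x s - (t - s) *\<^sub>R v s)) (at_left t)"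
              by (intro tendsto_norm tendsto_diff tendsto_scaleR tendsto_const id_t xt)
            show "((\<lambda>s'. (s' - s) * (K * ((s' - s) + (\<Lambda> s' - \<Lambda> s)))) \<longlongrightarrow> (t - s) * (K * ((t - s) + (\<Lambda>l - \<Lambda> s)))) (at_left t)"
              by (intro tendsto_mult tendsto_add tendsto_diff tendsto_const id_t \<Lambda>l)
            show "\<forall>\<^sub>F s' in at_left t. norm (x s' - x s - (s' - s) *\<^sub>R v s) \<le> (s' - s) * (K * ((s' - s) + (\<Lambda> s' - \<Lambda> s)))"
              using below[OF st(1)] by eventually_elim (use xl st t in auto)
          qed simp
          moreover have "norm (vl - v s) \<le> K * ((t - s) + (\<Lambda>l - \<Lambda> s))"
          proof (rule tendsto_le)
            show "((\<lambda>s'. norm (v s' - v s)) \<longlongrightarrow> norm (vl - v s)) (at_left t)"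
              by (intro tendsto_norm tendsto_diff tendsto_const vl)
            show "((\<lambda>s'. K * ((s' - s) + (\<Lambda> s' - \<Lambda> s))) \<longlongrightarrow> K * ((t - s) + (\<Lambda>l - \<Lambda> s))) (at_left t)"
              by (intro tendsto_mult tendsto_add tendsto_diff tendsto_const id_t \<Lambda>l)
            show "\<forall>\<^sub>F s' in at_left t. norm (v s' - v s) \<le> K * ((s' - s) + (\<Lambda> s' - \<Lambda> s))"
              using below[OF st(1)] by eventually_elim (use vi in auto)
          qed simp
          then have "norm ((t - s) *\<^sub>R (vl - v s)) \<le> (t - s) * (K * ((t - s) + (\<Lambda>l - \<Lambda> s)))"
            using st by (simp add: mult_left_mono)
          moreover have eq: "x s - x t - (s - t) *\<^sub>R vl = (t - s) *\<^sub>R (vl - v s) - (x t - x s - (t - s) *\<^sub>R v s)"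
            by (simp add: algebra_simps)
          ultimately have "norm (x s - x t - (s - t) *\<^sub>R vl) \<le> 2 * ((t - s) * (K * ((t - s) + (\<Lambda>l - \<Lambda> s))))"
            unfolding eq
            using norm_triangle_ineq4[of "(t - s) *\<^sub>R (vl - v s)" "x t - x s - (t - s) *\<^sub>R v s"] by linarith
          then show "norm (x s - x t - (s - t) *\<^sub>R vl) / norm (s - t) \<le> 2 * K * ((t - s) + (\<Lambda>l - \<Lambda> s))"
            using st by (simp add: divide_le_eq mult_ac)
        qed
      qed
    qed (use contact_t pos in auto)
    have wr: "?\<psi> \<bullet> v t \<ge> 0"
    proof (rule derivative_at_right_minimum_nonneg)
        show "((\<lambda>s. \<phi> (x s)) has_field_derivative ?\<psi> \<bullet> v t) (at_right t)"
        proof (rule normal_speed_at_boundary[OF \<phi>_deriv[OF inb]])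
          show "(x has_vector_derivative v t) (at_right t)"
            unfolding has_vector_derivative_def
          proof (rule has_derivativeI_sandwich)
            show "0 < t0 + \<tau> - t" using t by simp
            show "bounded_linear (\<lambda>h. h *\<^sub>R v t)" by (rule bounded_linear_scaleR_left)
            have "(\<Lambda> \<longlongrightarrow> \<Lambda> t) (at_right t)" using \<Lambda>rc[of t] by (simp add: continuous_within)
            then have "((\<lambda>s. K * ((s - t) + (\<Lambda> s - \<Lambda> t))) \<longlongrightarrow> K * ((t - t) + (\<Lambda> t - \<Lambda> t))) (at_right t)"
              by (intro tendsto_mult tendsto_add tendsto_diff tendsto_const tendsto_ident_at)
            then show "((\<lambda>s. K * ((s - t) + (\<Lambda> s - \<Lambda> t))) \<longlongrightarrow> 0) (at_right t)" by simp
            fix s assume s: "s \<in> {t<..}" "s \<noteq> t" "dist s t < t0 + \<tau> - t"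
            then show "norm (x s - x t - (s - t) *\<^sub>R v t) / norm (s - t) \<le> K * ((s - t) + (\<Lambda> s - \<Lambda> t))"
              using xl[of t s] t by (simp add: divide_le_eq dist_real_def mult_ac)
          qed
        qed
    qed (use contact_t pos in auto)
    \<comment> \<open>\<open>rebound e\<close> of the normal speed is continuous in time, although the normal speed itself jumps\<close>
    have "\<bar>rebound e (?\<psi> \<bullet> v t) - rebound e (?\<psi> \<bullet> vl)\<bar> \<le> 3 * K^3 * (t - t)"
    proof (rule tendsto_le)
      have "((\<lambda>s. \<psi> (x s)) \<longlongrightarrow> ?\<psi>) (at_left t)"
        by (rule continuous_on_tendsto_compose[OF \<psi>_continuous xt]) (use inb in auto)
      then show "((\<lambda>s. \<bar>rebound e (?\<psi> \<bullet> v t) - rebound e (\<psi> (x s) \<bullet> v s)\<bar>) \<longlongrightarrow>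
         \<bar>rebound e (?\<psi> \<bullet> v t) - rebound e (?\<psi> \<bullet> vl)\<bar>) (at_left t)"
        unfolding rebound_def by (intro tendsto_intros vl)
      show "((\<lambda>s. 3 * K^3 * (t - s)) \<longlongrightarrow> 3 * K^3 * (t - t)) (at_left t)"
        by (intro tendsto_intros id_t)
      show "\<forall>\<^sub>F s in at_left t. \<bar>rebound e (?\<psi> \<bullet> v t) - rebound e (\<psi> (x s) \<bullet> v s)\<bar> \<le> 3 * K^3 * (t - s)"
        using inside by eventually_elim (use reb t in auto)
    qed simp
    then have "?\<psi> \<bullet> v t = - e * (?\<psi> \<bullet> vl)"
      using rebound_nonneg[OF e(1) wr] rebound_nonpos[OF e(1) wl] by simp
    moreover have "?\<psi> \<bullet> v t = ?\<psi> \<bullet> vl + (\<Lambda> t - \<Lambda>l) * (?\<psi> \<bullet> ?n)"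
      using arg_cong[OF jump, of "\<lambda>z. ?\<psi> \<bullet> z"] by (simp add: inner_diff_right)
    ultimately have D: "\<Lambda> t - \<Lambda>l = - ((1 + e) * ((?\<psi> \<bullet> vl) / (?\<psi> \<bullet> ?n)))"
      using \<psi>c by (simp add: field_simps)
    have "v t = vl + (\<Lambda> t - \<Lambda>l) *\<^sub>R ?n"
      unfolding jump[symmetric] by simp
    then have "v t = vl - ((1 + e) * ((?\<psi> \<bullet> vl) / (?\<psi> \<bullet> ?n))) *\<^sub>R ?n"
      unfolding D by simp
    then show ?thesis using vl by blast
  qed
  show ?thesis
  proof
    show "\<exists>\<delta>>0. emeasure lam {t-\<delta><..t+\<delta>} = 0" if p: "\<phi> (x t) > 0" for t
    proof -
      obtain \<delta> where \<delta>: "\<delta> > 0" "\<Lambda> (t + \<delta>) = \<Lambda> (t - \<delta>)" using off[OF p] by blast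
      then have "emeasure lam {t-\<delta><..t+\<delta>} = 0" using lam_Ioc(2)[of "t-\<delta>" "t+\<delta>"] by simp
      then show ?thesis using \<delta>(1) by blast
    qed
    show "bounded (v ` {t0..t0+\<tau>})" unfolding bounded_iff using vR by (intro exI[of _ R]) auto
  qed (use ini xc pos inb vrc vmeas bv hi lam_fin lam_sets dv impact in auto)
qed

end

section \<open>Matrices and gradients\<close>

lemma tendsto_matrix_vector_mult:
  fixes A :: "'a \<Rightarrow> real^'n^'m" and b :: "'a \<Rightarrow> real^'n"
  assumes "(A \<longlongrightarrow> A') F" "(b \<longlongrightarrow> b') F"
  shows "((\<lambda>x. A x *v b x) \<longlongrightarrow> A' *v b') F"
  unfolding matrix_vector_mult_def
  by (intro tendsto_vec_lambda tendsto_sum tendsto_mult tendsto_vec_nth assms)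

lemma continuous_on_matrix_vector_mult:
  fixes A :: "'a::topological_space \<Rightarrow> real^'n^'m" and b :: "'a \<Rightarrow> real^'n"
  assumes "continuous_on S A" "continuous_on S b"
  shows "continuous_on S (\<lambda>x. A x *v b x)"
  using assms unfolding continuous_on_def by (auto intro: tendsto_matrix_vector_mult)

lemma continuous_on_det:
  fixes A :: "'a::topological_space \<Rightarrow> real^'n^'n"
  assumes "\<And>i j. continuous_on S (\<lambda>x. A x $ i $ j)"
  shows "continuous_on S (\<lambda>x. det (A x))"
  unfolding det_def by (intro continuous_intros assms)

lemma matrix_inv_inverse:
  fixes A :: "real^'n^'n"
  assumes "invertible A"
  shows "A ** matrix_inv A = mat 1" "matrix_inv A ** A = mat 1"
  using assms someI_ex[of "\<lambda>B. A ** B = mat 1 \<and> B ** A = mat 1"]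
  unfolding invertible_def matrix_inv_def by auto

text \<open>
  By Cramer's rule the components of the solution are quotients of determinants.
\<close>
lemma continuous_on_matrix_inv_mult:
  fixes A :: "'a::topological_space \<Rightarrow> real^'n^'n" and b :: "'a \<Rightarrow> real^'n"
  assumes A: "continuous_on S A" and b: "continuous_on S b" and inv: "\<And>x. x \<in> S \<Longrightarrow> invertible (A x)"
  shows "continuous_on S (\<lambda>x. matrix_inv (A x) *v b x)"
proof -
  have nz: "det (A x) \<noteq> 0" if "x \<in> S" for x
    using inv[OF that] by (simp add: invertible_det_nz)
  have eq: "matrix_inv (A x) *v b x = (\<chi> k. det (\<chi> i j. if j = k then b x $ i else A x $ i $ j) / det (A x))"
    if "x \<in> S" for x
  proof (rule iffD1[OF cramer[OF nz[OF that]]])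
    show "A x *v (matrix_inv (A x) *v b x) = b x"
      using inv[OF that] by (simp add: matrix_vector_mul_assoc matrix_inv_inverse)
  qed
  have comp: "continuous_on S (\<lambda>x. A x $ i $ j)" for i j
    using A by (intro continuous_intros)
  have "continuous_on S (\<lambda>x. (\<chi> k. det (\<chi> i j. if j = k then b x $ i else A x $ i $ j) / det (A x)))"
  proof (intro continuous_on_vec_lambda continuous_on_divide continuous_on_det ballI nz)
    fix i j k
    show "continuous_on S (\<lambda>x. (\<chi> i j. if j = k then b x $ i else A x $ i $ j) $ i $ j)"
      using comp b by (cases "j = k") (auto intro!: continuous_intros)
  qed (use comp in auto)
  then show ?thesis
    by (rule continuous_on_eq) (simp add: eq)
qed

lemma sym_pos_def_invertible:
  assumes "sym_pos_def A" shows "invertible A"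
proof -
  have "x = 0" if "A *v x = 0" for x
    using assms that unfolding sym_pos_def_def by (metis inner_zero_right less_irrefl)
  then obtain B where "B ** A = mat 1" using matrix_left_invertible_ker by blast
  then show ?thesis by (simp add: invertible_left_inverse) blast
qed

lemma sym_pos_def_inv_mult:
  assumes "sym_pos_def A"
  shows "A *v (matrix_inv A *v x) = x" "matrix_inv A *v (A *v x) = x"
  using sym_pos_def_invertible[OF assms]
  by (simp_all add: matrix_vector_mul_assoc matrix_inv_inverse)

lemma sym_pos_def_inv_inner:
  assumes "sym_pos_def A"
  shows "(matrix_inv A *v p) \<bullet> q = p \<bullet> (matrix_inv A *v q)"
proof -
  let ?u = "matrix_inv A *v p" and ?w = "matrix_inv A *v q"
  have "?u \<bullet> (A *v ?w) = (?u v* A) \<bullet> ?w" by (simp add: dot_lmul_matrix)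
  also have "?u v* A = transpose A *v ?u" by simp
  also have "transpose A = A" using assms by (simp add: sym_pos_def_def)
  finally show ?thesis by (simp add: sym_pos_def_inv_mult[OF assms])
qed

lemma sym_pos_def_inv_pos:
  assumes "sym_pos_def A" "q \<noteq> 0"
  shows "q \<bullet> (matrix_inv A *v q) > 0"
proof -
  let ?w = "matrix_inv A *v q"
  have q: "A *v ?w = q" by (rule sym_pos_def_inv_mult[OF assms(1)])
  then have "?w \<noteq> 0" using assms(2) by auto
  then have "?w \<bullet> (A *v ?w) > 0" using assms(1) unfolding sym_pos_def_def by blast
  then show ?thesis unfolding q by (simp add: inner_commute)
qed

lemma frechet_derivative_dcov:
  assumes "g differentiable (at x)"
  shows "(g has_derivative (\<lambda>y. dcov g x \<bullet> y)) (at x)"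
proof -
  let ?D = "frechet_derivative g (at x)"
  have D: "(g has_derivative ?D) (at x)" using assms frechet_derivative_works by blast
  then have lin: "linear ?D" by (rule has_derivative_linear)
  have "?D y = dcov g x \<bullet> y" for y
  proof -
    have "y = (\<Sum>i\<in>UNIV. (y $ i) *\<^sub>R axis i 1)"
      using basis_expansion[of y] by (simp add: scalar_mult_eq_scaleR)
    then have "?D y = ?D (\<Sum>i\<in>UNIV. (y $ i) *\<^sub>R axis i 1)" by simp
    also have "\<dots> = (\<Sum>i\<in>UNIV. (y $ i) * ?D (axis i 1))"
      using lin by (simp add: linear_sum linear_scale)
    finally show ?thesis by (simp add: dcov_def inner_vec_def mult.commute)
  qed
  then have "?D = (\<lambda>y. dcov g x \<bullet> y)" by blast
  then show ?thesis using D by simp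
qed

lemma Ck_on_continuous_on: "Ck_on k f U \<Longrightarrow> continuous_on U f"
  by (cases k) (auto intro!: continuous_at_imp_continuous_on differentiable_imp_continuous_within)

lemma Ck_on_Suc_imp: "Ck_on (Suc k) f U \<Longrightarrow> Ck_on k f U"
proof (induction k arbitrary: f)
  case 0
  then show ?case using Ck_on_continuous_on[of "Suc 0" f U] by simp
next
  case (Suc k)
  have "f differentiable (at x)" if "x \<in> U" for x
    using Suc.prems that by simp
  moreover have "Ck_on (Suc k) (\<lambda>x. frechet_derivative f (at x) v) U" for v
    using Suc.prems unfolding Ck_on.simps(2)[of "Suc k"] by blast
  ultimately show ?case using Suc.IH unfolding Ck_on.simps(2)[of k] by blast
qed

lemma dcov_continuous:
  assumes "Ck_on (Suc k) g U" shows "continuous_on U (dcov g)"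
  unfolding dcov_def[abs_def]
  by (rule continuous_on_vec_lambda, rule Ck_on_continuous_on[of k]) (use assms in simp)

text \<open>
  The mean value inequality, with the maximum of the norm of the gradient as the constant.
\<close>
lemma C1_lipschitz_on_compact_convex:
  fixes g :: "real^'n \<Rightarrow> real"
  assumes g: "Ck_on 1 g UNIV" and S: "compact S" "convex S"
  shows "\<exists>L\<ge>0. \<forall>x\<in>S. \<forall>y\<in>S. \<bar>g x - g y\<bar> \<le> L * norm (x - y)"
proof -
  have diff: "g differentiable (at x)" for x using g by simp
  have "continuous_on S (dcov g)"
    by (rule continuous_on_subset[OF dcov_continuous[of 0]]) (use g in auto)
  then have "bounded (dcov g ` S)"
    using S(1) compact_continuous_image compact_imp_bounded by blast
  then obtain L where L: "L > 0" "\<And>x. x \<in> S \<Longrightarrow> norm (dcov g x) \<le> L"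
    unfolding bounded_pos by auto
  have "norm (g x - g y) \<le> L * norm (x - y)" if "x \<in> S" "y \<in> S" for x y
  proof (rule differentiable_bound[OF S(2)])
    show "(g has_derivative (\<lambda>y. dcov g z \<bullet> y)) (at z within S)" for z
      using frechet_derivative_dcov[OF diff] by (rule has_derivative_at_withinI)
    show "onorm (\<lambda>y. dcov g z \<bullet> y) \<le> L" if "z \<in> S" for z
    proof (rule onorm_le)
      fix y
      show "norm (dcov g z \<bullet> y) \<le> L * norm y"
        using Cauchy_Schwarz_ineq2[of "dcov g z" y] mult_right_mono[OF L(2)[OF that], of "norm y"] by simp
    qed
  qed (use that in auto)
  then show ?thesis using L(1) by (intro exI[of _ L]) auto
qed

lemma C2_gradient_lipschitz:
  fixes g :: "real^'n \<Rightarrow> real"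
  assumes g: "Ck_on 2 g UNIV" and S: "compact S" "convex S"
  shows "\<exists>L\<ge>0. \<forall>x\<in>S. \<forall>y\<in>S. norm (dcov g x - dcov g y) \<le> L * norm (x - y)"
proof -
  have "Ck_on 1 (\<lambda>x. dcov g x $ i) UNIV" for i
    using g by (simp add: dcov_def numeral_2_eq_2)
  then have "\<forall>i. \<exists>L\<ge>0. \<forall>x\<in>S. \<forall>y\<in>S. \<bar>dcov g x $ i - dcov g y $ i\<bar> \<le> L * norm (x - y)"
    using C1_lipschitz_on_compact_convex[OF _ S] by blast
  then obtain L where L: "\<And>i. L i \<ge> 0" "\<And>i x y. x \<in> S \<Longrightarrow> y \<in> S \<Longrightarrow> \<bar>dcov g x $ i - dcov g y $ i\<bar> \<le> L i * norm (x - y)"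
    by metis
  have "norm (dcov g x - dcov g y) \<le> (\<Sum>i\<in>UNIV. L i) * norm (x - y)" if "x \<in> S" "y \<in> S" for x y
  proof -
    have "norm (dcov g x - dcov g y) \<le> (\<Sum>i\<in>UNIV. \<bar>(dcov g x - dcov g y) $ i\<bar>)" by (rule norm_le_l1_cart)
    also have "\<dots> \<le> (\<Sum>i\<in>UNIV. L i * norm (x - y))" by (rule sum_mono) (use L(2)[OF that] in simp)
    finally show ?thesis by (simp add: sum_distrib_right)
  qed
  then show ?thesis using L(1) by (intro exI[of _ "\<Sum>i\<in>UNIV. L i"]) (auto intro: sum_nonneg)
qed

section \<open>Choice of the constants\<close>

text \<open>
  The radius \<open>r\<close> is chosen first. If \<open>\<phi> x0 > 0\<close> the ball avoids the boundary, and if \<open>\<phi> x0 = 0\<close> the vector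
  \<open>n\<close> stays transversal on it. Then \<open>K\<close> is the sum of the bounds on the balls, and \<open>\<tau>\<close> comes last.
\<close>
lemma bouncing_scheme_exists:
  fixes G :: "real \<times> 'a \<times> 'a \<Rightarrow> 'a::euclidean_space" and \<phi> :: "'a \<Rightarrow> real" and \<psi> n :: "'a \<Rightarrow> 'a"
  assumes e: "0 \<le> e" "e \<le> 1"
    and contG: "continuous_on UNIV G" and contn: "continuous_on UNIV n" and cont\<psi>: "continuous_on UNIV \<psi>"
    and lip: "\<And>r. \<exists>L\<ge>0. \<forall>x\<in>cball x0 r. \<forall>y\<in>cball x0 r. norm (\<psi> x - \<psi> y) \<le> L * norm (x - y)"
    and deriv: "\<And>x. (\<phi> has_derivative (\<lambda>y. \<psi> x \<bullet> y)) (at x)"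
    and \<phi>0: "\<phi> x0 \<ge> 0" and contact: "\<phi> x0 = 0 \<Longrightarrow> \<psi> x0 \<bullet> n x0 > 0 \<and> \<psi> x0 \<bullet> v0 \<ge> 0"
    and T: "\<tau>max > 0"
  obtains \<tau> r K where "0 < \<tau>" "\<tau> \<le> \<tau>max" "bouncing_scheme G \<phi> \<psi> n e t0 x0 v0 \<tau> r K"
proof -
  have "\<exists>r c. r > 0 \<and> c > 0 \<and> ((\<forall>x\<in>cball x0 r. \<phi> x > 0) \<or> (\<forall>x\<in>cball x0 r. \<psi> x \<bullet> n x \<ge> c) \<and> \<psi> x0 \<bullet> v0 \<ge> 0)"
  proof (cases "\<phi> x0 = 0")
    case True
    have cont: "continuous_on UNIV (\<lambda>x. \<psi> x \<bullet> n x)" by (intro continuous_intros cont\<psi> contn)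
    have c0: "\<psi> x0 \<bullet> n x0 > 0" using contact[OF True] by simp
    have "open {x. \<psi> x \<bullet> n x > (\<psi> x0 \<bullet> n x0) / 2}"
      by (intro open_Collect_less cont continuous_on_const)
    moreover have "x0 \<in> {x. \<psi> x \<bullet> n x > (\<psi> x0 \<bullet> n x0) / 2}" using c0 by simp
    ultimately obtain r where "r > 0" "cball x0 r \<subseteq> {x. \<psi> x \<bullet> n x > (\<psi> x0 \<bullet> n x0) / 2}"
      unfolding open_contains_cball by blast
    then show ?thesis using c0 contact[OF True]
      by (intro exI[of _ r] exI[of _ "(\<psi> x0 \<bullet> n x0) / 2"]) fastforce
  next
    case False
    have "continuous_on UNIV \<phi>"
      using deriv by (auto intro!: continuous_at_imp_continuous_on has_derivative_continuous)
    then have "open {x. \<phi> x > 0}" by (intro open_Collect_less continuous_on_const)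
    moreover have "x0 \<in> {x. \<phi> x > 0}" using False \<phi>0 by simp
    ultimately obtain r where "r > 0" "cball x0 r \<subseteq> {x. \<phi> x > 0}"
      unfolding open_contains_cball by blast
    then show ?thesis by (intro exI[of _ r] exI[of _ 1]) auto
  qed
  then obtain r c where r: "r > 0" and c: "c > 0"
    and rc: "(\<forall>x\<in>cball x0 r. \<phi> x > 0) \<or> (\<forall>x\<in>cball x0 r. \<psi> x \<bullet> n x \<ge> c) \<and> \<psi> x0 \<bullet> v0 \<ge> 0"
    by blast
  have bnd: "\<exists>B\<ge>0. \<forall>p\<in>S. norm (h p) \<le> B" if "continuous_on UNIV h" "compact S"
    for h :: "'b::metric_space \<Rightarrow> 'a" and S
  proof -
    have "bounded (h ` S)"
      using that compact_continuous_image continuous_on_subset compact_imp_bounded by blast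
    then show ?thesis unfolding bounded_pos by (auto intro: less_imp_le)
  qed
  obtain BG where BG: "BG \<ge> 0" "\<And>p. p \<in> {t0..t0+1} \<times> cball x0 r \<times> cball v0 r \<Longrightarrow> norm (G p) \<le> BG"
    using bnd[OF contG compact_Times[OF compact_Icc compact_Times[OF compact_cball compact_cball]]] by blast
  obtain Bn where Bn: "Bn \<ge> 0" "\<And>x. x \<in> cball x0 r \<Longrightarrow> norm (n x) \<le> Bn"
    using bnd[OF contn compact_cball] by blast
  obtain B\<psi> where B\<psi>: "B\<psi> \<ge> 0" "\<And>x. x \<in> cball x0 r \<Longrightarrow> norm (\<psi> x) \<le> B\<psi>"
    using bnd[OF cont\<psi> compact_cball] by blast
  obtain L where L: "L \<ge> 0" "\<And>x y. x \<in> cball x0 r \<Longrightarrow> y \<in> cball x0 r \<Longrightarrow> norm (\<psi> x - \<psi> y) \<le> L * norm (x - y)"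
    using lip by blast
  define K where "K = 1 + (norm v0 + r) + BG + Bn + B\<psi> + L + 1 / c"
  have Kge: "1 \<le> K" "norm v0 + r \<le> K" "BG \<le> K" "Bn \<le> K" "B\<psi> \<le> K" "L \<le> K" "1 / c \<le> K"
    unfolding K_def using r c BG(1) Bn(1) B\<psi>(1) L(1) by (simp_all add: add_nonneg_nonneg)
  have cK: "1 / K \<le> c" using Kge(1,7) c by (simp add: field_simps)
  define \<tau> where "\<tau> = min (min 1 \<tau>max) (r / (7 * K^5))"
  have K5: "7 * K^5 > 0" using Kge(1) by simp
  have \<tau>: "0 < \<tau>" "\<tau> \<le> 1" "\<tau> \<le> \<tau>max" "\<tau> \<le> r / (7 * K^5)" unfolding \<tau>_def using T r K5 by auto
  have "7 * K^5 * \<tau> \<le> r" using \<tau>(4) K5 by (simp add: pos_le_divide_eq mult.commute)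
  then have "bouncing_scheme G \<phi> \<psi> n e t0 x0 v0 \<tau> r K"
  proof (unfold_locales)
    show "norm (G (t, x, y)) \<le> K" if "t \<in> {t0..t0+\<tau>}" "x \<in> cball x0 r" "y \<in> cball v0 r" for t x y
      using BG(2)[of "(t, x, y)"] Kge(3) \<tau>(2) that by auto
    show "norm (n x) \<le> K" if "x \<in> cball x0 r" for x using Bn(2)[OF that] Kge(4) by linarith
    show "norm (\<psi> x) \<le> K" if "x \<in> cball x0 r" for x using B\<psi>(2)[OF that] Kge(5) by linarith
    show "norm (\<psi> x - \<psi> y) \<le> K * norm (x - y)" if "x \<in> cball x0 r" "y \<in> cball x0 r" for x y
      using L(2)[OF that] mult_right_mono[OF Kge(6), of "norm (x - y)"] by simp
    show "(\<forall>x\<in>cball x0 r. \<phi> x > 0) \<or> (\<forall>x\<in>cball x0 r. \<psi> x \<bullet> n x \<ge> 1 / K) \<and> \<psi> x0 \<bullet> v0 \<ge> 0"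
      using rc cK order_trans by blast
  qed (use e r Kge \<tau> deriv \<phi>0 contG contn in auto)
  then show ?thesis using that \<tau> by blast
qed

section \<open>Densities of vector measures\<close>

text \<open>
  Both summands are absolutely continuous with respect to their sum. This provides a common reference
  measure for the Lebesgue part and the impulsive part of the acceleration.
\<close>
definition sum_measure :: "'a measure \<Rightarrow> 'a measure \<Rightarrow> 'a measure" where
  "sum_measure M N = measure_of (space M) (sets M) (\<lambda>A. emeasure M A + emeasure N A)"

lemma sets_sum_measure [simp]: "sets (sum_measure M N) = sets M"
  and space_sum_measure [simp]: "space (sum_measure M N) = space M"
  by (simp_all add: sum_measure_def)

lemma emeasure_sum_measure:
  assumes "sets N = sets M" "A \<in> sets M"
  shows "emeasure (sum_measure M N) A = emeasure M A + emeasure N A"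
  unfolding sum_measure_def
proof (rule emeasure_measure_of_sigma)
  show "countably_additive (sets M) (\<lambda>A. emeasure M A + emeasure N A)"
  proof (rule countably_additiveI)
    fix B :: "nat \<Rightarrow> 'a set" assume B: "range B \<subseteq> sets M" "disjoint_family B"
    then have "(\<Sum>i. emeasure M (B i)) = emeasure M (\<Union>i. B i)" "(\<Sum>i. emeasure N (B i)) = emeasure N (\<Union>i. B i)"
      using assms(1) by (auto intro!: suminf_emeasure)
    then show "(\<Sum>i. emeasure M (B i) + emeasure N (B i)) = emeasure M (\<Union>i. B i) + emeasure N (\<Union>i. B i)"
      by (simp add: suminf_add[symmetric])
  qed
qed (use assms in \<open>auto simp: positive_def sets.sigma_algebra_axioms\<close>)

lemma has_vm_density_density:
  fixes g :: "real \<Rightarrow> 'a::{banach,second_countable_topology}"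
  assumes "has_vm_density I \<nu> (density m (\<lambda>x. ennreal (D x))) g" "D \<in> borel_measurable m" "\<And>x. 0 \<le> D x"
    and m: "sets m = sets borel"
  shows "has_vm_density I \<nu> m (\<lambda>x. D x *\<^sub>R g x)"
  unfolding has_vm_density_def
proof (intro ballI impI)
  fix B assume B: "B \<in> sets borel" "B \<subseteq> I"
  let ?h = "\<lambda>x. indicator B x *\<^sub>R g x"
  have int: "integrable (density m (\<lambda>x. ennreal (D x))) ?h"
    and val: "\<nu> B = integral\<^sup>L (density m (\<lambda>x. ennreal (D x))) ?h"
    using assms(1) B unfolding has_vm_density_def set_integrable_def set_lebesgue_integral_def by auto
  have meas: "?h \<in> borel_measurable m"
    using borel_measurable_integrable[OF int] by (simp add: measurable_cong_sets[OF sets_density refl])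
  have eq: "(\<lambda>x. D x *\<^sub>R ?h x) = (\<lambda>x. indicator B x *\<^sub>R (D x *\<^sub>R g x))" by (simp add: mult.commute)
  have "integrable m (\<lambda>x. D x *\<^sub>R ?h x)"
    using int integrable_density[OF meas assms(2)] assms(3) by simp
  moreover have "\<nu> B = integral\<^sup>L m (\<lambda>x. D x *\<^sub>R ?h x)"
    unfolding val by (rule integral_density[OF meas assms(2)]) (use assms(3) in simp)
  ultimately show "set_integrable m B (\<lambda>x. D x *\<^sub>R g x) \<and> \<nu> B = (LINT x:B|m. D x *\<^sub>R g x)"
    unfolding set_integrable_def set_lebesgue_integral_def eq by simp
qed

lemma has_vm_density_restrict:
  fixes g :: "real \<Rightarrow> 'a::{banach,second_countable_topology}"
  assumes "has_vm_density I \<nu> m g" "I \<in> sets borel" and m: "sets m = sets borel"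
  shows "has_vm_density I \<nu> (density m (\<lambda>x. ennreal (indicator I x))) g"
  unfolding has_vm_density_def
proof (intro ballI impI)
  fix B assume B: "B \<in> sets borel" "B \<subseteq> I"
  let ?h = "\<lambda>x. indicator B x *\<^sub>R g x"
  have int: "integrable m ?h" and val: "\<nu> B = integral\<^sup>L m ?h"
    using assms(1) B unfolding has_vm_density_def set_integrable_def set_lebesgue_integral_def by auto
  have meas: "?h \<in> borel_measurable m" using borel_measurable_integrable[OF int] .
  have ind: "(indicator I :: real \<Rightarrow> real) \<in> borel_measurable m" using assms(2) m by simp
  have eq: "(\<lambda>x. indicator I x *\<^sub>R ?h x) = ?h"
    using B by (intro ext) (auto split: split_indicator)
  have "integrable (density m (\<lambda>x. ennreal (indicator I x))) ?h"
    using int integrable_density[OF meas ind] unfolding eq by simp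
  moreover have "integral\<^sup>L (density m (\<lambda>x. ennreal (indicator I x))) ?h = integral\<^sup>L m ?h"
    using integral_density[OF meas ind] unfolding eq by simp
  ultimately show "set_integrable (density m (\<lambda>x. ennreal (indicator I x))) B g \<and>
      \<nu> B = (LINT x:B|density m (\<lambda>x. ennreal (indicator I x)). g x)"
    unfolding set_integrable_def set_lebesgue_integral_def val by simp
qed

lemma has_vm_density_add:
  fixes g1 g2 :: "real \<Rightarrow> 'a::{banach,second_countable_topology}"
  assumes "has_vm_density I \<nu>1 m g1" "has_vm_density I \<nu>2 m g2"
  shows "has_vm_density I (\<lambda>B. \<nu>1 B + \<nu>2 B) m (\<lambda>x. g1 x + g2 x)"
  using assms unfolding has_vm_density_def by (auto intro: set_integral_add)

lemma has_vm_density_vector_measure: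
  fixes g :: "real \<Rightarrow> 'a::{banach,second_countable_topology}"
  assumes \<nu>: "has_vm_density I \<nu> m g" and I: "I \<in> sets borel" and m: "sets m = sets borel"
  shows "vector_measure_on I \<nu>"
  unfolding vector_measure_on_def
proof (intro conjI allI impI)
  have val: "\<nu> B = (LINT s:B|m. g s)" "set_integrable m B g" if "B \<in> sets borel" "B \<subseteq> I" for B
    using \<nu> that unfolding has_vm_density_def by auto
  show "\<nu> {} = 0" using val(1)[of "{}"] by (simp add: set_lebesgue_integral_def)
  fix A :: "nat \<Rightarrow> real set"
  assume A: "disjoint_family A \<and> (\<forall>n. A n \<in> sets borel \<and> A n \<subseteq> I)"
  let ?P = "\<lambda>k. \<Union>i<k. A i"
  have P: "?P k \<in> sets borel" "?P k \<subseteq> I" for k using A by auto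
  have sum: "(\<Sum>i<k. \<nu> (A i)) = (LINT s:?P k|m. g s)" for k
  proof (induction k)
    case (Suc k)
    have "?P (Suc k) = ?P k \<union> A k" by (auto simp: lessThan_Suc)
    moreover have "?P k \<inter> A k = {}"
    proof -
      have "A i \<inter> A k = {}" if "i < k" for i
        using A that by (intro disjoint_family_onD[of A UNIV]) auto
      then show ?thesis by blast
    qed
    ultimately have "(LINT s:?P (Suc k)|m. g s) = (LINT s:?P k|m. g s) + (LINT s:A k|m. g s)"
      using val(2)[OF P, of k] val(2)[of "A k"] A by (simp add: set_integral_Un)
    then show ?case using Suc val(1)[of "A k"] A by simp
  qed (simp add: set_lebesgue_integral_def)
  have U: "(\<Union>k. ?P k) = (\<Union>n. A n)" by auto
  have A_Un: "(\<Union>n. A n) \<in> sets borel" "(\<Union>n. A n) \<subseteq> I" using A by auto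
  have "(\<lambda>k. LINT s:?P k|m. g s) \<longlonglongrightarrow> (LINT s:(\<Union>k. ?P k)|m. g s)"
  proof (rule set_integral_cont_up)
    show "?P k \<in> sets m" for k using P m by simp
    show "incseq ?P" by (auto simp: incseq_def intro: less_le_trans)
    show "set_integrable m (\<Union>k. ?P k) g" unfolding U by (rule val(2)[OF A_Un])
  qed
  then show "(\<lambda>n. \<nu> (A n)) sums \<nu> (\<Union>n. A n)"
    unfolding sums_def sum U val(1)[OF A_Un] .
qed

text \<open>
  Multiplying a vector measure by a matrix function requires a density with respect to one finite
  measure. Here it is the sum of \<open>lam\<close> and of Lebesgue measure on \<open>I\<close>; the Radon-Nikodym densities
  \<open>D1\<close> and \<open>D2\<close> of the summands are scalar and commute with the matrices.
\<close>
lemma is_matrix_times_vm_sum: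
  fixes A :: "real \<Rightarrow> real^'n^'n" and g k :: "real \<Rightarrow> real^'n"
  assumes lam: "finite_measure lam" "sets lam = sets borel"
    and I: "I \<in> sets borel" "emeasure lborel I < \<infinity>"
    and "has_vm_density I \<nu> lborel g" "has_vm_density I \<nu>' lam k"
    and "has_vm_density I \<kappa> lborel (\<lambda>s. A s *v g s)" "has_vm_density I \<kappa>' lam (\<lambda>s. A s *v k s)"
  shows "is_matrix_times_vm I (\<lambda>B. \<kappa> B + \<kappa>' B) A (\<lambda>B. \<nu> B + \<nu>' B)"
    and "vector_measure_on I (\<lambda>B. \<nu> B + \<nu>' B)"
proof -
  define l where "l = density lborel (\<lambda>x. ennreal (indicator I x))"
  define m where "m = sum_measure l lam"
  have l_sets: "sets l = sets borel" unfolding l_def by simp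
  have m_sets: "sets m = sets borel" unfolding m_def using l_sets by simp
  have "emeasure l (space l) = emeasure lborel I"
    unfolding l_def using I(1) by (simp add: emeasure_density ennreal_indicator)
  then have l_fin: "finite_measure l" using I(2) by (intro finite_measureI) auto
  have em: "emeasure m B = emeasure l B + emeasure lam B" if "B \<in> sets borel" for B
    unfolding m_def by (rule emeasure_sum_measure) (use that l_sets lam(2) in auto)
  have "finite_measure m"
  proof (rule finite_measureI)
    have "emeasure m UNIV = emeasure l UNIV + emeasure lam UNIV" by (rule em) simp
    then show "emeasure m (space m) \<noteq> \<infinity>"
      using finite_measure.emeasure_finite[OF l_fin] finite_measure.emeasure_finite[OF lam(1)]
        sets_eq_imp_space_eq[OF m_sets] by simp
  qed
  then interpret m: finite_measure m .
  have ac: "absolutely_continuous m l" "absolutely_continuous m lam"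
    unfolding absolutely_continuous_def null_sets_def using em m_sets l_sets lam(2) by auto
  have dens: "\<exists>D. D \<in> borel_measurable m \<and> (\<forall>x. 0 \<le> D x) \<and> density m (\<lambda>x. ennreal (D x)) = N"
    if N: "finite_measure N" "absolutely_continuous m N" "sets N = sets m" for N
  proof -
    obtain D where D: "D \<in> borel_measurable m" "AE x in m. RN_deriv m N x = ennreal (D x)" "\<And>x. 0 \<le> D x"
      using m.real_RN_deriv[OF N] by metis
    have "density m (\<lambda>x. ennreal (D x)) = density m (RN_deriv m N)"
      by (rule density_cong) (use D in auto)
    then show ?thesis using m.density_RN_deriv[OF N(2,3)] D by auto
  qed
  obtain D1 where D1: "D1 \<in> borel_measurable m" "\<And>x. 0 \<le> D1 x" "density m (\<lambda>x. ennreal (D1 x)) = l"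
    using dens[OF l_fin ac(1)] l_sets m_sets by auto
  obtain D2 where D2: "D2 \<in> borel_measurable m" "\<And>x. 0 \<le> D2 x" "density m (\<lambda>x. ennreal (D2 x)) = lam"
    using dens[OF lam(1) ac(2)] lam(2) m_sets by auto
  have 1: "has_vm_density I \<nu>0 m (\<lambda>x. D1 x *\<^sub>R h x)" if "has_vm_density I \<nu>0 lborel h" for \<nu>0 and h :: "real \<Rightarrow> real^'n"
    by (rule has_vm_density_density[OF _ D1(1,2) m_sets], unfold D1(3) l_def)
       (rule has_vm_density_restrict[OF that I(1)], simp)
  have 2: "has_vm_density I \<nu>0 m (\<lambda>x. D2 x *\<^sub>R h x)" if "has_vm_density I \<nu>0 lam h" for \<nu>0 and h :: "real \<Rightarrow> real^'n"
    by (rule has_vm_density_density[OF _ D2(1,2) m_sets], unfold D2(3)) (rule that)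
  have \<nu>_dens: "has_vm_density I (\<lambda>B. \<nu> B + \<nu>' B) m (\<lambda>x. D1 x *\<^sub>R g x + D2 x *\<^sub>R k x)"
    by (intro has_vm_density_add 1 2 assms)
  have "has_vm_density I (\<lambda>B. \<kappa> B + \<kappa>' B) m (\<lambda>x. D1 x *\<^sub>R (A x *v g x) + D2 x *\<^sub>R (A x *v k x))"
    by (intro has_vm_density_add 1 2 assms)
  then have "has_vm_density I (\<lambda>B. \<kappa> B + \<kappa>' B) m (\<lambda>x. A x *v (D1 x *\<^sub>R g x + D2 x *\<^sub>R k x))"
    by (simp add: matrix_vector_right_distrib matrix_vector_mult_scaleR)
  then show "is_matrix_times_vm I (\<lambda>B. \<kappa> B + \<kappa>' B) A (\<lambda>B. \<nu> B + \<nu>' B)"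
    unfolding is_matrix_times_vm_def using m.finite_measure_axioms m_sets \<nu>_dens by blast
  show "vector_measure_on I (\<lambda>B. \<nu> B + \<nu>' B)"
    by (rule has_vm_density_vector_measure[OF \<nu>_dens I(1) m_sets])
qed

lemma has_vm_density_bounded:
  fixes g :: "real \<Rightarrow> 'a::{banach,second_countable_topology}"
  assumes "sets m = sets borel" "emeasure m I < \<infinity>" "I \<in> sets borel" "g \<in> borel_measurable borel" "bounded (g ` I)"
  shows "has_vm_density I (\<lambda>B. LINT s:B|m. g s) m g"
  unfolding has_vm_density_def
proof (intro ballI impI conjI refl)
  fix B assume B: "B \<in> sets borel" "B \<subseteq> I"
  obtain c where "\<And>s. s \<in> I \<Longrightarrow> norm (g s) \<le> c" using assms(5) unfolding bounded_iff by auto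
  moreover have "emeasure m B \<le> emeasure m I" using B assms(1,3) by (intro emeasure_mono) auto
  ultimately show "set_integrable m B g"
    using assms B by (intro set_integrable_bounded[where c = c])
      (auto simp: measurable_cong_sets[OF assms(1) refl])
qed

text \<open>
  The velocity has jumps, so the composition is merely measurable; it is bounded because the states
  stay in a compact set.
\<close>
lemma bounded_along_motion:
  fixes h :: "real \<times> 'a::euclidean_space \<times> 'a \<Rightarrow> 'b::euclidean_space" and x v :: "real \<Rightarrow> 'a"
  assumes h: "continuous_on UNIV h" and x: "continuous_on UNIV x"
    and v: "v \<in> borel_measurable borel" "bounded (v ` {a..b})"
  shows "(\<lambda>s. h (s, x s, v s)) \<in> borel_measurable borel"
    and "bounded ((\<lambda>s. h (s, x s, v s)) ` {a<..<b})"
proof -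
  have "x \<in> borel_measurable borel" using x by (rule borel_measurable_continuous_onI)
  then show "(\<lambda>s. h (s, x s, v s)) \<in> borel_measurable borel"
    using v(1) by (intro borel_measurable_continuous_on[OF h]) measurable
  obtain R where R: "\<And>s. s \<in> {a..b} \<Longrightarrow> norm (v s) \<le> R" using v(2) unfolding bounded_iff by blast
  define S where "S = {a..b} \<times> x ` {a..b} \<times> cball (0::'a) R"
  have "compact (x ` {a..b})"
    by (rule compact_continuous_image) (auto intro: continuous_on_subset[OF x])
  then have "compact S" unfolding S_def by (intro compact_Times compact_Icc compact_cball)
  then have "bounded (h ` S)"
    using compact_continuous_image continuous_on_subset[OF h] compact_imp_bounded by blast
  moreover have "(\<lambda>s. h (s, x s, v s)) ` {a<..<b} \<subseteq> h ` S"
    unfolding S_def using R by (auto intro!: imageI)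
  ultimately show "bounded ((\<lambda>s. h (s, x s, v s)) ` {a<..<b})" by (rule bounded_subset)
qed

section \<open>Existence for the impact problem\<close>

theorem corollary9p2:
  fixes T e :: real
    and K :: "(real^'n) set"
    and \<phi> :: "real^'n \<Rightarrow> real"
    and M :: "real^'n \<Rightarrow> real^'n^'n"
    and f :: "real \<Rightarrow> real^'n \<Rightarrow> real^'n \<Rightarrow> real^'n"
  assumes "T > 0" and "0 \<le> e" and "e \<le> 1"
    and "closed K" and "interior K \<noteq> {}"
    and "C3_hypersurface (frontier K)" and "on_one_side_of_boundary K"
    and "Ck_on 3 \<phi> UNIV"
    and "K = {x. \<phi> x \<ge> 0}" and "frontier K = {x. \<phi> x = 0}"
    and "\<forall>x\<in>frontier K. dcov \<phi> x \<noteq> 0"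
    and "Ck_on 3 M UNIV" and "\<forall>x. sym_pos_def (M x)"
    and "continuous_on ({0..T} \<times> UNIV \<times> UNIV) (\<lambda>(t, x, q). f t x q)"
    and "local_lipschitz {0..T} UNIV (\<lambda>t (x, q). f t x q)"
  shows "\<forall>(t0, u0, p0)\<in>admissible_data T K \<phi> M.
           \<exists>\<tau>>0. t0 + \<tau> \<le> T \<and> (\<exists>u. impact_solution e K \<phi> M f t0 u0 p0 \<tau> u)"
proof (intro ballI, clarify)
  fix t0 u0 p0 assume "(t0, u0, p0) \<in> admissible_data T K \<phi> M"
  then have t0: "0 \<le> t0" "t0 < T" and u0: "u0 \<in> K"
    and adm: "u0 \<in> frontier K \<Longrightarrow> dual_inner M u0 p0 (dcov \<phi> u0) \<ge> 0"
    by (auto simp: admissible_data_def)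
  note K_eq = assms(9) and bdry = assms(10)
  have spd: "sym_pos_def (M x)" for x using assms(13) by blast
  have contM: "continuous_on UNIV M" by (rule Ck_on_continuous_on[OF assms(12)])
  have \<phi>2: "Ck_on 2 \<phi> UNIV"
    using Ck_on_Suc_imp[of 2 \<phi> UNIV] assms(8) by (simp only: numeral_3_eq_3 numeral_2_eq_2)
  have \<phi>_diff: "\<phi> differentiable (at x)" for x using assms(8) by (simp add: numeral_3_eq_3)
  have contd: "continuous_on UNIV (dcov \<phi>)"
    by (rule dcov_continuous[of 2]) (use assms(8) in \<open>simp only: numeral_3_eq_3 numeral_2_eq_2\<close>)
  define n where "n x = matrix_inv (M x) *v dcov \<phi> x" for x
  \<comment> \<open>the force is extended to all times by its values at the end points \<open>0\<close> and \<open>T\<close>\<close>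
  define ff where "ff = (\<lambda>(t, x, y). f (max 0 (min T t)) x (M x *v y))"
  define G where "G = (\<lambda>(t, x, y). matrix_inv (M x) *v ff (t, x, y))"
  define v0 where "v0 = matrix_inv (M u0) *v p0"
  have contn: "continuous_on UNIV n"
    unfolding n_def[abs_def]
    by (intro continuous_on_matrix_inv_mult contM contd sym_pos_def_invertible spd)
  have contM': "continuous_on UNIV (\<lambda>z::real \<times> (real^'n) \<times> (real^'n). M (fst (snd z)))"
    by (rule continuous_on_compose2[OF contM]) (auto intro!: continuous_intros)
  have contff: "continuous_on UNIV ff"
  proof -
    have "continuous_on UNIV (\<lambda>z. (\<lambda>(t, x, q). f t x q) (max 0 (min T (fst z)), fst (snd z), M (fst (snd z)) *v snd (snd z)))"
    proof (rule continuous_on_compose2[OF assms(14)])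
      show "continuous_on UNIV (\<lambda>z. (max 0 (min T (fst z)), fst (snd z), M (fst (snd z)) *v snd (snd z)))"
        by (intro continuous_intros continuous_on_matrix_vector_mult contM')
    qed (use assms(1) in auto)
    then show ?thesis unfolding ff_def by (simp add: case_prod_unfold)
  qed
  have contG: "continuous_on UNIV G"
    unfolding G_def case_prod_unfold prod.collapse
    by (intro continuous_on_matrix_inv_mult contM' contff sym_pos_def_invertible spd)
  have MG: "M x *v G (t, x, y) = ff (t, x, y)" for t x y
    unfolding G_def using sym_pos_def_inv_mult(1)[OF spd] by simp
  have Mn: "M x *v n x = dcov \<phi> x" for x
    unfolding n_def by (rule sym_pos_def_inv_mult(1)[OF spd])
  have lip: "\<exists>L\<ge>0. \<forall>x\<in>cball u0 r. \<forall>y\<in>cball u0 r. norm (dcov \<phi> x - dcov \<phi> y) \<le> L * norm (x - y)" for r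
    by (rule C2_gradient_lipschitz[OF \<phi>2 compact_cball convex_cball])
  have \<phi>u0: "\<phi> u0 \<ge> 0" using u0 K_eq by blast
  have contact: "dcov \<phi> u0 \<bullet> n u0 > 0 \<and> dcov \<phi> u0 \<bullet> v0 \<ge> 0" if "\<phi> u0 = 0"
  proof
    have fr: "u0 \<in> frontier K" using that bdry by blast
    then have "dcov \<phi> u0 \<noteq> 0" using assms(11) by blast
    then show "dcov \<phi> u0 \<bullet> n u0 > 0" unfolding n_def by (rule sym_pos_def_inv_pos[OF spd])
    show "dcov \<phi> u0 \<bullet> v0 \<ge> 0"
      using adm[OF fr] sym_pos_def_inv_inner[OF spd, of u0 p0 "dcov \<phi> u0"]
      unfolding dual_inner_def v0_def by (simp add: inner_commute)
  qed
  have "0 < T - t0" using t0 by simp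
  then obtain \<tau> r C where \<tau>: "0 < \<tau>" "\<tau> \<le> T - t0"
    and scheme: "bouncing_scheme G \<phi> (dcov \<phi>) n e t0 u0 v0 \<tau> r C"
    using bouncing_scheme_exists[OF assms(2,3) contG contn contd lip
        frechet_derivative_dcov[OF \<phi>_diff] \<phi>u0 contact, of "T - t0" t0] by blast
  obtain u v :: "real \<Rightarrow> real^'n" and lam where
    ini: "u t0 = u0" "v t0 = v0" and uc: "continuous_on UNIV u" and pos: "\<And>t. \<phi> (u t) \<ge> 0" and
    vrc: "\<And>t. (v \<longlongrightarrow> v t) (at_right t)" and vm: "v \<in> borel_measurable borel" and
    vb: "bounded (v ` {t0..t0+\<tau>})" and
    bv: "bounded_variation_on t0 (t0 + \<tau>) v" and
    prim: "\<And>t. t \<in> {t0..t0+\<tau>} \<Longrightarrow> (v has_integral (u t - u t0)) {t0..t}" and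
    lam: "finite_measure lam" "sets lam = sets borel" and
    dv: "\<And>c d. t0 \<le> c \<Longrightarrow> c \<le> d \<Longrightarrow> d \<le> t0 + \<tau> \<Longrightarrow>
       v d - v c = (LINT s:{c<..d}|lborel. G (s, u s, v s)) + (LINT s:{c<..d}|lam. n (u s))" and
    off: "\<And>t. \<phi> (u t) > 0 \<Longrightarrow> \<exists>\<delta>>0. emeasure lam {t-\<delta><..t+\<delta>} = 0" and
    impact: "\<And>t. t0 < t \<Longrightarrow> t < t0 + \<tau> \<Longrightarrow> \<phi> (u t) = 0 \<Longrightarrow> \<exists>vl. (v \<longlongrightarrow> vl) (at_left t) \<and>
       v t = vl - ((1 + e) * ((dcov \<phi> (u t) \<bullet> vl) / (dcov \<phi> (u t) \<bullet> n (u t)))) *\<^sub>R n (u t)"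
    by (rule bouncing_scheme.bouncing_motion_exists[OF scheme]) (rule that)
  define I where "I = {t0<..<t0+\<tau>}"
  define p where "p t = M (u t) *v v t" for t
  define \<mu> where "\<mu> B = (LINT s:B|lam. dcov \<phi> (u s))" for B
  define F where "F B = (LINT s:B|lborel. ff (s, u s, v s))" for B
  define ddu where "ddu B = (LINT s:B|lborel. G (s, u s, v s)) + (LINT s:B|lam. n (u s))" for B
  have I: "I \<in> sets borel" "emeasure lborel I < \<infinity>" "emeasure lam I < \<infinity>"
    unfolding I_def using emeasure_bounded_finite[of "{t0<..<t0+\<tau>}"] finite_measure.emeasure_finite[OF lam(1)]
    by (auto simp: less_top[symmetric])
  note along = bounded_along_motion[OF _ uc vm vb, folded I_def]
  have F_dens: "has_vm_density I F lborel (\<lambda>s. ff (s, u s, v s))"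
    unfolding F_def[abs_def] by (rule has_vm_density_bounded) (use I along[OF contff] in auto)
  have G_dens: "has_vm_density I (\<lambda>B. LINT s:B|lborel. G (s, u s, v s)) lborel (\<lambda>s. G (s, u s, v s))"
    by (rule has_vm_density_bounded) (use I along[OF contG] in auto)
  have lam_dens: "has_vm_density I (\<lambda>B. LINT s:B|lam. h (u s)) lam (\<lambda>s. h (u s))"
    if "continuous_on UNIV h" for h :: "real^'n \<Rightarrow> real^'n"
  proof (rule has_vm_density_bounded)
    have "continuous_on UNIV (\<lambda>z::real \<times> (real^'n) \<times> (real^'n). h (fst (snd z)))"
      by (rule continuous_on_compose2[OF that]) (auto intro!: continuous_intros)
    from along[OF this] show "(\<lambda>s. h (u s)) \<in> borel_measurable borel" "bounded ((\<lambda>s. h (u s)) ` I)" by simp_all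
  qed (use I lam in auto)
  have \<mu>_dens: "has_vm_density I \<mu> lam (\<lambda>s. dcov \<phi> (u s))"
    unfolding \<mu>_def[abs_def] by (rule lam_dens[OF contd])
  note sum = is_matrix_times_vm_sum[where A = "\<lambda>s. M (u s)" and \<nu> = "\<lambda>B. LINT s:B|lborel. G (s, u s, v s)"
      and \<nu>' = "\<lambda>B. LINT s:B|lam. n (u s)" and \<kappa> = F and \<kappa>' = \<mu>, OF lam I(1,2) G_dens lam_dens[OF contn],
      unfolded MG Mn, OF F_dens \<mu>_dens, folded ddu_def]
  have Mu: "((\<lambda>s. M (u s)) \<longlongrightarrow> M (u t)) (at t within S)" for t S
  proof -
    have "(u \<longlongrightarrow> u t) (at t)" using uc unfolding continuous_on_def by blast
    then have "(u \<longlongrightarrow> u t) (at t within S)" by (rule tendsto_within_subset) simp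
    then show ?thesis by (rule continuous_on_tendsto_compose[OF contM]) auto
  qed
  have p_right: "(p \<longlongrightarrow> p t) (at_right t)" for t
    unfolding p_def[abs_def] by (rule tendsto_matrix_vector_mult[OF Mu vrc])
  have law: "impact_law e \<phi> M (u t) p t" if t: "t \<in> {t0<..<t0+\<tau>}" and fr: "u t \<in> frontier K" for t
  proof -
    have "\<phi> (u t) = 0" using fr bdry by blast
    then obtain vl where vl: "(v \<longlongrightarrow> vl) (at_left t)"
      and jump: "v t = vl - ((1 + e) * ((dcov \<phi> (u t) \<bullet> vl) / (dcov \<phi> (u t) \<bullet> n (u t)))) *\<^sub>R n (u t)"
      using impact[of t] t by auto
    have "(p \<longlongrightarrow> M (u t) *v vl) (at_left t)"
      unfolding p_def[abs_def] by (rule tendsto_matrix_vector_mult[OF Mu vl])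
    then have left: "Lim (at_left t) p = M (u t) *v vl" by (intro tendsto_Lim) simp_all
    have right: "Lim (at_right t) p = M (u t) *v v t"
      using p_right[of t] unfolding p_def by (intro tendsto_Lim) simp_all
    have "M (u t) *v v t = M (u t) *v vl - ((1 + e) * ((dcov \<phi> (u t) \<bullet> vl) / (dcov \<phi> (u t) \<bullet> n (u t)))) *\<^sub>R dcov \<phi> (u t)"
      unfolding jump by (simp add: matrix_vector_mult_diff_distrib matrix_vector_mult_scaleR Mn)
    then show ?thesis
      unfolding impact_law_def left right dual_inner_def sym_pos_def_inv_mult(2)[OF spd] n_def .
  qed
  have supp: "vm_support {t0<..<t0+\<tau>} \<mu> \<subseteq> {t. \<phi> (u t) = 0}"
  proof
    fix t assume t: "t \<in> vm_support {t0<..<t0+\<tau>} \<mu>"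
    show "t \<in> {t. \<phi> (u t) = 0}"
    proof (rule ccontr)
      assume "t \<notin> {t. \<phi> (u t) = 0}"
      then have "\<phi> (u t) > 0" using pos[of t] by simp
      then obtain \<delta> where \<delta>: "\<delta> > 0" "emeasure lam {t-\<delta><..t+\<delta>} = 0" using off by blast
      then have "open {t-\<delta><..<t+\<delta>}" "t \<in> {t-\<delta><..<t+\<delta>}" by auto
      with t obtain B where B: "B \<in> sets borel" "B \<subseteq> {t-\<delta><..<t+\<delta>} \<inter> {t0<..<t0+\<tau>}" "\<mu> B \<noteq> 0"
        unfolding vm_support_def by blast
      have "emeasure lam B \<le> emeasure lam {t-\<delta><..t+\<delta>}"
        using B lam(2) by (intro emeasure_mono) auto
      then have "B \<in> null_sets lam" using \<delta> B(1) lam(2) by (auto simp: null_sets_def)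
      then have "AE s in lam. s \<notin> B" by (rule AE_not_in)
      then have "\<mu> B = 0"
        unfolding \<mu>_def set_lebesgue_integral_def by (intro integral_eq_zero_AE) (auto elim: eventually_mono)
      then show False using B(3) by simp
    qed
  qed
  have deriv: "is_derivative_measure t0 (t0+\<tau>) ddu v"
    unfolding is_derivative_measure_def
  proof (intro conjI allI impI)
    show "vector_measure_on {t0<..<t0+\<tau>} ddu" using sum(2) unfolding I_def ddu_def[abs_def] .
    fix c d assume cd: "t0 < c \<and> c \<le> d \<and> d < t0 + \<tau>"
    have "Lim (at_right s) v = v s" for s using vrc by (intro tendsto_Lim) simp_all
    then show "ddu {c<..d} = Lim (at_right d) v - Lim (at_right c) v"
      using dv[of c d] cd unfolding ddu_def by simp
  qed
  have F_dens': "has_vm_density {t0<..<t0+\<tau>} F lborel (\<lambda>t. f t (u t) (p t))"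
  proof -
    have eq: "ff (s, u s, v s) = f s (u s) (p s)" if "s \<in> I" for s
      using that t0 \<tau> unfolding ff_def p_def I_def by simp
    have int: "set_integrable lborel B (\<lambda>s. ff (s, u s, v s)) = set_integrable lborel B (\<lambda>s. f s (u s) (p s))"
      if "B \<subseteq> I" for B
      by (intro set_integrable_cong refl) (use that eq in auto)
    have val: "(LINT s:B|lborel. ff (s, u s, v s)) = (LINT s:B|lborel. f s (u s) (p s))"
      if "B \<in> sets borel" "B \<subseteq> I" for B
      by (intro set_lebesgue_integral_cong) (use that eq in auto)
    show ?thesis
      unfolding has_vm_density_def I_def[symmetric]
    proof (intro ballI impI)
      fix B assume B: "B \<in> sets borel" "B \<subseteq> I"
      then have "set_integrable lborel B (\<lambda>s. ff (s, u s, v s)) \<and> F B = (LINT s:B|lborel. ff (s, u s, v s))"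
        using F_dens unfolding has_vm_density_def by blast
      then show "set_integrable lborel B (\<lambda>t. f t (u t) (p t)) \<and> F B = (LINT s:B|lborel. f s (u s) (p s))"
        unfolding int[OF B(2)] val[OF B] .
    qed
  qed
  have "impact_solution e K \<phi> M f t0 u0 p0 \<tau> u"
    unfolding impact_solution_def
  proof (intro conjI exI)
    show "continuous_on {t0..t0+\<tau>} u" using uc by (rule continuous_on_subset) simp
    show "u ` {t0..t0+\<tau>} \<subseteq> K" using pos unfolding K_eq by blast
    show "bounded_variation_on t0 (t0+\<tau>) v" by (rule bv)
    show "\<forall>t\<in>{t0..t0+\<tau>}. (v has_integral (u t - u t0)) {t0..t}" using prim by blast
    show "p = (\<lambda>t. M (u t) *v v t)" by (simp add: p_def[abs_def])
    show "is_derivative_measure t0 (t0+\<tau>) ddu v" by (rule deriv)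
    show "is_matrix_times_vm {t0<..<t0+\<tau>} (\<lambda>B. F B + \<mu> B) (\<lambda>t. M (u t)) ddu"
      using sum(1) unfolding I_def ddu_def[abs_def] .
    show "vector_measure_on {t0<..<t0+\<tau>} \<mu>"
      using has_vm_density_vector_measure[OF \<mu>_dens I(1) lam(2)] unfolding I_def .
    show "has_vm_density {t0<..<t0+\<tau>} F lborel (\<lambda>t. f t (u t) (p t))" by (rule F_dens')
    show "\<forall>B\<in>sets borel. B \<subseteq> {t0<..<t0+\<tau>} \<longrightarrow> F B + \<mu> B = \<mu> B + F B" by (simp add: add.commute)
    show "vm_support {t0<..<t0+\<tau>} \<mu> \<subseteq> {t. \<phi> (u t) = 0}" by (rule supp)
    show "finite_measure lam" "sets lam = sets borel" by (rule lam)+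
    show "has_vm_density {t0<..<t0+\<tau>} \<mu> lam (\<lambda>t. dcov \<phi> (u t))" using \<mu>_dens unfolding I_def .
    show "\<forall>t\<in>{t0<..<t0+\<tau>}. u t \<in> frontier K \<longrightarrow> impact_law e \<phi> M (u t) p t" using law by blast
    show "u t0 = u0" by (rule ini)
    have "p t0 = p0" unfolding p_def ini v0_def by (rule sym_pos_def_inv_mult(1)[OF spd])
    then show "(p \<longlongrightarrow> p0) (at_right t0)" using p_right[of t0] by simp
  qed
  then show "\<exists>\<tau>>0. t0 + \<tau> \<le> T \<and> (\<exists>u. impact_solution e K \<phi> M f t0 u0 p0 \<tau> u)"
    using \<tau> by (intro exI[of _ \<tau>]) auto
qed

end
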